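(* Let $(X,\|\cdot\|,\tau)$ be a sequentially complete C-sequential Saks space. Let $(A,D(A))$ be a linear operator on $X$, $\omega\in\mathbb R$ and $M\ge1$. Then the following assertions are equivalent. (a) $A$ is the bi-generator of a locally $\tau$-bi-continuous and exponentially bounded semigroup $(S(t))_{t\ge0}$ on $X$ such that $\|S(t)\|_{\mathcal L(X)}\le Me^{\omega t}$ for all $t\ge0$. (b) $A$ is bi-closed, bi-densely defined, $(\omega,\infty)\subseteq\rho_{\|\cdot\|}(A)$ with $$\sup_{\lambda>\omega,\,m\in\mathbb N}\|(\lambda-\omega)^mR(\lambda,A)^m\|_{\mathcal L(X)}\le M,$$ and the family $\bigl((s-\alpha)^mR(s,A)^m\bigr)_{s>\alpha,\,m\in\mathbb N}$ is bi-equicontinuous for all $\alpha>\omega$.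
   Context: Linear spaces are over $\mathbb R$ or $\mathbb C$; $\mathbb N=\{1,2,\dots\}$. For a normed space $(X,\|\cdot\|)$, $\tau_{\|\cdot\|}$ is the norm topology and $\mathcal L(X)$ the bounded linear operators with the operator norm. Saks space: a triple $(X,\|\cdot\|,\tau)$ where $(X,\|\cdot\|)$ is a normed space and $\tau\subseteq\tau_{\|\cdot\|}$ is a Hausdorff locally convex topology on $X$ such that some directed system of seminorms $\mathcal P_\tau$ generating $\tau$ satisfies $\|x\|=\sup_{p\in\mathcal P_\tau}p(x)$ for all $x\in X$. Its mixed topology $\gamma$ is the finest linear topology on $X$ that coincides with $\tau$ on $\|\cdot\|$-bounded sets and satisfies $\tau\subseteq\gamma\subseteq\tau_{\|\cdot\|}$; it is Hausdorff locally convex. The Saks space is sequentially complete if $(X,\gamma)$ is sequentially complete, and C-sequential if $(X,\gamma)$ is C-sequential, i.e. every convex sequentially open subset of $(X,\gamma)$ is open ($U$ is sequentially open if every sequence converging to a point of $U$ is eventually in $U$). A family $(T_j)_{j\in J}$ of linear maps $X\to X$ is bi-equicontinuous if for every $\|\cdot\|$-bounded sequence $(x_n)$ in $X$ and $x\in X$ with $x_n\to x$ w.r.t. $\tau$ one has $\tau$-$\lim_{n\to\infty}T_j(x_n-x)=0$ uniformly for $j\in J$. A semigroup $(S(t))_{t\ge0}$ on $X$ consists of linear maps with $S(0)=\mathrm{id}$, $S(t)S(s)=S(t+s)$. It is locally $\tau$-bi-continuous if all $S(t)\in\mathcal L(X)$, $t\mapsto S(t)x$ is $\tau$-continuous for every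 $x\in X$, and for every compact $N\subseteq[0,\infty)$ one has $\sup_{t\in N}\|S(t)\|_{\mathcal L(X)}<\infty$ and $(S(t))_{t\in N}$ is bi-equicontinuous. It is exponentially bounded if $\sup_{t\ge0}\|e^{\alpha t}S(t)\|_{\mathcal L(X)}<\infty$ for some $\alpha\in\mathbb R$. Its bi-generator is the operator $Ax:=\tau\text{-}\lim_{t\to0+}\frac1t(S(t)x-x)$ with domain $D(A)$ the set of all $x\in X$ such that this limit exists and $\sup_{t\in(0,1]}\frac1t\|S(t)x-x\|<\infty$. A linear operator $(A,D(A))$ on $X$ is bi-closed if for each sequence $(x_i)$ in $D(A)$ with $(x_i)$, $(Ax_i)$ $\|\cdot\|$-bounded and $x_i\to x$, $Ax_i\to y$ w.r.t. $\tau$ for some $x,y\in X$ one has $x\in D(A)$ and $Ax=y$. It is bi-densely defined if for every $x\in X$ there is a $\|\cdot\|$-bounded sequence $(x_i)$ in $D(A)$ with $x_i\to x$ w.r.t. $\tau$. $\rho_{\|\cdot\|}(A)$ is the set of scalars $\lambda$ such that $\lambda-A\colon D(A)\to X$ is bijective with $R(\lambda,A):=(\lambda-A)^{-1}\in\mathcal L(X)$. *)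

theory Defs
  imports "HOL-Analysis.Analysis"
begin

text \<open>
  Spaces over \<open>\<real>\<close> and \<open>\<complex>\<close> are treated at once: the scalars form a type \<open>'k\<close> of class
  \<open>real_normed_field\<close>. By the Gelfand--Mazur theorem \<open>\<real>\<close> and \<open>\<complex>\<close> are, up to isometric
  isomorphism, the only such fields. The space \<open>X\<close> is the type \<open>'a\<close>, not assumed complete, and
  \<open>smul\<close> extends its real scalar multiplication; for real scalars \<open>smul\<close> is \<open>scaleR\<close>.
\<close>

locale normed_space_over = vector_space smul
  for smul :: "'k::real_normed_field \<Rightarrow> 'a::real_normed_vector \<Rightarrow> 'a" +
  assumes norm_smul: "norm (smul c x) = norm c * norm x"
    and smul_of_real: "smul (of_real r) x = r *\<^sub>R x"


subsection \<open>Saks spaces and the mixed topology\<close>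

definition seminorm :: "('k::real_normed_field \<Rightarrow> 'a::real_normed_vector \<Rightarrow> 'a) \<Rightarrow> ('a \<Rightarrow> real) \<Rightarrow> bool"
  where "seminorm smul p \<longleftrightarrow>
    (\<forall>x y. p (x + y) \<le> p x + p y) \<and> (\<forall>c x. p (smul c x) = norm c * p x)"

definition directed_system :: "('a \<Rightarrow> real) set \<Rightarrow> bool"
  where "directed_system P \<longleftrightarrow>
    P \<noteq> {} \<and> (\<forall>p\<in>P. \<forall>q\<in>P. \<exists>r\<in>P. \<forall>x. p x \<le> r x \<and> q x \<le> r x)"

definition seminorm_topology :: "('a::real_normed_vector \<Rightarrow> real) set \<Rightarrow> 'a topology"
  where "seminorm_topology P =
    topology_generated_by {{y. p (y - x) < e} | p x e. p \<in> P \<and> e > 0}"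

definition coarser :: "'a topology \<Rightarrow> 'a topology \<Rightarrow> bool"
  where "coarser T T' \<longleftrightarrow> (\<forall>U. openin T U \<longrightarrow> openin T' U)"

text \<open>Local convexity of \<open>\<tau>\<close> is part of its being generated by seminorms. The norm topology is
  \<open>euclidean\<close>.\<close>

locale saks_space = normed_space_over smul
  for smul :: "'k::real_normed_field \<Rightarrow> 'a::real_normed_vector \<Rightarrow> 'a" +
  fixes \<tau> :: "'a topology"
  assumes coarser_norm: "coarser \<tau> euclidean"
    and Hausdorff: "Hausdorff_space \<tau>"
    and norming_seminorms:
      "\<exists>P. (\<forall>p\<in>P. seminorm smul p) \<and> directed_system P \<and> \<tau> = seminorm_topology P \<and>
           (\<forall>x. bdd_above ((\<lambda>p. p x) ` P) \<and> norm x = (SUP p\<in>P. p x))"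

definition linear_topology ::
    "('k::real_normed_field \<Rightarrow> 'a::real_normed_vector \<Rightarrow> 'a) \<Rightarrow> 'a topology \<Rightarrow> bool"
  where "linear_topology smul T \<longleftrightarrow>
    topspace T = UNIV \<and>
    continuous_map (prod_topology T T) T (\<lambda>(x, y). x + y) \<and>
    continuous_map (prod_topology euclidean T) T (\<lambda>(c, x). smul c x)"

definition mixed_admissible ::
    "('k::real_normed_field \<Rightarrow> 'a::real_normed_vector \<Rightarrow> 'a) \<Rightarrow> 'a topology \<Rightarrow> 'a topology \<Rightarrow> bool"
  where "mixed_admissible smul \<tau> \<gamma> \<longleftrightarrow>
    linear_topology smul \<gamma> \<and>
    (\<forall>B. bounded B \<longrightarrow> subtopology \<gamma> B = subtopology \<tau> B) \<and>
    coarser \<tau> \<gamma> \<and> coarser \<gamma> euclidean"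

definition mixed_topology ::
    "('k::real_normed_field \<Rightarrow> 'a::real_normed_vector \<Rightarrow> 'a) \<Rightarrow> 'a topology \<Rightarrow> 'a topology"
  where "mixed_topology smul \<tau> =
    (THE \<gamma>. mixed_admissible smul \<tau> \<gamma> \<and>
         (\<forall>\<gamma>'. mixed_admissible smul \<tau> \<gamma>' \<longrightarrow> coarser \<gamma>' \<gamma>))"

text \<open>Cauchy sequences are those of the translation-invariant uniformity of a linear topology.\<close>

definition seq_complete :: "'a::real_normed_vector topology \<Rightarrow> bool"
  where "seq_complete T \<longleftrightarrow>
    (\<forall>x :: nat \<Rightarrow> 'a.
      (\<forall>U. openin T U \<and> 0 \<in> U \<longrightarrow> (\<exists>N. \<forall>m\<ge>N. \<forall>n\<ge>N. x m - x n \<in> U)) \<longrightarrow>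
      (\<exists>l. limitin T x l sequentially))"

definition seq_open :: "'a topology \<Rightarrow> 'a set \<Rightarrow> bool"
  where "seq_open T U \<longleftrightarrow>
    (\<forall>(x :: nat \<Rightarrow> 'a) l. l \<in> U \<and> limitin T x l sequentially \<longrightarrow>
      (\<forall>\<^sub>F n in sequentially. x n \<in> U))"

definition C_sequential :: "'a::real_normed_vector topology \<Rightarrow> bool"
  where "C_sequential T \<longleftrightarrow> (\<forall>U. convex U \<and> seq_open T U \<longrightarrow> openin T U)"


subsection \<open>Bi-continuous semigroups and their generators\<close>

definition bi_equicontinuous :: "'a::real_normed_vector topology \<Rightarrow> 'j set \<Rightarrow> ('j \<Rightarrow> 'a \<Rightarrow> 'a) \<Rightarrow> bool"
  where "bi_equicontinuous \<tau> J T \<longleftrightarrow>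
    (\<forall>(x :: nat \<Rightarrow> 'a) l. bounded (range x) \<and> limitin \<tau> x l sequentially \<longrightarrow>
      (\<forall>U. openin \<tau> U \<and> 0 \<in> U \<longrightarrow> (\<forall>\<^sub>F n in sequentially. \<forall>j\<in>J. T j (x n - l) \<in> U)))"

text \<open>Membership in \<open>\<L>(X)\<close>; its norm is \<open>onorm\<close>.\<close>

definition bounded_operator ::
    "('k::real_normed_field \<Rightarrow> 'a::real_normed_vector \<Rightarrow> 'a) \<Rightarrow> ('a \<Rightarrow> 'a) \<Rightarrow> bool"
  where "bounded_operator smul T \<longleftrightarrow> Vector_Spaces.linear smul smul T \<and> bounded_linear T"

text \<open>Only the values of \<open>S\<close> on \<open>{0..}\<close> matter, here and below.\<close>

definition operator_semigroup ::
    "('k::real_normed_field \<Rightarrow> 'a::real_normed_vector \<Rightarrow> 'a) \<Rightarrow> (real \<Rightarrow> 'a \<Rightarrow> 'a) \<Rightarrow> bool"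
  where "operator_semigroup smul S \<longleftrightarrow>
    (\<forall>t\<ge>0. Vector_Spaces.linear smul smul (S t)) \<and>
    S 0 = id \<and> (\<forall>t\<ge>0. \<forall>s\<ge>0. S (t + s) = S t \<circ> S s)"

definition locally_bi_continuous ::
    "('k::real_normed_field \<Rightarrow> 'a::real_normed_vector \<Rightarrow> 'a) \<Rightarrow> 'a topology \<Rightarrow>
     (real \<Rightarrow> 'a \<Rightarrow> 'a) \<Rightarrow> bool"
  where "locally_bi_continuous smul \<tau> S \<longleftrightarrow>
    (\<forall>t\<ge>0. bounded_operator smul (S t)) \<and>
    (\<forall>x. continuous_map (top_of_set {0..}) \<tau> (\<lambda>t. S t x)) \<and>
    (\<forall>N. compact N \<and> N \<subseteq> {0..} \<longrightarrow>
      bdd_above ((\<lambda>t. onorm (S t)) ` N) \<and> bi_equicontinuous \<tau> N S)"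

definition exponentially_bounded :: "(real \<Rightarrow> 'a::real_normed_vector \<Rightarrow> 'a) \<Rightarrow> bool"
  where "exponentially_bounded S \<longleftrightarrow>
    (\<exists>\<alpha>::real. bdd_above ((\<lambda>t. onorm (\<lambda>x. exp (\<alpha> * t) *\<^sub>R S t x)) ` {0..}))"

text \<open>An operator \<open>(A, D(A))\<close> is a total function \<open>A\<close> together with a set \<open>D\<close>; the values of \<open>A\<close>
  outside \<open>D\<close> are irrelevant.\<close>

definition bi_generator ::
    "'a::real_normed_vector topology \<Rightarrow> (real \<Rightarrow> 'a \<Rightarrow> 'a) \<Rightarrow> 'a set \<Rightarrow> ('a \<Rightarrow> 'a) \<Rightarrow> bool"
  where "bi_generator \<tau> S D A \<longleftrightarrow>
    D = {x. (\<exists>y. limitin \<tau> (\<lambda>t. (1 / t) *\<^sub>R (S t x - x)) y (at_right 0)) \<and>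
            bdd_above ((\<lambda>t. (1 / t) * norm (S t x - x)) ` {0<..1})} \<and>
    (\<forall>x\<in>D. limitin \<tau> (\<lambda>t. (1 / t) *\<^sub>R (S t x - x)) (A x) (at_right 0))"


subsection \<open>Linear operators\<close>

definition linear_operator ::
    "('k::real_normed_field \<Rightarrow> 'a::real_normed_vector \<Rightarrow> 'a) \<Rightarrow> 'a set \<Rightarrow> ('a \<Rightarrow> 'a) \<Rightarrow> bool"
  where "linear_operator smul D A \<longleftrightarrow>
    module.subspace smul D \<and>
    (\<forall>x\<in>D. \<forall>y\<in>D. A (x + y) = A x + A y) \<and>
    (\<forall>c. \<forall>x\<in>D. A (smul c x) = smul c (A x))"

definition bi_closed :: "'a::real_normed_vector topology \<Rightarrow> 'a set \<Rightarrow> ('a \<Rightarrow> 'a) \<Rightarrow> bool"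
  where "bi_closed \<tau> D A \<longleftrightarrow>
    (\<forall>(u :: nat \<Rightarrow> 'a) x y.
      range u \<subseteq> D \<and> bounded (range u) \<and> bounded (range (\<lambda>i. A (u i))) \<and>
      limitin \<tau> u x sequentially \<and> limitin \<tau> (\<lambda>i. A (u i)) y sequentially \<longrightarrow>
      x \<in> D \<and> A x = y)"

definition bi_densely_defined :: "'a::real_normed_vector topology \<Rightarrow> 'a set \<Rightarrow> bool"
  where "bi_densely_defined \<tau> D \<longleftrightarrow>
    (\<forall>x. \<exists>u :: nat \<Rightarrow> 'a. range u \<subseteq> D \<and> bounded (range u) \<and> limitin \<tau> u x sequentially)"

definition resolvent ::
    "('k::real_normed_field \<Rightarrow> 'a::real_normed_vector \<Rightarrow> 'a) \<Rightarrow> 'a set \<Rightarrow> ('a \<Rightarrow> 'a) \<Rightarrow> 'k \<Rightarrow> 'a \<Rightarrow> 'a"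
  where "resolvent smul D A l = the_inv_into D (\<lambda>x. smul l x - A x)"

definition resolvent_set ::
    "('k::real_normed_field \<Rightarrow> 'a::real_normed_vector \<Rightarrow> 'a) \<Rightarrow> 'a set \<Rightarrow> ('a \<Rightarrow> 'a) \<Rightarrow> 'k set"
  where "resolvent_set smul D A =
    {l. bij_betw (\<lambda>x. smul l x - A x) D UNIV \<and> bounded_operator smul (resolvent smul D A l)}"

end

theory Submission
  imports Defs
begin

text \<open>
  Sequential completeness of the mixed topology enters only through the convergence of bounded
  \<open>\<tau>\<close>-Cauchy sequences, so everything is reduced to estimates of the norming seminorms along
  sequences; no vector-valued integral is used.

  For a semigroup \<open>S\<close> and \<open>V t = exp (- l * t) S t\<close> the Laplace transform \<open>R\<close> is replaced by the
  solution operators \<open>Rh h\<close> of \<open>y - V h y = h x\<close>, which are Neumann series in \<open>V h\<close> and converge to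
  \<open>R\<close> along \<open>h = 1 / 2 ^ n\<close>. A bound \<open>p (S t x) \<le> c exp (\<alpha> t)\<close> for all \<open>t\<close> gives the same
  bound for \<open>R x\<close> with \<open>c / (l - \<alpha>)\<close>; iterating this yields the norm estimates and the
  bi-equicontinuity of the powers.

  Conversely, the implicit Euler steps \<open>J n = (1 - h A)\<^sup>-\<^sup>1\<close> with \<open>h = 1 / 2 ^ (n + n0)\<close> produce
  \<open>S t x\<close> as the limit of \<open>(J n)\<^sup>k x\<close>, \<open>k = \<lfloor>t / h\<rfloor>\<close>. Halving the step size costs
  \<open>O(h)\<close> in norm on the domain of \<open>A\<^sup>2\<close>, and bi-density together with bi-equicontinuity extends the
  convergence to all \<open>x\<close> in the topology \<open>\<tau>\<close>. The generator of \<open>S\<close> extends \<open>A\<close>, and the two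
  agree since \<open>l - A\<close> is onto while \<open>l\<close> minus the generator is injective.
\<close>

section \<open>The mixed topology\<close>

text \<open>The obstacle is that bi-equicontinuity is a statement about sequences and does not come
  as an inequality \<open>p (T x) \<le> q x\<close>, so it cannot be iterated directly. Its
  substitute is a bound on the orbit of one vector,
  \<open>p (S t x) \<le> c exp (\<alpha> t)\<close> or the analogue for Euler powers. Such a bound
  passes to the constructed operators with explicit constants; the sequential hypothesis serves only
  to make c small, along a given null sequence or by contradiction. Two growth rates occur. Norm
  estimates keep \<omega> and M exactly. For a semigroup the seminorm estimates use some \<alpha> >
  \<omega>, because equicontinuity covers bounded time intervals only, and later times are absorbed
  by comparing \<open>exp (\<omega> t)\<close> with \<open>exp (\<alpha> t)\<close>. Dyadic steps
  make every finer step divide every coarser one, so that discretisations are related by exact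
  algebraic identities. As X need not be norm complete, even norm-Cauchy sequences get their limits
  from \<tau>.\<close>

locale seminorm_family = normed_space_over smul
  for smul :: "'k::real_normed_field \<Rightarrow> 'a::real_normed_vector \<Rightarrow> 'a" +
  fixes P :: "('a \<Rightarrow> real) set"
  assumes seminorms: "p \<in> P \<Longrightarrow> seminorm smul p"
    and directed: "directed_system P"
begin

lemma sn_triangle: "p \<in> P \<Longrightarrow> p (x + y) \<le> p x + p y"
  and sn_smul: "p \<in> P \<Longrightarrow> p (smul c x) = norm c * p x"
  using seminorms unfolding seminorm_def by blast+

lemma sn_scaleR: "p \<in> P \<Longrightarrow> p (r *\<^sub>R x) = \<bar>r\<bar> * p x"
  by (metis norm_of_real sn_smul smul_of_real)

lemma sn_zero: "p \<in> P \<Longrightarrow> p 0 = 0"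
  by (metis abs_zero mult_zero_left scaleR_zero_left sn_scaleR)

lemma sn_minus: "p \<in> P \<Longrightarrow> p (- x) = p x"
  using sn_scaleR[of p "-1" x] by simp

lemma sn_commute: "p \<in> P \<Longrightarrow> p (x - y) = p (y - x)"
  by (metis minus_diff_eq sn_minus)

lemma sn_nonneg: "p \<in> P \<Longrightarrow> 0 \<le> p x"
  using sn_triangle[of p x "- x"] by (simp add: sn_minus sn_zero)

lemma sn_triangle_diff: "p \<in> P \<Longrightarrow> p (x - z) \<le> p (x - y) + p (y - z)"
  by (metis diff_add_cancel diff_add_eq add_diff_eq sn_triangle)

lemma sn_diff: "p \<in> P \<Longrightarrow> p (x - y) \<le> p x + p y"
  using sn_triangle[of p x "- y"] by (simp add: sn_minus)

lemma sn_le: "p \<in> P \<Longrightarrow> p x \<le> p y + p (x - y)"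
  by (metis add.commute diff_add_cancel sn_triangle)

lemma sn_sum: "p \<in> P \<Longrightarrow> p (\<Sum>i\<in>I. f i) \<le> (\<Sum>i\<in>I. p (f i))"
proof (induction I rule: infinite_finite_induct)
  case (insert i I)
  then show ?case
    using sn_triangle[of p "f i" "\<Sum>i\<in>I. f i"] by simp
qed (auto simp: sn_zero)

abbreviation \<tau>P where "\<tau>P \<equiv> seminorm_topology P"

lemma openin_sn_ball: "p \<in> P \<Longrightarrow> openin \<tau>P {y. p (y - x) < e}"
proof (cases "e > 0")
  case False
  assume "p \<in> P"
  then have "{y. p (y - x) < e} = {}"
    using False by (auto simp: not_less intro: order_trans[OF _ sn_nonneg])
  then show ?thesis by simp
next
  case True
  assume "p \<in> P"
  then show ?thesis unfolding seminorm_topology_def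
    using True by (intro topology_generated_by_Basis) blast
qed

text \<open>Directedness serves the finite intersections: a seminorm above two others has a ball
  inside both of theirs. A subbasic ball around another centre z contains a ball around x whose
  radius is reduced by \<open>p (x - z)\<close>.\<close>

lemma sn_ball_subset:
  assumes "openin \<tau>P U" "x \<in> U"
  obtains p e where "p \<in> P" "e > 0" "{y. p (y - x) < e} \<subseteq> U"
proof -
  have "generate_topology_on {{y. p (y - x) < e} | p x e. p \<in> P \<and> e > 0} U"
    using assms(1) unfolding seminorm_topology_def by (simp add: openin_topology_generated_by_iff)
  then have "\<forall>x\<in>U. \<exists>p\<in>P. \<exists>e>0. {y. p (y - x) < e} \<subseteq> U"
  proof induction
    case (Int a b)
    show ?case
    proof
      fix x assume "x \<in> a \<inter> b"
      then obtain p e q d where *: "p \<in> P" "e > 0" "{y. p (y - x) < e} \<subseteq> a"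
        "q \<in> P" "d > 0" "{y. q (y - x) < d} \<subseteq> b"
        using Int.IH by (meson IntD1 IntD2)
      then obtain r where r: "r \<in> P" "\<And>x. p x \<le> r x" "\<And>x. q x \<le> r x"
        using directed unfolding directed_system_def by meson
      have "{y. r (y - x) < min e d} \<subseteq> a \<inter> b"
      proof
        fix y assume "y \<in> {y. r (y - x) < min e d}"
        then have "p (y - x) < e" "q (y - x) < d"
          using r(2,3)[of "y - x"] by auto
        then show "y \<in> a \<inter> b" using *(3,6) by blast
      qed
      then show "\<exists>p\<in>P. \<exists>e>0. {y. p (y - x) < e} \<subseteq> a \<inter> b"
        using r(1) \<open>e > 0\<close> \<open>d > 0\<close> by (intro bexI[of _ r] exI[of _ "min e d"]) auto
    qed
  next
    case (UN K)
    show ?case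
    proof
      fix x assume "x \<in> \<Union>K"
      then obtain k where k: "k \<in> K" "x \<in> k" by blast
      then obtain p e where "p \<in> P" "e > 0" "{y. p (y - x) < e} \<subseteq> k"
        using UN.IH by blast
      then show "\<exists>p\<in>P. \<exists>e>0. {y. p (y - x) < e} \<subseteq> \<Union>K"
        using k by (intro bexI[of _ p] exI[of _ e]) auto
    qed
  next
    case (Basis s)
    then obtain p z e where s: "s = {y. p (y - z) < e}" "p \<in> P" "e > 0" by blast
    show ?case
    proof
      fix x assume "x \<in> s"
      then have "{y. p (y - x) < e - p (x - z)} \<subseteq> s"
        using s(1) by (auto intro: le_less_trans[OF sn_triangle_diff[OF s(2), of _ z x]])
      then show "\<exists>p\<in>P. \<exists>e>0. {y. p (y - x) < e} \<subseteq> s"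
        using s \<open>x \<in> s\<close> by (intro bexI[of _ p] exI[of _ "e - p (x - z)"]) auto
    qed
  qed auto
  then show ?thesis using assms(2) that by meson
qed

lemma topspace_\<tau>P: "topspace \<tau>P = UNIV"
proof -
  obtain p where p: "p \<in> P" using directed unfolding directed_system_def by blast
  have "x \<in> topspace \<tau>P" for x
    using openin_subset[OF openin_sn_ball[OF p, of x 1]] by (auto simp: sn_zero[OF p])
  then show ?thesis by blast
qed

lemma limitin_\<tau>P:
  "limitin \<tau>P u l F \<longleftrightarrow> (\<forall>p\<in>P. ((\<lambda>i. p (u i - l)) \<longlongrightarrow> 0) F)"
proof
  assume L: "limitin \<tau>P u l F"
  show "\<forall>p\<in>P. ((\<lambda>i. p (u i - l)) \<longlongrightarrow> 0) F"
  proof (intro ballI tendstoI)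
    fix p and e :: real assume p: "p \<in> P" "e > 0"
    have "l \<in> {y. p (y - l) < e}" using p by (simp add: sn_zero)
    then have "\<forall>\<^sub>F i in F. u i \<in> {y. p (y - l) < e}"
      using L openin_sn_ball[OF p(1), of l e] unfolding limitin_def by blast
    then show "\<forall>\<^sub>F i in F. dist (p (u i - l)) 0 < e"
      by (simp add: sn_nonneg[OF p(1)])
  qed
next
  assume R: "\<forall>p\<in>P. ((\<lambda>i. p (u i - l)) \<longlongrightarrow> 0) F"
  show "limitin \<tau>P u l F"
    unfolding limitin_def topspace_\<tau>P
  proof (intro conjI allI impI)
    fix U assume "openin \<tau>P U \<and> l \<in> U"
    then obtain p e where p: "p \<in> P" "e > 0" "{y. p (y - l) < e} \<subseteq> U"
      using sn_ball_subset by metis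
    have "\<forall>\<^sub>F i in F. p (u i - l) < e"
      using R p by (auto dest: order_tendstoD)
    then show "\<forall>\<^sub>F i in F. u i \<in> U"
      by (rule eventually_mono) (use p in auto)
  qed simp
qed

lemma continuous_map_into_\<tau>P:
  "continuous_map X \<tau>P f \<longleftrightarrow>
    (\<forall>p\<in>P. \<forall>x\<in>topspace X. \<forall>e>0. \<exists>U. openin X U \<and> x \<in> U \<and> (\<forall>y\<in>U. p (f y - f x) < e))"
    (is "?L \<longleftrightarrow> ?R")
proof
  assume L: ?L
  show ?R
  proof (intro ballI allI impI)
    fix p x and e :: real assume *: "p \<in> P" "x \<in> topspace X" "e > 0"
    let ?U = "{y \<in> topspace X. f y \<in> {z. p (z - f x) < e}}"
    have "openin X ?U"
      using L openin_sn_ball[OF *(1)] by (rule openin_continuous_map_preimage)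
    then show "\<exists>U. openin X U \<and> x \<in> U \<and> (\<forall>y\<in>U. p (f y - f x) < e)"
      using * by (intro exI[of _ ?U]) (simp add: sn_zero)
  qed
next
  assume R: ?R
  have "openin X {x \<in> topspace X. f x \<in> U}" if U: "openin \<tau>P U" for U
  proof (subst openin_subopen, intro ballI)
    fix x assume x: "x \<in> {x \<in> topspace X. f x \<in> U}"
    then obtain p e where p: "p \<in> P" "e > 0" "{y. p (y - f x) < e} \<subseteq> U"
      using sn_ball_subset[OF U, of "f x"] by blast
    from R[rule_format, OF p(1) _ p(2), of x] x
    obtain W where "openin X W" "x \<in> W" "\<forall>y\<in>W. p (f y - f x) < e"
      by auto
    moreover have "W \<subseteq> topspace X" using \<open>openin X W\<close> openin_subset by blast
    ultimately show "\<exists>T. openin X T \<and> x \<in> T \<and> T \<subseteq> {x \<in> topspace X. f x \<in> U}"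
      using p by blast
  qed
  then show ?L by (auto simp: continuous_map_def topspace_\<tau>P)
qed

text \<open>Makes \<open>\<tau>P\<close> itself a candidate in the definition of the mixed topology,
  so that the set of candidates is not empty.\<close>

lemma linear_topology_\<tau>P: "linear_topology smul \<tau>P"
  unfolding linear_topology_def
proof (intro conjI)
  show "continuous_map (prod_topology \<tau>P \<tau>P) \<tau>P (\<lambda>(x, y). x + y)"
    unfolding continuous_map_into_\<tau>P
  proof (intro ballI allI impI)
    fix p and z :: "'a \<times> 'a" and e :: real assume p: "p \<in> P" "e > 0"
    obtain a b where z: "z = (a, b)" by force
    let ?U = "{y. p (y - a) < e / 2} \<times> {y. p (y - b) < e / 2}"
    have "p (c + d - (a + b)) < e" if "p (c - a) < e / 2" "p (d - b) < e / 2" for c d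
      using sn_triangle[OF p(1), of "c - a" "d - b"] that by (simp add: algebra_simps)
    then show "\<exists>U. openin (prod_topology \<tau>P \<tau>P) U \<and> z \<in> U \<and>
        (\<forall>y\<in>U. p ((case y of (x, y) \<Rightarrow> x + y) - (case z of (x, y) \<Rightarrow> x + y)) < e)"
      using p openin_sn_ball[OF p(1), of _ "e / 2"] by (intro exI[of _ ?U])
        (auto simp: z openin_prod_Times_iff sn_zero simp del: less_divide_eq_numeral1)
  qed
  show "continuous_map (prod_topology euclidean \<tau>P) \<tau>P (\<lambda>(c, x). smul c x)"
    unfolding continuous_map_into_\<tau>P
  proof (intro ballI allI impI)
    fix p and z :: "'k \<times> 'a" and e :: real assume p: "p \<in> P" "e > 0"
    obtain a b where z: "z = (a, b)" by force
    \<comment> \<open>The increment is \<open>smul c (d - b) + smul (c - a) b\<close>. The radius r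
      keeps the second term below e / 2, and s does so for the first, where
      \<open>norm c \<le> norm a + r\<close>. The summand 1 guards against
      \<open>p b = 0\<close>.\<close>
    define r where "r = e / 2 / (p b + 1)"
    define s where "s = e / 2 / (norm a + r)"
    have pb: "0 \<le> p b" using sn_nonneg[OF p(1)] .
    have r: "r > 0" using p pb by (simp add: r_def)
    have ar: "norm a + r > 0" using r by (simp add: add_nonneg_pos)
    have s: "s > 0" using p ar by (simp add: s_def)
    let ?U = "ball a r \<times> {y. p (y - b) < s}"
    have "p (smul c d - smul a b) < e" if "c \<in> ball a r" "p (d - b) < s" for c d
    proof -
      have c: "norm (c - a) < r" using that by (simp add: dist_norm norm_minus_commute)
      then have c': "norm c \<le> norm a + r"
        using norm_triangle_sub[of c a] by linarith
      have "smul c d - smul a b = smul c (d - b) + smul (c - a) b"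
        by (simp add: scale_right_diff_distrib scale_left_diff_distrib)
      then have "p (smul c d - smul a b) \<le> norm c * p (d - b) + norm (c - a) * p b"
        using sn_triangle[OF p(1)] by (metis sn_smul[OF p(1)])
      also have "norm c * p (d - b) \<le> (norm a + r) * p (d - b)"
        using c' sn_nonneg[OF p(1)] by (rule mult_right_mono)
      also have "(norm a + r) * p (d - b) < (norm a + r) * s"
        using that ar by simp
      also have "(norm a + r) * s = e / 2" using ar unfolding s_def by (subst nonzero_mult_div_cancel_left[symmetric, of "norm a + r"]) auto
      also have "norm (c - a) * p b \<le> r * p b" using c pb by (intro mult_right_mono) auto
      also have "r * p b \<le> e / 2"
        using p pb by (simp add: r_def field_simps)
      finally show ?thesis by simp
    qed
    then show "\<exists>U. openin (prod_topology euclidean \<tau>P) U \<and> z \<in> U \<and>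
        (\<forall>y\<in>U. p ((case y of (x, y) \<Rightarrow> smul x y) - (case z of (x, y) \<Rightarrow> smul x y)) < e)"
      using p r s by (intro exI[of _ ?U])
        (auto simp: z openin_prod_Times_iff openin_sn_ball sn_zero)
  qed
qed (rule topspace_\<tau>P)

end

section \<open>Existence of the mixed topology as a supremum\<close>

lemma mixed_admissible_sup:
  assumes adm: "\<And>T. T \<in> F \<Longrightarrow> mixed_admissible smul \<tau> T" and "\<tau> \<in> F"
  shows "mixed_admissible smul \<tau> (topology_generated_by {U. \<exists>T\<in>F. openin T U})"
    (is "mixed_admissible _ _ ?G")
proof -
  let ?B = "{U. \<exists>T\<in>F. openin T U}"
  have gen: "openin ?G U \<longleftrightarrow> generate_topology_on ?B U" for U
    by (simp add: openin_topology_generated_by_iff)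
  have G: "openin ?G U" if "T \<in> F" "openin T U" for T U
    using that by (intro topology_generated_by_Basis) blast
  have top: "topspace T = UNIV" if "T \<in> F" for T
    using adm[OF that] unfolding mixed_admissible_def linear_topology_def by blast
  have topG: "topspace ?G = UNIV"
    using openin_subset[OF G[OF \<open>\<tau> \<in> F\<close> openin_topspace]] top[OF \<open>\<tau> \<in> F\<close>] by auto
  have G_id: "continuous_map ?G T id" if "T \<in> F" for T
    using G[OF that] topG top[OF that] by (auto simp: continuous_map_def)
  \<comment> \<open>Universal property of the supremum: continuity into \<open>?G\<close> is tested
    on each member of F, which lets the linear structure be inherited.\<close>
  have into_G: "continuous_map Y ?G f" if "\<And>T. T \<in> F \<Longrightarrow> continuous_map Y T f" for f :: "'c \<Rightarrow> 'a" and Y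
  proof (rule continuous_on_generated_topo)
    show "openin Y (f -` U \<inter> topspace Y)" if "U \<in> ?B" for U
    proof -
      obtain T where "T \<in> F" "openin T U" using \<open>U \<in> ?B\<close> by blast
      then have "openin Y {x \<in> topspace Y. f x \<in> U}"
        using \<open>\<And>T. T \<in> F \<Longrightarrow> continuous_map Y T f\<close> openin_continuous_map_preimage by blast
      moreover have "{x \<in> topspace Y. f x \<in> U} = f -` U \<inter> topspace Y" by blast
      ultimately show ?thesis by simp
    qed
    show "f ` topspace Y \<subseteq> \<Union>?B"
      using topG by (simp add: topology_generated_by_topspace)
  qed
  have "linear_topology smul ?G"
    unfolding linear_topology_def
  proof (intro conjI into_G)
    fix T assume T: "T \<in> F"
    then have lin: "continuous_map (prod_topology T T) T (\<lambda>(x, y). x + y)"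
      "continuous_map (prod_topology euclidean T) T (\<lambda>(c, x). smul c x)"
      using adm unfolding mixed_admissible_def linear_topology_def by blast+
    have "continuous_map (prod_topology ?G ?G) (prod_topology T T) (\<lambda>(x, y). (id x, id y))"
      using G_id[OF T] unfolding continuous_map_prod_top by blast
    from continuous_map_compose[OF this lin(1)]
    show "continuous_map (prod_topology ?G ?G) T (\<lambda>(x, y). x + y)"
      by (simp add: o_def case_prod_unfold)
    have "continuous_map (prod_topology euclidean ?G) (prod_topology euclidean T) (\<lambda>(x, y). (id x, id y))"
      using G_id[OF T] unfolding continuous_map_prod_top by (simp add: id_def)
    from continuous_map_compose[OF this lin(2)]
    show "continuous_map (prod_topology euclidean ?G) T (\<lambda>(c, x). smul c x)"
      by (simp add: o_def case_prod_unfold)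
  qed (rule topG)
  \<comment> \<open>Taking traces on B commutes with finite intersections and with unions, and every
    generating set has the trace of a \<tau>-open set.\<close>
  moreover have "subtopology ?G B = subtopology \<tau> B" if "bounded B" for B
  proof -
    have "openin (subtopology \<tau> B) (B \<inter> U)" if "openin ?G U" for U
      using that unfolding gen
    proof induction
      case (Int a b)
      then have "openin (subtopology \<tau> B) ((B \<inter> a) \<inter> (B \<inter> b))" by blast
      then show ?case by (simp add: Int_ac)
    next
      case (UN K)
      then have "openin (subtopology \<tau> B) (\<Union>k\<in>K. B \<inter> k)" by blast
      then show ?case by simp
    next
      case (Basis s)
      then obtain T where "T \<in> F" "openin T s" by blast
      then have "openin (subtopology T B) (B \<inter> s)"
        by (simp add: openin_subtopology_Int2)
      moreover have "subtopology T B = subtopology \<tau> B"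
        using adm[OF \<open>T \<in> F\<close>] \<open>bounded B\<close> unfolding mixed_admissible_def by blast
      ultimately show ?case by simp
    qed simp
    moreover have "openin (subtopology ?G B) (B \<inter> U)" if "openin \<tau> U" for U
      using G[OF \<open>\<tau> \<in> F\<close> that] by (simp add: openin_subtopology_Int2)
    ultimately have "openin (subtopology ?G B) S \<longleftrightarrow> openin (subtopology \<tau> B) S" for S
    proof -
      assume *: "\<And>U. openin ?G U \<Longrightarrow> openin (subtopology \<tau> B) (B \<inter> U)"
        "\<And>U. openin \<tau> U \<Longrightarrow> openin (subtopology ?G B) (B \<inter> U)"
      show ?thesis
      proof
        assume "openin (subtopology ?G B) S"
        then obtain T where "openin ?G T" "S = B \<inter> T"
          unfolding openin_subtopology by (auto simp: Int_commute)
        then show "openin (subtopology \<tau> B) S" using *(1) by simp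
      next
        assume "openin (subtopology \<tau> B) S"
        then obtain T where "openin \<tau> T" "S = B \<inter> T"
          unfolding openin_subtopology by (auto simp: Int_commute)
        then show "openin (subtopology ?G B) S" using *(2) by simp
      qed
    qed
    then show ?thesis unfolding topology_eq by blast
  qed
  moreover have "coarser \<tau> ?G" unfolding coarser_def using G[OF \<open>\<tau> \<in> F\<close>] by blast
  moreover have "coarser ?G euclidean" unfolding coarser_def
  proof (intro allI impI)
    fix U assume "openin ?G U"
    then have "generate_topology_on ?B U" using gen by blast
    then show "openin euclidean U"
    proof induction
      case (Basis s)
      then obtain T where "T \<in> F" "openin T s" by blast
      then show ?case using adm unfolding mixed_admissible_def coarser_def by blast
    qed auto
  qed
  ultimately show ?thesis unfolding mixed_admissible_def by blast
qed

text \<open>Justifies the definite description: the supremum of all admissible topologies is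
  admissible, hence a finest one, and two finest ones have the same open sets.\<close>

lemma mixed_admissible_mixed_topology:
  assumes "linear_topology smul \<tau>" "coarser \<tau> euclidean"
  shows "mixed_admissible smul \<tau> (mixed_topology smul \<tau>)"
proof -
  let ?F = "{T. mixed_admissible smul \<tau> T}"
  let ?G = "topology_generated_by {U. \<exists>T\<in>?F. openin T U}"
  have "mixed_admissible smul \<tau> \<tau>"
    using assms unfolding mixed_admissible_def coarser_def by blast
  then have "mixed_admissible smul \<tau> ?G" by (intro mixed_admissible_sup) auto
  moreover have "coarser T ?G" if "mixed_admissible smul \<tau> T" for T
    using that unfolding coarser_def by (auto intro: topology_generated_by_Basis)
  ultimately have "\<exists>!\<gamma>. mixed_admissible smul \<tau> \<gamma> \<and>
         (\<forall>\<gamma>'. mixed_admissible smul \<tau> \<gamma>' \<longrightarrow> coarser \<gamma>' \<gamma>)"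
    by (intro ex1I[of _ ?G]) (auto simp: coarser_def topology_eq)
  from theI'[OF this] show ?thesis unfolding mixed_topology_def by blast
qed

section \<open>Norming seminorms of a Saks space\<close>

locale norming_seminorms = seminorm_family smul P
  for smul :: "'k::real_normed_field \<Rightarrow> 'a::real_normed_vector \<Rightarrow> 'a" and P +
  assumes sn_le_norm: "p \<in> P \<Longrightarrow> p x \<le> norm x"
    and norm_leI: "(\<And>p. p \<in> P \<Longrightarrow> p x \<le> c) \<Longrightarrow> norm x \<le> c"
    and bounded_Cauchy_converges:
      "bounded (range u) \<Longrightarrow> (\<And>p e. p \<in> P \<Longrightarrow> e > 0 \<Longrightarrow> \<exists>N. \<forall>m\<ge>N. \<forall>n\<ge>N. p (u m - u n) < e) \<Longrightarrow>
        \<exists>l. limitin (seminorm_topology P) u l sequentially"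

text \<open>The differences of a sequence in the ball of radius C lie in the ball of radius 2 C,
  where the mixed topology and \<tau> have the same traces. Hence a bounded \<tau>-Cauchy sequence
  is Cauchy for the mixed topology, and its limit there is also a \<tau>-limit because \<tau> is
  coarser.\<close>

lemma saks_space_norming_seminorms:
  fixes smul :: "'k::real_normed_field \<Rightarrow> 'a::real_normed_vector \<Rightarrow> 'a"
  assumes "saks_space smul \<tau>" and "seq_complete (mixed_topology smul \<tau>)"
  obtains P where "norming_seminorms smul P" "\<tau> = seminorm_topology P"
proof -
  interpret saks_space smul \<tau> by fact
  obtain P where P': "\<forall>p\<in>P. seminorm smul p" "directed_system P" "\<tau> = seminorm_topology P"
    "\<forall>x. bdd_above ((\<lambda>p. p x) ` P) \<and> norm x = (SUP p\<in>P. p x)"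
    using norming_seminorms by blast
  then have P: "\<And>p. p \<in> P \<Longrightarrow> seminorm smul p" "directed_system P" "\<tau> = seminorm_topology P"
    by blast+
  have bdd: "bdd_above ((\<lambda>p. p x) ` P)" and sup: "norm x = (SUP p\<in>P. p x)" for x
    using P'(4)[rule_format, of x] by simp_all
  interpret seminorm_family smul P
    by unfold_locales (use P in auto)
  have P_ne: "P \<noteq> {}" using directed unfolding directed_system_def by blast
  let ?\<gamma> = "mixed_topology smul \<tau>"
  have adm: "mixed_admissible smul \<tau> ?\<gamma>"
    using linear_topology_\<tau>P coarser_norm unfolding P(3)
    by (rule mixed_admissible_mixed_topology)
  have "norming_seminorms smul P"
  proof unfold_locales
    show "p x \<le> norm x" if "p \<in> P" for p x
      unfolding sup by (rule cSUP_upper[OF that bdd])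
    show "norm x \<le> c" if "\<And>p. p \<in> P \<Longrightarrow> p x \<le> c" for x c
      unfolding sup by (rule cSUP_least[OF P_ne that])
    show "\<exists>l. limitin \<tau>P u l sequentially"
      if bu: "bounded (range u)"
        and cu: "\<And>p e. p \<in> P \<Longrightarrow> e > 0 \<Longrightarrow> \<exists>N. \<forall>m\<ge>N. \<forall>n\<ge>N. p (u m - u n) < e"
      for u :: "nat \<Rightarrow> 'a"
    proof -
      obtain C where C: "\<And>n. norm (u n) \<le> C" using bu by (auto simp: bounded_iff)
      let ?B = "cball (0::'a) (2 * C)"
      have "\<exists>N. \<forall>m\<ge>N. \<forall>n\<ge>N. u m - u n \<in> U" if U: "openin ?\<gamma> U" "0 \<in> U" for U
      proof -
        have "subtopology ?\<gamma> ?B = subtopology \<tau> ?B"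
          using adm unfolding mixed_admissible_def by (metis bounded_cball)
        then have "openin (subtopology \<tau> ?B) (?B \<inter> U)"
          using openin_subtopology_Int2[OF U(1), of ?B] by simp
        then obtain W where W: "openin \<tau> W" "?B \<inter> U = W \<inter> ?B"
          unfolding openin_subtopology by blast
        have "C \<ge> 0" using norm_ge_zero C[of 0] by (rule order_trans)
        then have "0 \<in> ?B \<inter> U" using U(2) by simp
        then have "0 \<in> W" unfolding W(2) by blast
        then obtain p e where p: "p \<in> P" "e > 0" "{y. p (y - 0) < e} \<subseteq> W"
          using sn_ball_subset W(1) unfolding P(3) by metis
        obtain N where N: "\<forall>m\<ge>N. \<forall>n\<ge>N. p (u m - u n) < e" using cu[OF p(1,2)] by blast
        have "u m - u n \<in> U" if "m \<ge> N" "n \<ge> N" for m n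
        proof -
          have "u m - u n \<in> W" using p(3) N that by auto
          moreover have "u m - u n \<in> ?B"
            using norm_triangle_ineq4[of "u m" "u n"] C[of m] C[of n] by simp
          ultimately show ?thesis using W(2) by blast
        qed
        then show ?thesis by blast
      qed
      then obtain l where l: "limitin ?\<gamma> u l sequentially"
        using assms(2) unfolding seq_complete_def by blast
      have "openin ?\<gamma> U" if "openin \<tau> U" for U
        using adm that unfolding mixed_admissible_def coarser_def by blast
      then have "limitin \<tau> u l sequentially"
        using l topspace_\<tau>P unfolding limitin_def P(3) by blast
      then show ?thesis unfolding P(3) by blast
    qed
  qed
  then show thesis using that P(3) by blast
qed

section \<open>Calculus of \<tau>-limits of sequences\<close>

context norming_seminorms
begin

abbreviation tl :: "(nat \<Rightarrow> 'a) \<Rightarrow> 'a \<Rightarrow> bool"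
  where "tl u l \<equiv> limitin \<tau>P u l sequentially"

lemma tl_seminorm: "tl u l \<Longrightarrow> p \<in> P \<Longrightarrow> (\<lambda>n. p (u n - l)) \<longlonglongrightarrow> 0"
  unfolding limitin_\<tau>P by blast

lemma tlI:
  assumes "\<And>p. p \<in> P \<Longrightarrow> \<exists>c. c \<longlonglongrightarrow> 0 \<and> (\<forall>\<^sub>F n in sequentially. p (u n - l) \<le> c n)"
  shows "tl u l"
  unfolding limitin_\<tau>P
proof
  fix p assume p: "p \<in> P"
  then obtain c where c: "c \<longlonglongrightarrow> 0" "\<forall>\<^sub>F n in sequentially. p (u n - l) \<le> c n"
    using assms by blast
  show "(\<lambda>n. p (u n - l)) \<longlonglongrightarrow> 0"
    by (rule tendsto_sandwich[OF _ c(2) tendsto_const c(1)]) (simp add: sn_nonneg[OF p])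
qed

lemma tl_eventually: "tl u l \<Longrightarrow> p \<in> P \<Longrightarrow> e > 0 \<Longrightarrow> \<forall>\<^sub>F n in sequentially. p (u n - l) < e"
  using tl_seminorm order_tendstoD(2) by blast

lemma tl_eventuallyI:
  "(\<And>p e. p \<in> P \<Longrightarrow> e > 0 \<Longrightarrow> \<forall>\<^sub>F n in sequentially. p (u n - l) < e) \<Longrightarrow> tl u l"
  unfolding limitin_\<tau>P by (intro ballI tendstoI) (simp add: sn_nonneg)

lemma tl_add: assumes "tl u l" "tl v m" shows "tl (\<lambda>n. u n + v n) (l + m)"
proof (rule tlI)
  fix p assume p: "p \<in> P"
  have "p (u n + v n - (l + m)) \<le> p (u n - l) + p (v n - m)" for n
    using sn_triangle[OF p, of "u n - l" "v n - m"] by (simp add: algebra_simps)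
  then show "\<exists>c. c \<longlonglongrightarrow> 0 \<and> (\<forall>\<^sub>F n in sequentially. p (u n + v n - (l + m)) \<le> c n)"
    using tendsto_add[OF tl_seminorm[OF assms(1) p] tl_seminorm[OF assms(2) p]] by auto
qed

lemma tl_smul: assumes "tl u l" shows "tl (\<lambda>n. smul c (u n)) (smul c l)"
proof (rule tlI)
  fix p assume p: "p \<in> P"
  have "p (smul c (u n) - smul c l) \<le> norm c * p (u n - l)" for n
    using sn_smul[OF p, of c "u n - l"] by (simp add: scale_right_diff_distrib)
  then show "\<exists>d. d \<longlonglongrightarrow> 0 \<and> (\<forall>\<^sub>F n in sequentially. p (smul c (u n) - smul c l) \<le> d n)"
    using tendsto_mult_left[OF tl_seminorm[OF assms(1) p], of "norm c"] by auto
qed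

lemma tl_scaleR: assumes "tl u l" "c \<longlonglongrightarrow> d" shows "tl (\<lambda>n. c n *\<^sub>R u n) (d *\<^sub>R l)"
proof (rule tlI)
  fix p assume p: "p \<in> P"
  have "p (c n *\<^sub>R u n - d *\<^sub>R l) \<le> \<bar>c n\<bar> * p (u n - l) + \<bar>c n - d\<bar> * p l" for n
  proof -
    have "c n *\<^sub>R u n - d *\<^sub>R l = c n *\<^sub>R (u n - l) + (c n - d) *\<^sub>R l"
      by (simp add: algebra_simps)
    then show ?thesis
      using sn_triangle[OF p, of "c n *\<^sub>R (u n - l)" "(c n - d) *\<^sub>R l"]
      by (simp only: sn_scaleR[OF p])
  qed
  moreover have "(\<lambda>n. \<bar>c n\<bar> * p (u n - l) + \<bar>c n - d\<bar> * p l) \<longlonglongrightarrow> \<bar>d\<bar> * 0 + \<bar>d - d\<bar> * p l"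
    by (intro tendsto_intros assms tl_seminorm p)
  ultimately show "\<exists>e. e \<longlonglongrightarrow> 0 \<and> (\<forall>\<^sub>F n in sequentially. p (c n *\<^sub>R u n - d *\<^sub>R l) \<le> e n)"
    by auto
qed

lemma tl_diff: assumes "tl u l" "tl v m" shows "tl (\<lambda>n. u n - v n) (l - m)"
  using tl_add[OF assms(1) tl_scaleR[OF assms(2) tendsto_const, of "-1"]] by simp

lemma tl_const: "tl (\<lambda>n. l) l"
  by (rule tlI) (auto simp: sn_zero)

lemma tl_zero_iff: "tl (\<lambda>n. u n - l) 0 \<longleftrightarrow> tl u l"
  by (simp add: limitin_\<tau>P)

lemma tl_le:
  assumes "tl u l" "p \<in> P" "\<forall>\<^sub>F n in sequentially. p (u n) \<le> c n" "c \<longlonglongrightarrow> d"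
  shows "p l \<le> d"
proof -
  have "p l \<le> p (u n) + p (u n - l)" for n
    using sn_le[OF assms(2), of l "u n"] by (simp add: sn_commute[OF assms(2)])
  then have "\<forall>\<^sub>F n in sequentially. p l \<le> c n + p (u n - l)"
    using assms(3) by (auto elim!: eventually_mono intro: order_trans add_right_mono)
  then have "p l \<le> d + 0"
    by (intro tendsto_lowerbound[OF tendsto_add[OF assms(4) tl_seminorm[OF assms(1,2)]]]) auto
  then show ?thesis by simp
qed

text \<open>As a supremum of \<tau>-continuous seminorms the norm is lower semicontinuous for
  \<tau>, which carries upper bounds to the limit.\<close>

lemma tl_norm_le:
  assumes "tl u l" "\<forall>\<^sub>F n in sequentially. norm (u n) \<le> c n" "c \<longlonglongrightarrow> d"
  shows "norm l \<le> d"
proof (rule norm_leI)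
  fix p assume p: "p \<in> P"
  have "\<forall>\<^sub>F n in sequentially. p (u n) \<le> c n"
    using assms(2) by (rule eventually_mono) (rule order_trans[OF sn_le_norm[OF p]])
  then show "p l \<le> d" by (rule tl_le[OF assms(1) p _ assms(3)])
qed

lemma tl_unique: "tl u l \<Longrightarrow> tl u m \<Longrightarrow> l = m"
proof -
  assume "tl u l" "tl u m"
  then have "tl (\<lambda>n. 0) (l - m)" using tl_diff[of u l u m] by simp
  then have "norm (l - m) \<le> 0" by (rule tl_norm_le[where c="\<lambda>_. 0"]) auto
  then show ?thesis by simp
qed

lemma tl_norm: "u \<longlonglongrightarrow> l \<Longrightarrow> tl u l"
proof (rule tlI)
  fix p assume "u \<longlonglongrightarrow> l" and p: "p \<in> P"
  then have "(\<lambda>n. norm (u n - l)) \<longlonglongrightarrow> 0"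
    by (simp add: LIM_zero_iff tendsto_norm_zero_iff)
  then show "\<exists>c. c \<longlonglongrightarrow> 0 \<and> (\<forall>\<^sub>F n in sequentially. p (u n - l) \<le> c n)"
    using sn_le_norm[OF p] by auto
qed

text \<open>The operators are applied to \<open>u n - l\<close> only, so bounded null sequences
  carry the whole content. The bound C is explicit because later estimates compute with it.\<close>

lemma bi_equicontinuous_\<tau>P:
  "bi_equicontinuous \<tau>P J T \<longleftrightarrow>
    (\<forall>u C. (\<forall>n. norm (u n) \<le> C) \<and> tl u 0 \<longrightarrow>
      (\<forall>p\<in>P. \<forall>e>0. \<forall>\<^sub>F n in sequentially. \<forall>j\<in>J. p (T j (u n)) < e))"
    (is "?L \<longleftrightarrow> ?R")
proof
  assume L: ?L
  show ?R
  proof (intro allI ballI impI, elim conjE)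
    fix u C p and e :: real
    assume *: "\<forall>n. norm (u n) \<le> C" "tl u 0" "p \<in> P" "e > 0"
    have "bounded (range u)" using *(1) by (auto simp: bounded_iff)
    moreover have "0 \<in> {y. p (y - 0) < e}" using * by (simp add: sn_zero)
    ultimately have "\<forall>\<^sub>F n in sequentially. \<forall>j\<in>J. T j (u n - 0) \<in> {y. p (y - 0) < e}"
      using L *(2) openin_sn_ball[OF *(3), of 0 e] unfolding bi_equicontinuous_def by blast
    then show "\<forall>\<^sub>F n in sequentially. \<forall>j\<in>J. p (T j (u n)) < e" by simp
  qed
next
  assume R: ?R
  show ?L unfolding bi_equicontinuous_def
  proof (intro allI impI, elim conjE)
    fix u :: "nat \<Rightarrow> 'a" and l U
    assume *: "bounded (range u)" "tl u l" and U: "openin \<tau>P U" "0 \<in> U"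
    obtain p e where p: "p \<in> P" "e > 0" "{y. p (y - 0) < e} \<subseteq> U"
      using sn_ball_subset[OF U] .
    obtain C where C: "\<And>n. norm (u n) \<le> C" using *(1) by (auto simp: bounded_iff)
    have "norm (u n - l) \<le> C + norm l" for n
      using norm_triangle_ineq4[of "u n" l] C[of n] by simp
    then have "\<forall>\<^sub>F n in sequentially. \<forall>j\<in>J. p (T j (u n - l)) < e"
      using R[rule_format, of "\<lambda>n. u n - l" _ p e] *(2) p(1,2) unfolding tl_zero_iff by blast
    then show "\<forall>\<^sub>F n in sequentially. \<forall>j\<in>J. T j (u n - l) \<in> U"
      by (rule eventually_mono) (use p in auto)
  qed
qed

lemma real_linear:
  assumes "Vector_Spaces.linear smul smul T" shows "linear T"
proof
  interpret T: Vector_Spaces.linear smul smul T by fact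
  show "T (x + y) = T x + T y" for x y by (rule T.add)
  show "T (r *\<^sub>R x) = r *\<^sub>R T x" for r x
    using T.scale[of "of_real r" x] by (simp add: smul_of_real)
qed

lemma smul_linearI:
  assumes "\<And>x y. T (x + y) = T x + T y" "\<And>c x. T (smul c x) = smul c (T x)"
  shows "Vector_Spaces.linear smul smul T"
  by unfold_locales (use assms in \<open>auto simp: scale_right_distrib scale_left_distrib\<close>)

text \<open>Sampling one-sided limits along \<open>1 / Suc n\<close> brings derivatives at 0 into
  the sequential calculus, where limits are known to be unique.\<close>

lemma tl_at_right:
  assumes "limitin \<tau>P f y (at_right 0)"
  shows "tl (\<lambda>n. f (inverse (real (Suc n)))) y"
proof -
  have "filterlim (\<lambda>n. inverse (real (Suc n))) (at_right 0) sequentially"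
    unfolding filterlim_at using LIMSEQ_inverse_real_of_nat by auto
  from filterlim_compose[OF _ this] show ?thesis
    using assms unfolding limitin_\<tau>P by blast
qed

end

section \<open>The resolvent of a generator\<close>

lemma dyadic_floor_tendsto:
  assumes "t \<ge> 0"
  shows "(\<lambda>n. real (nat \<lfloor>t * 2 ^ n\<rfloor>) / 2 ^ n) \<longlonglongrightarrow> t"
proof (rule LIMSEQ_I)
  fix e :: real assume "e > 0"
  then obtain N where N: "(1 / 2) ^ N < e" using real_arch_pow_inv[of e "1/2"] by auto
  have "norm (real (nat \<lfloor>t * 2 ^ n\<rfloor>) / 2 ^ n - t) < e" if "n \<ge> N" for n
  proof -
    have 1: "real (nat \<lfloor>t * 2 ^ n\<rfloor>) = of_int \<lfloor>t * 2 ^ n\<rfloor>" using assms by simp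
    have "\<bar>real (nat \<lfloor>t * 2 ^ n\<rfloor>) - t * 2 ^ n\<bar> \<le> 1" unfolding 1 by linarith
    then have "\<bar>real (nat \<lfloor>t * 2 ^ n\<rfloor>) - t * 2 ^ n\<bar> / 2 ^ n \<le> 1 / 2 ^ n"
      by (intro divide_right_mono) auto
    also have "\<bar>real (nat \<lfloor>t * 2 ^ n\<rfloor>) - t * 2 ^ n\<bar> / 2 ^ n = \<bar>real (nat \<lfloor>t * 2 ^ n\<rfloor>) / 2 ^ n - t\<bar>"
      using abs_divide[of "real (nat \<lfloor>t * 2 ^ n\<rfloor>) - t * 2 ^ n" "2 ^ n"] by (simp add: diff_divide_distrib)
    also have "1 / 2 ^ n \<le> (1 / 2 :: real) ^ N"
      using that by (simp add: power_one_over power_decreasing field_simps)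
    finally show ?thesis using N by simp
  qed
  then show "\<exists>N. \<forall>n\<ge>N. norm (real (nat \<lfloor>t * 2 ^ n\<rfloor>) / 2 ^ n - t) < e" by blast
qed

lemma abs_exp_minus_one_le: "\<bar>exp x - 1\<bar> \<le> \<bar>x\<bar> * exp \<bar>x\<bar>" for x :: real
proof (cases "x \<ge> 0")
  case True
  have "1 - exp (- x) \<le> x" using exp_ge_add_one_self[of "- x"] by linarith
  then have "exp x * (1 - exp (- x)) \<le> exp x * x" by (intro mult_left_mono) auto
  then show ?thesis using True by (simp add: algebra_simps exp_minus_inverse)
next
  case False
  have "1 - exp x \<le> - x" using exp_ge_add_one_self[of x] by linarith
  also have "- x * 1 \<le> - x * exp (- x)" using False by (intro mult_left_mono) auto
  finally show ?thesis using False by simp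
qed

text \<open>Stability of the implicit Euler method: with y = h c, one step grows at most like an
  exponential with rate \<open>c / (1 - h c)\<close>, which tends to c with h.\<close>

lemma one_over_one_minus_le_exp:
  fixes y :: real assumes "y < 1" shows "1 / (1 - y) \<le> exp (y / (1 - y))"
proof -
  have "1 / (1 - y) = 1 + y / (1 - y)" using assms by (simp add: field_simps)
  then show ?thesis using exp_ge_add_one_self[of "y / (1 - y)"] by simp
qed

section \<open>Orbit estimates for bi-continuous semigroups\<close>

locale bi_semigroup = norming_seminorms smul P
  for smul :: "'k::real_normed_field \<Rightarrow> 'a::real_normed_vector \<Rightarrow> 'a" and P +
  fixes S :: "real \<Rightarrow> 'a \<Rightarrow> 'a" and M \<omega> :: real
  assumes S_linear: "t \<ge> 0 \<Longrightarrow> Vector_Spaces.linear smul smul (S t)"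
    and S_0: "S 0 x = x"
    and S_add: "t \<ge> 0 \<Longrightarrow> s \<ge> 0 \<Longrightarrow> S (t + s) x = S t (S s x)"
    and M: "M \<ge> 1"
    and S_bound: "t \<ge> 0 \<Longrightarrow> norm (S t x) \<le> M * exp (\<omega> * t) * norm x"
    and S_cont: "t \<ge> 0 \<Longrightarrow> p \<in> P \<Longrightarrow> e > 0 \<Longrightarrow> \<exists>d>0. \<forall>s\<ge>0. \<bar>s - t\<bar> < d \<longrightarrow> p (S s x - S t x) < e"
    and S_equi: "(\<And>n. norm (u n) \<le> C) \<Longrightarrow> limitin (seminorm_topology P) u 0 sequentially \<Longrightarrow> p \<in> P \<Longrightarrow> e > 0 \<Longrightarrow>
      \<forall>\<^sub>F n in sequentially. \<forall>t\<in>{0..T}. p (S t (u n)) < e"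
begin

lemma linear_S: "t \<ge> 0 \<Longrightarrow> linear (S t)"
  by (rule real_linear[OF S_linear])

lemma S_smul: "t \<ge> 0 \<Longrightarrow> S t (smul c x) = smul c (S t x)"
  using module_hom.scale[of smul smul "S t"] S_linear[of t] unfolding module_hom_iff_linear by blast

text \<open>Local equicontinuity reaches up to a time T. Beyond T the norm bound
  \<open>M C exp (\<omega> t)\<close> is below \<open>e exp (\<alpha> t)\<close>, because \<alpha>
  exceeds \<omega>.\<close>

lemma S_equi_exp:
  assumes C: "\<And>n. norm (u n) \<le> C" and "tl u 0" "p \<in> P" "e > 0" "\<alpha> > \<omega>"
  shows "\<forall>\<^sub>F n in sequentially. \<forall>t\<ge>0. p (S t (u n)) \<le> e * exp (\<alpha> * t)"
proof -
  have "((\<lambda>t. M * C * exp ((\<omega> - \<alpha>) * t)) \<longlongrightarrow> M * C * 0) at_top"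
  proof (intro tendsto_mult tendsto_const)
    have "filterlim (\<lambda>t. (\<omega> - \<alpha>) * t) at_bot at_top"
      using assms(5) by (intro filterlim_tendsto_neg_mult_at_bot[OF tendsto_const]) (auto simp: filterlim_ident)
    then show "((\<lambda>t. exp ((\<omega> - \<alpha>) * t)) \<longlongrightarrow> 0) at_top"
      using filterlim_compose[OF exp_at_bot] by blast
  qed
  then have "\<forall>\<^sub>F t in at_top. M * C * exp ((\<omega> - \<alpha>) * t) < e"
    using assms(4) order_tendstoD(2) by fastforce
  then obtain T where T: "\<And>t. t \<ge> T \<Longrightarrow> M * C * exp ((\<omega> - \<alpha>) * t) < e"
    unfolding eventually_at_top_linorder by blast
  \<comment> \<open>A lower bound for \<open>e exp (\<alpha> t)\<close> on \<open>{0..T}\<close>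
    that is valid for either sign of \<alpha>.\<close>
  have "e * exp (- \<bar>\<alpha>\<bar> * \<bar>T\<bar>) > 0" using assms(4) by simp
  from S_equi[OF C assms(2,3) this, of T]
  show ?thesis
  proof (rule eventually_mono, intro allI impI)
    fix n t
    assume small: "\<forall>t\<in>{0..T}. p (S t (u n)) < e * exp (- \<bar>\<alpha>\<bar> * \<bar>T\<bar>)" and t: "(0::real) \<le> t"
    show "p (S t (u n)) \<le> e * exp (\<alpha> * t)"
    proof (cases "t \<le> T")
      case True
      have "\<bar>\<alpha> * t\<bar> \<le> \<bar>\<alpha>\<bar> * \<bar>T\<bar>"
        unfolding abs_mult using True t by (intro mult_left_mono) auto
      then have "- \<bar>\<alpha>\<bar> * \<bar>T\<bar> \<le> \<alpha> * t" by linarith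
      then have "e * exp (- \<bar>\<alpha>\<bar> * \<bar>T\<bar>) \<le> e * exp (\<alpha> * t)"
        using assms(4) by simp
      moreover have "p (S t (u n)) < e * exp (- \<bar>\<alpha>\<bar> * \<bar>T\<bar>)" using small True t by simp
      ultimately show ?thesis by linarith
    next
      case False
      have "p (S t (u n)) \<le> M * exp (\<omega> * t) * norm (u n)"
        using sn_le_norm[OF assms(3)] S_bound[OF t] by (rule order_trans)
      also have "\<dots> \<le> M * exp (\<omega> * t) * C"
        using C M by (intro mult_left_mono) auto
      also have "\<dots> = M * C * exp ((\<omega> - \<alpha>) * t) * exp (\<alpha> * t)"
        by (simp add: exp_diff algebra_simps)
      also have "\<dots> \<le> e * exp (\<alpha> * t)"
        using T[of t] False by (intro mult_right_mono) auto
      finally show ?thesis .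
    qed
  qed
qed

text \<open>Time and vector are varied separately: equicontinuity on \<open>{0..t + 1}\<close>
  handles \<open>u n - x\<close>, and continuity of one orbit handles x.\<close>

lemma S_tl:
  assumes C: "\<And>n. norm (u n) \<le> C" and u: "tl u x" and s: "s \<longlonglongrightarrow> t" "\<And>n. s n \<ge> 0" "t \<ge> 0"
  shows "tl (\<lambda>n. S (s n) (u n)) (S t x)"
proof -
  have "tl (\<lambda>n. S (s n) (u n - x)) 0"
  proof (rule tl_eventuallyI)
    fix p and e :: real assume p: "p \<in> P" "e > 0"
    have "norm (u n - x) \<le> C + norm x" for n
      using norm_triangle_ineq4[of "u n" x] C[of n] by linarith
    moreover have "tl (\<lambda>n. u n - x) 0" using u by (simp add: tl_zero_iff)
    ultimately have "\<forall>\<^sub>F n in sequentially. \<forall>r\<in>{0..t + 1}. p (S r (u n - x)) < e"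
      using p by (rule S_equi)
    moreover have "\<forall>\<^sub>F n in sequentially. s n < t + 1"
      using s(1) by (rule order_tendstoD) simp
    ultimately show "\<forall>\<^sub>F n in sequentially. p (S (s n) (u n - x) - 0) < e"
      by eventually_elim (use s(2) in \<open>auto simp: less_imp_le\<close>)
  qed
  moreover have "tl (\<lambda>n. S (s n) x) (S t x)"
  proof (rule tl_eventuallyI)
    fix p and e :: real assume p: "p \<in> P" "e > 0"
    then obtain d where d: "d > 0" "\<And>s. s \<ge> 0 \<Longrightarrow> \<bar>s - t\<bar> < d \<Longrightarrow> p (S s x - S t x) < e"
      using S_cont[OF s(3)] by blast
    have "\<forall>\<^sub>F n in sequentially. dist (s n) t < d"
      using s(1) d(1) by (rule tendstoD)
    then show "\<forall>\<^sub>F n in sequentially. p (S (s n) x - S t x) < e"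
      by (rule eventually_mono) (use s(2) d(2) in \<open>auto simp: dist_real_def\<close>)
  qed
  ultimately have "tl (\<lambda>n. S (s n) (u n - x) + S (s n) x) (0 + S t x)" by (rule tl_add)
  then show ?thesis using linear_diff[OF linear_S[OF s(2)]] by simp
qed

end

section \<open>Discrete resolvents of the rescaled semigroup\<close>

locale bi_semigroup_resolvent = bi_semigroup smul P S M \<omega>
  for smul :: "'k::real_normed_field \<Rightarrow> 'a::real_normed_vector \<Rightarrow> 'a" and P S M \<omega> +
  fixes l :: real
  assumes l: "l > \<omega>"
begin

definition V :: "real \<Rightarrow> 'a \<Rightarrow> 'a"
  where "V t x = exp (- l * t) *\<^sub>R S t x"

lemma linear_V: "t \<ge> 0 \<Longrightarrow> linear (V t)"
  unfolding V_def[abs_def] by (intro linear_compose_scale_right linear_S)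

lemma V_smul: "t \<ge> 0 \<Longrightarrow> V t (smul c x) = smul c (V t x)"
  unfolding V_def by (simp add: S_smul flip: smul_of_real)

lemma V_0: "V 0 x = x" by (simp add: V_def S_0)

lemma V_add: "t \<ge> 0 \<Longrightarrow> s \<ge> 0 \<Longrightarrow> V (t + s) x = V t (V s x)"
  by (simp add: V_def S_add linear_scale[OF linear_S] distrib_left mult_exp_exp)

lemma S_V: "t \<ge> 0 \<Longrightarrow> s \<ge> 0 \<Longrightarrow> S t (V s x) = exp (- l * s) *\<^sub>R S (t + s) x"
  by (simp add: V_def S_add linear_scale[OF linear_S])

lemma S_V_commute: "t \<ge> 0 \<Longrightarrow> s \<ge> 0 \<Longrightarrow> S t (V s x) = V s (S t x)"
  by (metis S_V S_add V_def add.commute)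

lemma V_bound: "t \<ge> 0 \<Longrightarrow> norm (V t x) \<le> M * exp (- (l - \<omega>) * t) * norm x"
  using mult_left_mono[OF S_bound[of t x], of "exp (- l * t)"]
  by (simp add: V_def exp_diff exp_minus field_simps)

lemma V_bound': "t \<ge> 0 \<Longrightarrow> norm (V t x) \<le> M * norm x"
  by (rule order_trans[OF V_bound]) (use l M in \<open>auto intro!: mult_left_le_one_le mult_nonpos_nonneg\<close>)

lemma V_tl:
  assumes "\<And>n. norm (u n) \<le> C" "tl u x" "s \<longlonglongrightarrow> t" "\<And>n. s n \<ge> 0" "t \<ge> 0"
  shows "tl (\<lambda>n. V (s n) (u n)) (V t x)"
  unfolding V_def
  by (rule tl_scaleR[OF S_tl[OF assms] tendsto_exp[OF tendsto_mult_left[OF assms(3)]]])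

text \<open>The partial sums and the remainder of the Neumann series for \<open>(1 - V h)\<^sup>-\<^sup>1 (h x)\<close>.\<close>

lemma V_iterate:
  assumes h: "h \<ge> 0" and y: "y - V h y = h *\<^sub>R x"
  shows "y = h *\<^sub>R (\<Sum>k<K. V (real k * h) x) + V (real K * h) y"
proof (induction K)
  case 0 then show ?case by (simp add: V_0)
next
  case (Suc K)
  have K: "real K * h \<ge> 0" using h by simp
  have "V (real K * h) y = V (real K * h) (h *\<^sub>R x + V h y)"
    using y by (metis diff_add_cancel)
  also have "\<dots> = h *\<^sub>R V (real K * h) x + V (real K * h) (V h y)"
    by (simp add: linear_add[OF linear_V[OF K]] linear_scale[OF linear_V[OF K]])
  also have "V (real K * h) (V h y) = V (real (Suc K) * h) y"
    using V_add[OF K h, of y] by (simp add: algebra_simps)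
  finally show ?case using Suc.IH by (simp add: algebra_simps)
qed

lemma V_power_tendsto_0:
  assumes "h > 0" shows "(\<lambda>K. V (real K * h) y) \<longlonglongrightarrow> 0"
proof -
  have "exp (- (l - \<omega>) * h) < 1" using l assms by (simp add: mult_neg_pos)
  then have "(\<lambda>K. M * exp (- (l - \<omega>) * h) ^ K * norm y) \<longlonglongrightarrow> M * 0 * norm y"
    by (intro tendsto_intros LIMSEQ_realpow_zero) auto
  then have lim: "(\<lambda>K. M * exp (- (l - \<omega>) * h) ^ K * norm y) \<longlonglongrightarrow> 0" by simp
  have "norm (V (real K * h) y) \<le> M * exp (- (l - \<omega>) * h) ^ K * norm y" for K
    using V_bound[of "real K * h" y] assms
    by (simp add: exp_of_nat_mult[symmetric] algebra_simps)
  then show ?thesis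
    by (intro Lim_null_comparison[OF _ lim] always_eventually allI)
qed

lemma V_resolvent_unique:
  assumes h: "h > 0" and "y - V h y = h *\<^sub>R x" "z - V h z = h *\<^sub>R x"
  shows "y = z"
proof -
  have "(y - z) - V h (y - z) = (y - V h y) - (z - V h z)"
    using h by (simp add: linear_diff[OF linear_V])
  then have "(y - z) - V h (y - z) = h *\<^sub>R 0" using assms by simp
  then have "y - z = V (real K * h) (y - z)" for K
    using V_iterate[of h "y - z" 0 K] h by (simp add: linear_0[OF linear_V])
  then have "(\<lambda>K. y - z) \<longlonglongrightarrow> 0"
    using V_power_tendsto_0[OF h, of "y - z"] by simp
  then show ?thesis by (simp add: LIMSEQ_const_iff)
qed

text \<open>The partial sums of the Neumann series are Cauchy in norm, but X need not be complete.
  Their limit is a \<tau>-limit, and \<open>V_tl\<close> moves \<open>V h\<close> through it because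
  the partial sums are bounded.\<close>

lemma V_resolvent_exists:
  assumes h: "h > 0"
  shows "\<exists>y. y - V h y = h *\<^sub>R x"
proof -
  define q where "q = exp (- (l - \<omega>) * h)"
  define y where "y K = h *\<^sub>R (\<Sum>k<K. V (real k * h) x)" for K
  have q: "0 < q" "q < 1" using l h by (auto simp: q_def mult_neg_pos)
  have Vq: "norm (V (real k * h) z) \<le> M * q ^ k * norm z" for k z
    using V_bound[of "real k * h" z] h
    by (simp add: q_def exp_of_nat_mult[symmetric] algebra_simps)
  have lin: "linear (V (real n * h))" for n using h by (intro linear_V) auto
  define B where "B = h * (M * norm x / (1 - q))"
  have y_bound: "norm (y K) \<le> B" for K
  proof -
    have "norm (y K) \<le> h * (\<Sum>k<K. M * q ^ k * norm x)"
      unfolding y_def using h by (auto intro!: order_trans[OF norm_sum] sum_mono Vq)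
    also have "(\<Sum>k<K. M * q ^ k * norm x) = M * norm x * (\<Sum>k<K. q ^ k)"
      by (simp add: sum_distrib_left mult_ac)
    also have "(\<Sum>k<K. q ^ k) \<le> (\<Sum>k. q ^ k)"
      using q by (intro sum_le_suminf summable_geometric) auto
    also have "(\<Sum>k. q ^ k) = 1 / (1 - q)"
      using q by (intro suminf_geometric) auto
    finally show ?thesis using h M by (simp add: B_def mult_left_mono)
  qed
  \<comment> \<open>Everything after the first n terms is \<open>V (n h)\<close> applied to a
    partial sum, so the uniform bound B and the decay of \<open>V (n h)\<close> give the Cauchy
    property.\<close>
  have y_add: "y (n + j) = y n + V (real n * h) (y j)" for n j
  proof -
    have "(\<Sum>k<n + j. V (real k * h) x) = (\<Sum>k<n. V (real k * h) x) + (\<Sum>k<j. V (real (n + k) * h) x)"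
      by (induction j) auto
    also have "(\<Sum>k<j. V (real (n + k) * h) x) = V (real n * h) (\<Sum>k<j. V (real k * h) x)"
      using h V_add[of "real n * h" "real k * h" x for k]
      by (simp add: linear_sum[OF lin] distrib_right)
    finally show ?thesis
      by (simp add: y_def linear_scale[OF lin] scaleR_right_distrib)
  qed
  have "\<exists>N. \<forall>m\<ge>N. \<forall>n\<ge>N. p (y m - y n) < e" if p: "p \<in> P" "e > 0" for p e
  proof -
    have "(\<lambda>n. M * q ^ n * B) \<longlonglongrightarrow> M * 0 * B"
      using q by (intro tendsto_intros LIMSEQ_realpow_zero) auto
    then have "\<forall>\<^sub>F n in sequentially. M * q ^ n * B < e / 2"
      by (rule order_tendstoD) (use p in auto)
    then obtain N where N: "M * q ^ N * B < e / 2"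
      by (auto simp: eventually_sequentially)
    have "p (y m - y N) < e / 2" if "m \<ge> N" for m
    proof -
      have "p (y m - y N) \<le> norm (V (real N * h) (y (m - N)))"
        using sn_le_norm[OF p(1), of "y m - y N"] y_add[of N "m - N"] that by simp
      also have "\<dots> \<le> M * q ^ N * norm (y (m - N))" by (rule Vq)
      also have "\<dots> \<le> M * q ^ N * B" using M q by (intro mult_left_mono y_bound) auto
      finally show ?thesis using N by simp
    qed
    then have "p (y m - y n) < e" if "m \<ge> N" "n \<ge> N" for m n
      using sn_triangle_diff[OF p(1), of "y m" "y n" "y N"] that
      by (smt (verit) field_sum_of_halves sn_commute[OF p(1)])
    then show ?thesis by blast
  qed
  moreover have "bounded (range y)" using y_bound by (auto simp: bounded_iff)
  ultimately obtain z where z: "tl y z" using bounded_Cauchy_converges by blast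
  have "tl (\<lambda>K. y K - V h (y K)) (z - V h z)"
    using h by (intro tl_diff z V_tl[OF y_bound z]) auto
  \<comment> \<open>The sum \<open>y (Suc K)\<close> is split once at its last and once at its first
    term; comparing the two gives the telescoped form.\<close>
  moreover have "y K - V h (y K) = h *\<^sub>R x - h *\<^sub>R V (real K * h) x" for K
  proof -
    have "y (Suc K) = y K + h *\<^sub>R V (real K * h) x"
      by (simp add: y_def scaleR_right_distrib)
    moreover have "y (Suc K) = h *\<^sub>R x + V h (y K)"
      using y_add[of 1 K] by (simp add: y_def V_0)
    ultimately show ?thesis by (simp add: algebra_simps)
  qed
  moreover have "tl (\<lambda>K. h *\<^sub>R x - h *\<^sub>R V (real K * h) x) (h *\<^sub>R x - h *\<^sub>R 0)"
    using V_power_tendsto_0[OF h] by (intro tl_norm tendsto_intros)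
  ultimately have "z - V h z = h *\<^sub>R x"
    using tl_unique by fastforce
  then show ?thesis by blast
qed

definition Rh :: "real \<Rightarrow> 'a \<Rightarrow> 'a"
  where "Rh h x = (THE y. y - V h y = h *\<^sub>R x)"

lemma Rh_eqI: "h > 0 \<Longrightarrow> y - V h y = h *\<^sub>R x \<Longrightarrow> Rh h x = y"
  unfolding Rh_def by (rule the_equality) (auto intro: V_resolvent_unique)

lemma Rh: "h > 0 \<Longrightarrow> Rh h x - V h (Rh h x) = h *\<^sub>R x"
  using V_resolvent_exists[of h x] Rh_eqI[of h _ x] by blast

lemma Rh_add: "h > 0 \<Longrightarrow> Rh h (x + y) = Rh h x + Rh h y"
proof (rule Rh_eqI)
  assume h: "h > 0"
  have "Rh h x + Rh h y - V h (Rh h x + Rh h y) = (Rh h x - V h (Rh h x)) + (Rh h y - V h (Rh h y))"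
    using h by (simp add: linear_add[OF linear_V])
  also have "\<dots> = h *\<^sub>R (x + y)"
    unfolding Rh[OF h] by (simp add: scaleR_right_distrib)
  finally show "Rh h x + Rh h y - V h (Rh h x + Rh h y) = h *\<^sub>R (x + y)" .
qed

lemma Rh_smul: "h > 0 \<Longrightarrow> Rh h (smul c x) = smul c (Rh h x)"
  using arg_cong[OF Rh[of h x], of "smul c"]
  by (intro Rh_eqI) (simp_all add: V_smul scale_right_diff_distrib scale_left_commute flip: smul_of_real)

lemma linear_Rh: "h > 0 \<Longrightarrow> linear (Rh h)"
  using Rh_add Rh_smul[of h "of_real _"] by (intro linearI) (auto simp: smul_of_real)

lemma S_Rh: "t \<ge> 0 \<Longrightarrow> h > 0 \<Longrightarrow> S t (Rh h x) = Rh h (S t x)"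
  using arg_cong[OF Rh[of h x], of "S t"]
  by (intro Rh_eqI[symmetric])
    (simp_all add: linear_diff[OF linear_S] linear_scale[OF linear_S] S_V_commute)

lemma V_Rh: "t \<ge> 0 \<Longrightarrow> h > 0 \<Longrightarrow> V t (Rh h x) = Rh h (V t x)"
  unfolding V_def by (simp add: S_Rh linear_scale[OF linear_Rh])

text \<open>S t turns the terms of the Neumann series into damped later points of the orbit of x,
  which gives a geometric series of ratio \<open>exp (- (l - \<alpha>) h)\<close>. The remainder is
  measured in norm, where it vanishes because l > \<omega>. Hypothesis and conclusion are both orbit
  bounds of rate \<alpha>, so the estimate can be applied to its own output.\<close>

lemma Rh_bound:
  assumes p: "p \<in> P" and h: "h > 0" and \<alpha>: "\<alpha> < l"
    and x: "\<And>t. t \<ge> 0 \<Longrightarrow> p (S t x) \<le> c * exp (\<alpha> * t)" and t: "t \<ge> 0"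
  shows "p (S t (Rh h x)) \<le> c * exp (\<alpha> * t) * (exp ((l - \<alpha>) * h) / (l - \<alpha>))"
proof -
  define r where "r = exp (- (l - \<alpha>) * h)"
  define y where "y = Rh h x"
  have r: "0 < r" "r < 1" using \<alpha> h by (auto simp: r_def mult_neg_pos)
  have c: "c \<ge> 0" using x[of 0] sn_nonneg[OF p, of "S 0 x"] by simp
  have term_le: "p (S t (V (real k * h) x)) \<le> c * exp (\<alpha> * t) * r ^ k" for k
  proof -
    have kh: "real k * h \<ge> 0" using h by simp
    have "p (S t (V (real k * h) x)) = exp (- l * (real k * h)) * p (S (t + real k * h) x)"
      by (simp add: S_V[OF t kh] sn_scaleR[OF p])
    also have "\<dots> \<le> exp (- l * (real k * h)) * (c * exp (\<alpha> * (t + real k * h)))"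
      using x[of "t + real k * h"] t kh by (intro mult_left_mono) auto
    also have "\<dots> = c * exp (\<alpha> * t) * (exp (- l * (real k * h)) * exp (\<alpha> * (real k * h)))"
      by (simp add: distrib_left exp_add)
    also have "exp (- l * (real k * h)) * exp (\<alpha> * (real k * h)) = r ^ k"
      unfolding r_def exp_of_nat_mult[symmetric] mult_exp_exp by (simp add: algebra_simps)
    finally show ?thesis .
  qed
  have partial: "p (S t y) \<le> h * (c * exp (\<alpha> * t) * (1 / (1 - r))) + norm (S t (V (real K * h) y))" for K
  proof -
    have "y = h *\<^sub>R (\<Sum>k<K. V (real k * h) x) + V (real K * h) y"
      unfolding y_def by (intro V_iterate Rh) (use h in auto)
    then have "S t y = h *\<^sub>R (\<Sum>k<K. S t (V (real k * h) x)) + S t (V (real K * h) y)"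
      using linear_add[OF linear_S[OF t]] linear_scale[OF linear_S[OF t]] linear_sum[OF linear_S[OF t]]
      by metis
    then have "p (S t y) \<le> p (h *\<^sub>R (\<Sum>k<K. S t (V (real k * h) x))) + p (S t (V (real K * h) y))"
      using sn_triangle[OF p] by metis
    also have "p (h *\<^sub>R (\<Sum>k<K. S t (V (real k * h) x))) \<le> h * (\<Sum>k<K. c * exp (\<alpha> * t) * r ^ k)"
      unfolding sn_scaleR[OF p] using h
      by (auto intro!: mult_left_mono order_trans[OF sn_sum[OF p]] sum_mono term_le)
    also have "(\<Sum>k<K. c * exp (\<alpha> * t) * r ^ k) = c * exp (\<alpha> * t) * (\<Sum>k<K. r ^ k)"
      by (simp add: sum_distrib_left)
    also have "(\<Sum>k<K. r ^ k) \<le> (\<Sum>k. r ^ k)"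
      using r by (intro sum_le_suminf summable_geometric) auto
    also have "(\<Sum>k. r ^ k) = 1 / (1 - r)"
      using r by (intro suminf_geometric) auto
    also have "p (S t (V (real K * h) y)) \<le> norm (S t (V (real K * h) y))"
      by (rule sn_le_norm[OF p])
    finally show ?thesis using h c by (simp add: mult_left_mono)
  qed
  have "(\<lambda>K. M * exp (\<omega> * t) * norm (V (real K * h) y)) \<longlonglongrightarrow> M * exp (\<omega> * t) * norm (0::'a)"
    by (intro tendsto_intros V_power_tendsto_0 h)
  then have "(\<lambda>K. M * exp (\<omega> * t) * norm (V (real K * h) y)) \<longlonglongrightarrow> 0" by simp
  from Lim_null_comparison[OF _ this, of "\<lambda>K. S t (V (real K * h) y)"]
  have "(\<lambda>K. norm (S t (V (real K * h) y))) \<longlonglongrightarrow> 0"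
    using S_bound[OF t] by (simp add: tendsto_norm_zero_iff)
  then have "(\<lambda>K. h * (c * exp (\<alpha> * t) * (1 / (1 - r))) + norm (S t (V (real K * h) y)))
      \<longlonglongrightarrow> h * (c * exp (\<alpha> * t) * (1 / (1 - r))) + 0"
    by (intro tendsto_intros)
  then have "p (S t y) \<le> h * (c * exp (\<alpha> * t) * (1 / (1 - r))) + 0"
    by (rule LIMSEQ_le_const) (use partial in blast)
  also have "\<dots> = c * exp (\<alpha> * t) * (h / (1 - r))" by simp
  \<comment> \<open>With z = (l - \<alpha>) h this is
    \<open>z \<le> exp z - 1 = exp z (1 - r)\<close>. The excess factor \<open>exp z\<close> tends
    to 1 with h, which leaves the sharp constant for R.\<close>
  also have "h / (1 - r) \<le> exp ((l - \<alpha>) * h) / (l - \<alpha>)"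
  proof -
    have "(l - \<alpha>) * h \<le> exp ((l - \<alpha>) * h) - 1"
      using exp_ge_add_one_self[of "(l - \<alpha>) * h"] by linarith
    also have "\<dots> = exp ((l - \<alpha>) * h) * (1 - r)"
      by (simp only: r_def right_diff_distrib mult_minus_left exp_minus_inverse mult_1_right)
    finally show ?thesis using r \<alpha> by (simp add: field_simps)
  qed
  finally show ?thesis using c by (simp add: y_def mult_left_mono)
qed

text \<open>For \<alpha> = \<omega> and c = \<open>M * norm x\<close> the orbit bound holds for all
  seminorms at once, so the seminorm estimate becomes a norm estimate.\<close>

lemma Rh_norm_bound:
  assumes h: "h > 0"
  shows "norm (Rh h x) \<le> M * norm x * (exp ((l - \<omega>) * h) / (l - \<omega>))"
proof (rule norm_leI)
  fix p assume p: "p \<in> P"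
  have "p (S t x) \<le> M * norm x * exp (\<omega> * t)" if "t \<ge> 0" for t
    using order_trans[OF sn_le_norm[OF p] S_bound[OF that]] by (simp add: mult_ac)
  from Rh_bound[OF p h l this, of 0]
  show "p (Rh h x) \<le> M * norm x * (exp ((l - \<omega>) * h) / (l - \<omega>))" by (simp add: S_0)
qed

text \<open>Bi-equicontinuity speaks of sequences, so uniformity in small r is obtained by
  contradiction: a failing choice of times r n tending to 0 makes \<open>V (r n) x - x\<close> a
  bounded null sequence that violates \<open>S_equi_exp\<close>.\<close>

lemma V_small:
  assumes "\<alpha> > \<omega>" "p \<in> P" "e > 0"
  shows "\<exists>d>0. \<forall>r t. 0 \<le> r \<and> r \<le> d \<and> 0 \<le> t \<longrightarrow> p (S t (V r x - x)) \<le> e * exp (\<alpha> * t)"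
proof (rule ccontr)
  assume neg: "\<not> ?thesis"
  have "\<exists>r t. 0 \<le> r \<and> r \<le> inverse (real (Suc n)) \<and> 0 \<le> t \<and> \<not> p (S t (V r x - x)) \<le> e * exp (\<alpha> * t)" for n
    using neg positive_imp_inverse_positive[of "real (Suc n)"] by (meson of_nat_0_less_iff zero_less_Suc)
  then obtain r t where rt: "\<And>n. 0 \<le> r n" "\<And>n. r n \<le> inverse (real (Suc n))" "\<And>n. 0 \<le> t n"
      "\<And>n. \<not> p (S (t n) (V (r n) x - x)) \<le> e * exp (\<alpha> * t n)"
    by metis
  have "r \<longlonglongrightarrow> 0"
    by (rule tendsto_sandwich[OF _ _ tendsto_const LIMSEQ_inverse_real_of_nat]) (use rt in auto)
  then have "tl (\<lambda>n. V (r n) x) (V 0 x)"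
    using rt(1) by (intro V_tl[where C = "norm x"] tl_const) auto
  then have "tl (\<lambda>n. V (r n) x - x) 0" by (simp add: V_0 tl_zero_iff)
  have "norm (V (r n) x - x) \<le> M * norm x + norm x" for n
    using norm_triangle_ineq4[of "V (r n) x" x] V_bound'[OF rt(1), of n x] by linarith
  from S_equi_exp[OF this \<open>tl (\<lambda>n. V (r n) x - x) 0\<close> assms(2,3,1)] have "\<forall>\<^sub>F n in sequentially. \<forall>t\<ge>0. p (S t (V (r n) x - x)) \<le> e * exp (\<alpha> * t)"
    .
  then show False using rt(3,4) by (auto simp: eventually_sequentially)
qed

text \<open>With \<open>k = h / N\<close>, the factorisation \<open>1 - V h = (1 + V k + \<dots> + V ((N - 1) k)) (1 - V k)\<close>
  makes \<open>Rh k\<close> an average of translates of \<open>Rh h\<close>.\<close>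

lemma Rh_refine:
  assumes h: "h > 0" and N: "N > 0"
  shows "Rh (h / real N) x - Rh h x = (1 / real N) *\<^sub>R (\<Sum>i<N. Rh h (V (real i * (h / real N)) x - x))"
proof -
  define k where "k = h / real N"
  have k: "k > 0" "real N * k = h" using h N by (auto simp: k_def)
  have lin: "linear (V k)" using k by (intro linear_V) auto
  define y where "y = (1 / real N) *\<^sub>R (\<Sum>i<N. V (real i * k) (Rh h x))"
  have "V k (V (real i * k) z) = V (real (Suc i) * k) z" for i z
    using V_add[of k "real i * k" z] k by (simp add: algebra_simps)
  then have "V k y = (1 / real N) *\<^sub>R (\<Sum>i<N. V (real (Suc i) * k) (Rh h x))"
    by (simp add: y_def linear_scale[OF lin] linear_sum[OF lin])
  then have "y - V k y = (1 / real N) *\<^sub>R (\<Sum>i<N. V (real i * k) (Rh h x) - V (real (Suc i) * k) (Rh h x))"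
    by (simp add: y_def sum_subtractf scaleR_right_diff_distrib)
  also have "\<dots> = (1 / real N) *\<^sub>R (V (real 0 * k) (Rh h x) - V (real N * k) (Rh h x))"
    by (simp only: sum_lessThan_telescope'[of "\<lambda>i. V (real i * k) (Rh h x)"])
  also have "\<dots> = k *\<^sub>R x" using Rh[OF h, of x] N k(2) by (simp add: V_0 k_def)
  finally have "Rh k x = y" using Rh_eqI k by blast
  then have "Rh k x - Rh h x = (1 / real N) *\<^sub>R (\<Sum>i<N. V (real i * k) (Rh h x) - Rh h x)"
    using N by (simp add: y_def sum_subtractf scaleR_right_diff_distrib sum_constant_scaleR)
  also have "(\<Sum>i<N. V (real i * k) (Rh h x) - Rh h x) = (\<Sum>i<N. Rh h (V (real i * k) x - x))"
    using h k by (simp add: V_Rh linear_diff[OF linear_Rh])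
  finally show ?thesis by (simp add: k_def)
qed

text \<open>The translates in \<open>Rh_refine\<close> stay within times at most h, so the
  hypothesis covers each of them, and an average inherits a common bound.\<close>

lemma Rh_refine_bound:
  assumes p: "p \<in> P" and h: "h > 0" and N: "N > 0" and \<alpha>: "\<alpha> < l"
    and x: "\<And>r t. 0 \<le> r \<Longrightarrow> r \<le> h \<Longrightarrow> 0 \<le> t \<Longrightarrow> p (S t (V r x - x)) \<le> e * exp (\<alpha> * t)"
  shows "p (Rh (h / real N) x - Rh h x) \<le> e * (exp ((l - \<alpha>) * h) / (l - \<alpha>))"
proof -
  have "p (Rh h (V (real i * (h / real N)) x - x)) \<le> e * (exp ((l - \<alpha>) * h) / (l - \<alpha>))" if "i < N" for i
  proof -
    have "real i * (h / real N) \<le> h" using that h N by (simp add: field_simps)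
    then show ?thesis
      using Rh_bound[OF p h \<alpha> x, of "real i * (h / real N)" 0] h by (simp add: S_0)
  qed
  then have "p (\<Sum>i<N. Rh h (V (real i * (h / real N)) x - x)) \<le> (\<Sum>i<N. e * (exp ((l - \<alpha>) * h) / (l - \<alpha>)))"
    by (intro order_trans[OF sn_sum[OF p]] sum_mono) auto
  then show ?thesis
    unfolding Rh_refine[OF h N] sn_scaleR[OF p] using N by (simp add: field_simps)
qed

lemma Rh_norm_bound': "norm (Rh (1 / 2 ^ n) x) \<le> M * norm x * (exp (l - \<omega>) / (l - \<omega>))"
proof -
  have "(l - \<omega>) * (1 / 2 ^ n) \<le> (l - \<omega>) * 1" using l by (intro mult_left_mono) auto
  then have "M * norm x * (exp ((l - \<omega>) * (1 / 2 ^ n)) / (l - \<omega>)) \<le> M * norm x * (exp (l - \<omega>) / (l - \<omega>))"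
    using l M by (intro mult_left_mono divide_right_mono) auto
  then show ?thesis using Rh_norm_bound[of "1 / 2 ^ n" x] by auto
qed

lemma Rh_converges: "\<exists>y. tl (\<lambda>n. Rh (1 / 2 ^ n) x) y"
proof (rule bounded_Cauchy_converges)
  show "bounded (range (\<lambda>n. Rh (1 / 2 ^ n) x))"
    unfolding bounded_iff using Rh_norm_bound' by blast
next
  fix p and e :: real assume p: "p \<in> P" "e > 0"
  \<comment> \<open>The rate lies strictly in between: above \<omega> for \<open>V_small\<close>,
    below l for the bounds on \<open>Rh\<close>.\<close>
  define \<alpha> where "\<alpha> = (\<omega> + l) / 2"
  have \<alpha>: "\<alpha> > \<omega>" "\<alpha> < l" using l by (auto simp: \<alpha>_def)
  define E where "E = exp ((l - \<alpha>) * 1) / (l - \<alpha>)"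
  have E: "E > 0" using \<alpha> by (simp add: E_def)
  define e' where "e' = e / 3 / E"
  have e': "e' > 0" "e' * E = e / 3" using E p by (auto simp: e'_def)
  obtain d where d: "d > 0" "\<And>r t. 0 \<le> r \<Longrightarrow> r \<le> d \<Longrightarrow> 0 \<le> t \<Longrightarrow> p (S t (V r x - x)) \<le> e' * exp (\<alpha> * t)"
    using V_small[OF \<alpha>(1) p(1) e'(1)] by blast
  \<comment> \<open>All later steps are h divided by a power of 2, so each \<open>Rh\<close> is
    compared with the single reference \<open>Rh h\<close>, at a cost of e / 3.\<close>
  obtain N where N: "(1 / 2) ^ N < d" using real_arch_pow_inv[of d "1/2"] d(1) by auto
  define h :: real where "h = 1 / 2 ^ N"
  have h: "h > 0" "h \<le> d" "h \<le> 1" using N by (auto simp: h_def power_one_over)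
  have "p (Rh (1 / 2 ^ n) x - Rh h x) \<le> e / 3" if "n \<ge> N" for n
  proof -
    have "p (Rh (h / real (2 ^ (n - N))) x - Rh h x) \<le> e' * (exp ((l - \<alpha>) * h) / (l - \<alpha>))"
      using h d(2) by (intro Rh_refine_bound p \<alpha>) auto
    also have "h / real (2 ^ (n - N)) = 1 / 2 ^ n"
      using that by (simp add: h_def flip: power_add)
    also have "e' * (exp ((l - \<alpha>) * h) / (l - \<alpha>)) \<le> e' * E"
      unfolding E_def using h \<alpha> e' by (intro mult_left_mono divide_right_mono) auto
    finally show ?thesis using e' by simp
  qed
  note * = this
  have "p (Rh (1 / 2 ^ m) x - Rh (1 / 2 ^ n) x) < e" if "m \<ge> N" "n \<ge> N" for m n
    using sn_triangle_diff[OF p(1), of "Rh (1 / 2 ^ m) x" "Rh (1 / 2 ^ n) x" "Rh h x"]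
      sn_commute[OF p(1), of "Rh h x" "Rh (1 / 2 ^ n) x"] *[OF that(1)] *[OF that(2)] p(2) by linarith
  then show "\<exists>N. \<forall>m\<ge>N. \<forall>n\<ge>N. p (Rh (1 / 2 ^ m) x - Rh (1 / 2 ^ n) x) < e" by blast
qed

section \<open>The limiting resolvent, its increments and its powers\<close>

definition R :: "'a \<Rightarrow> 'a"
  where "R x = (THE y. tl (\<lambda>n. Rh (1 / 2 ^ n) x) y)"

lemma R_tl: "tl (\<lambda>n. Rh (1 / 2 ^ n) x) (R x)"
proof -
  have "\<exists>!y. tl (\<lambda>n. Rh (1 / 2 ^ n) x) y" using Rh_converges tl_unique by blast
  then show ?thesis unfolding R_def by (rule theI')
qed

lemma R_eqI: "tl (\<lambda>n. Rh (1 / 2 ^ n) x) y \<Longrightarrow> R x = y"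
  using R_tl tl_unique by blast

lemma R_add: "R (x + y) = R x + R y"
  using tl_add[OF R_tl[of x] R_tl[of y]] by (intro R_eqI) (simp add: Rh_add)

lemma R_smul: "R (smul c x) = smul c (R x)"
  using tl_smul[OF R_tl[of x], of c] by (intro R_eqI) (simp add: Rh_smul)

lemma linear_R: "linear R"
  using R_add R_smul[of "of_real _"] by (intro linearI) (auto simp: smul_of_real)

lemma S_R: "t \<ge> 0 \<Longrightarrow> S t (R x) = R (S t x)"
  using S_tl[OF Rh_norm_bound' R_tl tendsto_const, of t x] by (intro R_eqI[symmetric]) (simp add: S_Rh)

lemma R_bound:
  assumes p: "p \<in> P" and \<alpha>: "\<alpha> < l"
    and x: "\<And>t. t \<ge> 0 \<Longrightarrow> p (S t x) \<le> c * exp (\<alpha> * t)" and t: "t \<ge> 0"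
  shows "p (S t (R x)) \<le> c / (l - \<alpha>) * exp (\<alpha> * t)"
proof (rule tl_le[OF _ p])
  show "tl (\<lambda>n. S t (Rh (1 / 2 ^ n) x)) (S t (R x))"
    using t by (intro S_tl[OF Rh_norm_bound' R_tl tendsto_const]) auto
  show "\<forall>\<^sub>F n in sequentially. p (S t (Rh (1 / 2 ^ n) x)) \<le>
      c * exp (\<alpha> * t) * (exp ((l - \<alpha>) * (1 / 2) ^ n) / (l - \<alpha>))"
    using Rh_bound[OF p _ \<alpha> x t, of "1 / 2 ^ n" for n] by (simp add: power_one_over)
  have "(\<lambda>n. c * exp (\<alpha> * t) * (exp ((l - \<alpha>) * (1 / 2) ^ n) / (l - \<alpha>)))
      \<longlonglongrightarrow> c * exp (\<alpha> * t) * (exp ((l - \<alpha>) * 0) / (l - \<alpha>))"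
    using \<alpha> by (intro tendsto_intros LIMSEQ_realpow_zero) auto
  then show "(\<lambda>n. c * exp (\<alpha> * t) * (exp ((l - \<alpha>) * (1 / 2) ^ n) / (l - \<alpha>)))
      \<longlonglongrightarrow> c / (l - \<alpha>) * exp (\<alpha> * t)"
    by (simp add: field_simps)
qed

text \<open>The difference on the left is the integral of \<open>V r x - z\<close> over \<open>[0, t]\<close>.\<close>

lemma R_increment:
  assumes p: "p \<in> P" and t: "t \<ge> 0" and c: "\<And>r. 0 \<le> r \<Longrightarrow> r \<le> t \<Longrightarrow> p (V r x - z) \<le> c"
  shows "p (R x - V t (R x) - t *\<^sub>R z) \<le> t * c"
proof -
  \<comment> \<open>The time t is rounded down to the grid of step \<open>1 / 2 ^ n\<close>, on
    which \<open>V_iterate\<close> produces exactly k n terms.\<close>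
  define k where "k n = nat \<lfloor>t * 2 ^ n\<rfloor>" for n :: nat
  define s where "s n = real (k n) / 2 ^ n" for n
  have s: "s \<longlonglongrightarrow> t" unfolding s_def k_def using t by (rule dyadic_floor_tendsto)
  have s_pos: "s n \<ge> 0" for n by (simp add: s_def)
  have s_le: "s n \<le> t" for n
  proof -
    have "real (k n) \<le> t * 2 ^ n" unfolding k_def using t by simp
    then show ?thesis by (simp add: s_def field_simps)
  qed
  have "tl (\<lambda>n. Rh (1 / 2 ^ n) x - V (s n) (Rh (1 / 2 ^ n) x) - s n *\<^sub>R z) (R x - V t (R x) - t *\<^sub>R z)"
    by (intro tl_diff R_tl V_tl[OF Rh_norm_bound' R_tl s s_pos t] tl_scaleR tl_const s)
  moreover have "p (Rh (1 / 2 ^ n) x - V (s n) (Rh (1 / 2 ^ n) x) - s n *\<^sub>R z) \<le> s n * c" for n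
  proof -
    define h :: real where "h = 1 / 2 ^ n"
    have h: "h > 0" "real (k n) * h = s n" by (auto simp: h_def s_def)
    have "Rh h x = h *\<^sub>R (\<Sum>i<k n. V (real i * h) x) + V (s n) (Rh h x)"
      using V_iterate[of h "Rh h x" x "k n"] h Rh[of h x] by simp
    then have "Rh h x - V (s n) (Rh h x) - s n *\<^sub>R z = h *\<^sub>R (\<Sum>i<k n. V (real i * h) x) - s n *\<^sub>R z"
      by (metis add_diff_cancel_right')
    also have "\<dots> = h *\<^sub>R (\<Sum>i<k n. V (real i * h) x - z)"
      using h by (simp add: sum_subtractf scaleR_right_diff_distrib sum_constant_scaleR mult.commute)
    finally have *: "Rh h x - V (s n) (Rh h x) - s n *\<^sub>R z = h *\<^sub>R (\<Sum>i<k n. V (real i * h) x - z)" .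
    have "p (\<Sum>i<k n. V (real i * h) x - z) \<le> (\<Sum>i<k n. c)"
    proof (rule order_trans[OF sn_sum[OF p]], rule sum_mono)
      fix i assume "i \<in> {..<k n}"
      then have "real i * h \<le> s n" using h by (auto simp flip: h(2))
      then show "p (V (real i * h) x - z) \<le> c"
        using h s_le[of n] by (intro c) auto
    qed
    then have "h * p (\<Sum>i<k n. V (real i * h) x - z) \<le> h * (real (k n) * c)"
      using h by (intro mult_left_mono) auto
    then show ?thesis
      unfolding h_def[symmetric] * sn_scaleR[OF p] using h by (simp add: mult_ac flip: h(2))
  qed
  ultimately show ?thesis
    using p by (intro tl_le[where c = "\<lambda>n. s n * c"] tendsto_intros s) auto
qed

text \<open>The centre z = 0 in \<open>R_increment\<close> bounds the difference quotients in norm;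
  the derivative at 0 will take z = x.\<close>

lemma R_increment_norm: "t \<ge> 0 \<Longrightarrow> norm (R x - V t (R x)) \<le> t * (M * norm x)"
proof (rule norm_leI)
  fix p assume p: "p \<in> P" and t: "t \<ge> 0"
  have "p (V r x - 0) \<le> M * norm x" if "0 \<le> r" for r
    using order_trans[OF sn_le_norm[OF p] V_bound'[OF that]] by simp
  from R_increment[OF p t this] show "p (R x - V t (R x)) \<le> t * (M * norm x)" by simp
qed

lemma R_increment_norm':
  assumes "t > 0" shows "norm ((1 / t) *\<^sub>R (R x - V t (R x))) \<le> M * norm x"
proof -
  have "norm ((1 / t) *\<^sub>R (R x - V t (R x))) = norm (R x - V t (R x)) / t"
    using assms by (simp only: norm_scaleR abs_divide abs_one abs_of_pos) simp
  also have "\<dots> \<le> M * norm x"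
    using R_increment_norm[of t x] assms by (simp add: pos_divide_le_eq mult.commute)
  finally show ?thesis .
qed

lemma R_increment_limit:
  assumes p: "p \<in> P"
  shows "((\<lambda>t. p ((1 / t) *\<^sub>R (R x - V t (R x)) - x)) \<longlongrightarrow> 0) (at_right 0)"
proof (rule tendstoI)
  fix e :: real assume "e > 0"
  then obtain d where d: "d > 0" "\<And>r. 0 \<le> r \<Longrightarrow> r \<le> d \<Longrightarrow> p (V r x - x) \<le> e / 2"
    using V_small[of "\<omega> + 1" p "e / 2" x] p by (fastforce simp: S_0)
  have "p ((1 / t) *\<^sub>R (R x - V t (R x)) - x) < e" if t: "0 < t" "t < d" for t
  proof -
    have "(1 / t) *\<^sub>R (R x - V t (R x)) - x = (1 / t) *\<^sub>R (R x - V t (R x) - t *\<^sub>R x)"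
      using t by (simp add: algebra_simps)
    also have "p \<dots> = p (R x - V t (R x) - t *\<^sub>R x) / t" using t by (simp add: sn_scaleR[OF p])
    also have "\<dots> \<le> t * (e / 2) / t"
      using t d by (intro divide_right_mono R_increment p) auto
    also have "\<dots> < e" using t \<open>e > 0\<close> by simp
    finally show ?thesis .
  qed
  then show "\<forall>\<^sub>F t in at_right 0. dist (p ((1 / t) *\<^sub>R (R x - V t (R x)) - x)) 0 < e"
    unfolding eventually_at_right_field using d(1) by (intro exI[of _ d]) (simp add: sn_nonneg[OF p])
qed

text \<open>A discrete product rule for \<open>S t = exp (l t) V t\<close>. It turns the derivative
  -x of \<open>V t (R x)\<close> at 0 into the value \<open>l R x - x\<close>.\<close>

lemma S_quotient:
  assumes "t > 0"
  shows "(1 / t) *\<^sub>R (S t x - x) = ((exp (l * t) - 1) / t) *\<^sub>R x - exp (l * t) *\<^sub>R ((1 / t) *\<^sub>R (x - V t x))"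
proof -
  have "S t x = exp (l * t) *\<^sub>R V t x" by (simp add: V_def mult_exp_exp)
  then show ?thesis by (simp add: algebra_simps diff_divide_distrib)
qed

lemma R_generator_limit:
  "limitin \<tau>P (\<lambda>t. (1 / t) *\<^sub>R (S t (R x) - R x)) (l *\<^sub>R R x - x) (at_right 0)"
  unfolding limitin_\<tau>P
proof
  fix p assume p: "p \<in> P"
  \<comment> \<open>The three errors come from the difference quotient of the exponential, from the
    increment of R x, and from replacing \<open>exp (l t)\<close> by 1 in front of x.\<close>
  let ?g = "\<lambda>t. \<bar>(exp (l * t) - 1) / t - l\<bar> * p (R x) +
    (exp (l * t) * p ((1 / t) *\<^sub>R (R x - V t (R x)) - x) + \<bar>exp (l * t) - 1\<bar> * p x)"
  have "((\<lambda>t. exp (l * t)) has_real_derivative l) (at 0)"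
    by (auto intro!: derivative_eq_intros)
  then have "((\<lambda>t. (exp (l * t) - 1) / t) \<longlongrightarrow> l) (at 0)"
    by (simp add: has_field_derivative_iff)
  then have "((\<lambda>t. (exp (l * t) - 1) / t) \<longlongrightarrow> l) (at_right 0)"
    by (rule filterlim_mono) (simp_all add: at_le)
  then have "(?g \<longlongrightarrow> \<bar>l - l\<bar> * p (R x) + (exp (l * 0) * 0 + \<bar>exp (l * 0) - 1\<bar> * p x)) (at_right 0)"
    by (intro tendsto_add tendsto_mult tendsto_diff tendsto_rabs tendsto_exp tendsto_const
        R_increment_limit p tendsto_ident_at)
  then have lim: "(?g \<longlongrightarrow> 0) (at_right 0)" by simp
  have "p ((1 / t) *\<^sub>R (S t (R x) - R x) - (l *\<^sub>R R x - x)) \<le> ?g t" if t: "t > 0" for t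
  proof -
    let ?a = "(1 / t) *\<^sub>R (R x - V t (R x)) - x"
    let ?q = "(exp (l * t) - 1) / t"
    have "(1 / t) *\<^sub>R (S t (R x) - R x) - (l *\<^sub>R R x - x)
        = (?q - l) *\<^sub>R R x - (exp (l * t) *\<^sub>R ?a + (exp (l * t) - 1) *\<^sub>R x)"
      unfolding S_quotient[OF t] by (simp add: scaleR_diff_left scaleR_diff_right)
    also have "p \<dots> \<le> p ((?q - l) *\<^sub>R R x) + (p (exp (l * t) *\<^sub>R ?a) + p ((exp (l * t) - 1) *\<^sub>R x))"
      by (intro order_trans[OF sn_diff[OF p]] add_left_mono sn_triangle[OF p])
    finally show ?thesis by (simp only: sn_scaleR[OF p] abs_exp_cancel)
  qed
  then show "((\<lambda>t. p ((1 / t) *\<^sub>R (S t (R x) - R x) - (l *\<^sub>R R x - x))) \<longlongrightarrow> 0) (at_right 0)"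
    by (intro tendsto_sandwich[OF _ _ tendsto_const lim])
      (auto simp: sn_nonneg[OF p] eventually_at_right_field intro!: exI[of _ 1])
qed

lemma R_generator_bdd:
  "bdd_above ((\<lambda>t. (1 / t) * norm (S t (R x) - R x)) ` {0<..1})"
proof (rule bdd_aboveI2)
  fix t :: real assume "t \<in> {0<..1}"
  then have t: "0 < t" "t \<le> 1" by auto
  have lt: "\<bar>l * t\<bar> \<le> \<bar>l\<bar>" using t by (simp add: abs_mult mult_left_le)
  have e: "exp (l * t) \<le> exp \<bar>l\<bar>" using lt by simp
  have "\<bar>exp (l * t) - 1\<bar> \<le> \<bar>l * t\<bar> * exp \<bar>l * t\<bar>" by (rule abs_exp_minus_one_le)
  also have "\<dots> \<le> \<bar>l * t\<bar> * exp \<bar>l\<bar>" using lt by (intro mult_left_mono) auto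
  finally have q: "\<bar>(exp (l * t) - 1) / t\<bar> \<le> \<bar>l\<bar> * exp \<bar>l\<bar>"
    using t by (simp add: abs_mult field_simps)
  have n: "norm ((1 / t) *\<^sub>R (R x - V t (R x))) \<le> M * norm x"
    using t by (intro R_increment_norm')
  have "(1 / t) * norm (S t (R x) - R x) = norm ((1 / t) *\<^sub>R (S t (R x) - R x))" using t by simp
  also have "\<dots> \<le> norm (((exp (l * t) - 1) / t) *\<^sub>R R x) + norm (exp (l * t) *\<^sub>R ((1 / t) *\<^sub>R (R x - V t (R x))))"
    unfolding S_quotient[OF t(1)] by (rule norm_triangle_ineq4)
  also have "\<dots> = \<bar>(exp (l * t) - 1) / t\<bar> * norm (R x) + exp (l * t) * norm ((1 / t) *\<^sub>R (R x - V t (R x)))"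
    by simp
  also have "\<dots> \<le> \<bar>l\<bar> * exp \<bar>l\<bar> * norm (R x) + exp \<bar>l\<bar> * (M * norm x)"
    by (intro add_mono mult_mono q e n) auto
  finally show "(1 / t) * norm (S t (R x) - R x) \<le> \<bar>l\<bar> * exp \<bar>l\<bar> * norm (R x) + exp \<bar>l\<bar> * (M * norm x)" .
qed

text \<open>Although only t = 0 is used in the end, the induction needs all t, since
  \<open>R_bound\<close> takes a bound on a whole orbit as input.\<close>

lemma R_power_bound:
  assumes p: "p \<in> P" and \<alpha>: "\<alpha> < l" and "\<And>t. t \<ge> 0 \<Longrightarrow> p (S t x) \<le> c * exp (\<alpha> * t)" and "t \<ge> 0"
  shows "p (S t ((R ^^ m) x)) \<le> c / (l - \<alpha>) ^ m * exp (\<alpha> * t)"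
  using assms(4)
proof (induction m arbitrary: t)
  case (Suc m)
  from R_bound[OF p \<alpha> Suc.IH Suc.prems] show ?case by (simp add: mult.commute)
qed (use assms in simp)

lemma R_power_bound':
  assumes "p \<in> P" "\<alpha> < l" "\<And>t. t \<ge> 0 \<Longrightarrow> p (S t x) \<le> c * exp (\<alpha> * t)"
  shows "p ((l - \<alpha>) ^ m *\<^sub>R (R ^^ m) x) \<le> c"
  using R_power_bound[OF assms, of 0 m] assms(2)
  by (simp add: S_0 sn_scaleR[OF assms(1)] pos_le_divide_eq mult.commute)

lemma R_power_norm_bound: "norm ((l - \<omega>) ^ m *\<^sub>R (R ^^ m) x) \<le> M * norm x"
proof (rule norm_leI)
  fix p assume p: "p \<in> P"
  have "p (S t x) \<le> M * norm x * exp (\<omega> * t)" if "t \<ge> 0" for t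
    using order_trans[OF sn_le_norm[OF p] S_bound[OF that]] by (simp add: mult_ac)
  then show "p ((l - \<omega>) ^ m *\<^sub>R (R ^^ m) x) \<le> M * norm x" by (rule R_power_bound'[OF p l])
qed

lemma R_tl_continuous:
  assumes C: "\<And>n. norm (u n) \<le> C" and u: "tl u x"
  shows "tl (\<lambda>n. R (u n)) (R x)"
proof -
  define \<alpha> where "\<alpha> = (\<omega> + l) / 2"
  have \<alpha>: "\<alpha> > \<omega>" "\<alpha> < l" using l by (auto simp: \<alpha>_def)
  have "norm (u n - x) \<le> C + norm x" for n
    using norm_triangle_ineq4[of "u n" x] C[of n] by linarith
  note * = S_equi_exp[OF this, unfolded tl_zero_iff, OF u _ _ \<alpha>(1)]
  show ?thesis
  proof (rule tl_eventuallyI)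
    fix p and e :: real assume p: "p \<in> P" "e > 0"
    \<comment> \<open>This tolerance cancels the denominator \<open>l - \<alpha>\<close> of
      \<open>R_bound\<close>.\<close>
    then have "e / 2 * (l - \<alpha>) > 0" using \<alpha> by simp
    from *[OF p(1) this] show "\<forall>\<^sub>F n in sequentially. p (R (u n) - R x) < e"
    proof (rule eventually_mono)
      fix n assume "\<forall>t\<ge>0. p (S t (u n - x)) \<le> e / 2 * (l - \<alpha>) * exp (\<alpha> * t)"
      then have "p (R (u n - x)) \<le> e / 2"
        using R_bound[OF p(1) \<alpha>(2), of "u n - x" "e / 2 * (l - \<alpha>)" 0] \<alpha>(2)
        by (simp add: S_0 del: times_divide_eq_left)
      then show "p (R (u n) - R x) < e" using p by (simp add: linear_diff[OF linear_R])
    qed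
  qed
qed

text \<open>R commutes with S, so it maps the difference quotients of x to those of R x, whose limit
  is known. The boundedness condition in the domain of the bi-generator is what allows R to pass
  through the \<tau>-limit.\<close>

lemma R_left_inverse:
  assumes lim: "limitin \<tau>P (\<lambda>t. (1 / t) *\<^sub>R (S t x - x)) y (at_right 0)"
    and bdd: "bdd_above ((\<lambda>t. (1 / t) * norm (S t x - x)) ` {0<..1})"
  shows "R (l *\<^sub>R x - y) = x"
proof -
  define t where "t n = inverse (real (Suc n))" for n
  have t: "t n > 0" "t n \<le> 1" for n by (auto simp: t_def field_simps)
  obtain C where C: "\<And>s. s \<in> {0<..1} \<Longrightarrow> (1 / s) * norm (S s x - x) \<le> C"
    using bdd unfolding bdd_above_def by blast
  define u where "u n = (1 / t n) *\<^sub>R (S (t n) x - x)" for n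
  have "norm (u n) \<le> C" for n using C[of "t n"] t[of n] by (simp add: u_def)
  moreover have "tl u y" unfolding u_def t_def by (rule tl_at_right[OF lim])
  ultimately have "tl (\<lambda>n. R (u n)) (R y)" by (rule R_tl_continuous)
  moreover have "R (u n) = (1 / t n) *\<^sub>R (S (t n) (R x) - R x)" for n
    using t[of n] by (simp add: u_def linear_scale[OF linear_R] linear_diff[OF linear_R] S_R)
  moreover have "tl (\<lambda>n. (1 / t n) *\<^sub>R (S (t n) (R x) - R x)) (l *\<^sub>R R x - x)"
    unfolding t_def by (rule tl_at_right[OF R_generator_limit])
  ultimately have "R y = l *\<^sub>R R x - x" using tl_unique by simp
  then show ?thesis by (simp add: linear_diff[OF linear_R] linear_scale[OF linear_R])
qed

section \<open>The bi-generator and its resolvent\<close>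

context
  fixes D A assumes gen: "bi_generator \<tau>P S D A"
begin

lemma generator_domain_iff:
  "x \<in> D \<longleftrightarrow> (\<exists>y. limitin \<tau>P (\<lambda>t. (1 / t) *\<^sub>R (S t x - x)) y (at_right 0)) \<and>
    bdd_above ((\<lambda>t. (1 / t) * norm (S t x - x)) ` {0<..1})"
  using conjunct1[OF gen[unfolded bi_generator_def]] by simp

lemma generator_limit:
  "x \<in> D \<Longrightarrow> limitin \<tau>P (\<lambda>t. (1 / t) *\<^sub>R (S t x - x)) (A x) (at_right 0)"
  using conjunct2[OF gen[unfolded bi_generator_def]] by simp

lemma R_in_domain: "R x \<in> D"
  unfolding generator_domain_iff by (intro conjI exI) (rule R_generator_limit, rule R_generator_bdd)

lemma generator_R: "A (R x) = l *\<^sub>R R x - x"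
proof -
  show ?thesis
    using tl_at_right[OF generator_limit[OF R_in_domain]] tl_at_right[OF R_generator_limit]
    by (rule tl_unique)
qed

lemma R_generator: "x \<in> D \<Longrightarrow> R (l *\<^sub>R x - A x) = x"
  using generator_limit by (intro R_left_inverse) (auto simp: generator_domain_iff)

lemma generator_bij: "bij_betw (\<lambda>x. smul (of_real l) x - A x) D UNIV"
  unfolding smul_of_real
  by (rule bij_betw_byWitness[where f' = R]) (auto simp: R_generator generator_R R_in_domain)

lemma resolvent_eq_R: "resolvent smul D A (of_real l) = R"
proof
  fix x
  show "resolvent smul D A (of_real l) x = R x"
    unfolding resolvent_def
    by (rule the_inv_into_f_eq[OF bij_betw_imp_inj_on[OF generator_bij]])
      (simp_all add: smul_of_real generator_R R_in_domain)
qed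

text \<open>Each u n is \<open>R (l u n - A (u n))\<close>, and R preserves \<tau>-limits of bounded
  sequences; so x is R of \<open>l x - y\<close>, from which both claims are read off.\<close>

lemma generator_bi_closed: "bi_closed \<tau>P D A"
  unfolding bi_closed_def
proof (intro allI impI, elim conjE)
  fix u :: "nat \<Rightarrow> 'a" and x y
  assume uD: "range u \<subseteq> D" and b: "bounded (range u)" "bounded (range (\<lambda>i. A (u i)))"
    and u: "tl u x" "tl (\<lambda>i. A (u i)) y"
  obtain B C where BC: "\<And>n. norm (u n) \<le> B" "\<And>n. norm (A (u n)) \<le> C"
    using b by (auto simp: bounded_iff)
  have "norm (l *\<^sub>R u n - A (u n)) \<le> \<bar>l\<bar> * B + C" for n
    using norm_triangle_ineq4[of "l *\<^sub>R u n" "A (u n)"] BC[of n]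
      mult_left_mono[OF BC(1)[of n], of "\<bar>l\<bar>"] by simp
  moreover have "tl (\<lambda>n. l *\<^sub>R u n - A (u n)) (l *\<^sub>R x - y)"
    by (intro tl_diff tl_scaleR u tendsto_const)
  ultimately have "tl (\<lambda>n. R (l *\<^sub>R u n - A (u n))) (R (l *\<^sub>R x - y))"
    by (rule R_tl_continuous)
  moreover have "R (l *\<^sub>R u n - A (u n)) = u n" for n
    using uD by (intro R_generator) auto
  ultimately have "x = R (l *\<^sub>R x - y)" using u(1) tl_unique by simp
  then show "x \<in> D \<and> A x = y"
    using R_in_domain[of "l *\<^sub>R x - y"] generator_R[of "l *\<^sub>R x - y"] by simp
qed

text \<open>The difference quotients of \<open>V t (R x)\<close> at 0, with reversed sign,
  approximate x boundedly, and they lie in the range of R because R commutes with V.\<close>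

lemma generator_bi_densely_defined: "bi_densely_defined \<tau>P D"
  unfolding bi_densely_defined_def
proof (intro allI exI conjI)
  fix x
  define t where "t n = inverse (real (Suc n))" for n
  have t: "t n > 0" for n by (auto simp: t_def)
  let ?u = "\<lambda>n. (1 / t n) *\<^sub>R (R x - V (t n) (R x))"
  have "?u n = R ((1 / t n) *\<^sub>R (x - V (t n) x))" for n
    using t[of n] unfolding V_def
    by (simp add: linear_scale[OF linear_R] linear_diff[OF linear_R] S_R)
  then show "range ?u \<subseteq> D" using R_in_domain by auto
  have "norm (?u n) \<le> M * norm x" for n
    using t by (intro R_increment_norm')
  then show "bounded (range ?u)" unfolding bounded_iff by blast
  have "limitin \<tau>P (\<lambda>t. (1 / t) *\<^sub>R (R x - V t (R x))) x (at_right 0)"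
    unfolding limitin_\<tau>P using R_increment_limit by blast
  from tl_at_right[OF this] show "tl ?u x" by (simp add: t_def)
qed

end

end

context bi_semigroup
begin

lemma generator_in_resolvent_set:
  assumes gen: "bi_generator \<tau>P S D A" and l: "l > \<omega>"
  shows "of_real l \<in> resolvent_set smul D A"
proof -
  interpret bi_semigroup_resolvent smul P S M \<omega> l by unfold_locales (rule l)
  have "norm (R x) \<le> norm x * (M / (l - \<omega>))" for x
  proof -
    have "(l - \<omega>) * norm (R x) \<le> M * norm x"
      using R_power_norm_bound[of 1 x] l unfolding norm_scaleR by simp
    then show ?thesis using l by (simp add: pos_le_divide_eq mult.commute)
  qed
  then have "bounded_linear R"
    using linear_R by (intro bounded_linear_intro[of R "M / (l - \<omega>)"]) (auto simp: linear_add linear_scale)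
  moreover have "Vector_Spaces.linear smul smul R" by (intro smul_linearI R_add R_smul)
  ultimately show ?thesis
    using generator_bij[OF gen] resolvent_eq_R[OF gen]
    unfolding resolvent_set_def bounded_operator_def by simp
qed

lemma generator_resolvent_onorm:
  assumes gen: "bi_generator \<tau>P S D A" and l: "l > \<omega>"
  shows "onorm (\<lambda>x. (l - \<omega>) ^ m *\<^sub>R (resolvent smul D A (of_real l) ^^ m) x) \<le> M"
proof -
  interpret bi_semigroup_resolvent smul P S M \<omega> l by unfold_locales (rule l)
  show ?thesis
    unfolding resolvent_eq_R[OF gen] using R_power_norm_bound M by (intro onorm_bound) auto
qed

text \<open>The orbit bound of rate \<alpha> involves neither s nor m, so the index n is fixed
  before them; each s then gives its own resolvent R, with the same bound for all powers. The factor
  1 / 2 makes the final inequality strict.\<close>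

lemma generator_resolvent_bi_equicontinuous:
  assumes gen: "bi_generator \<tau>P S D A" and \<alpha>: "\<alpha> > \<omega>"
  shows "bi_equicontinuous \<tau>P {(s, m). s > \<alpha> \<and> m \<ge> m0}
    (\<lambda>(s, m) x. (s - \<alpha>) ^ m *\<^sub>R (resolvent smul D A (of_real s) ^^ m) x)"
  unfolding bi_equicontinuous_\<tau>P
proof (intro allI impI ballI, elim conjE)
  fix u C p and e :: real
  assume u: "\<forall>n. norm (u n) \<le> C" "tl u 0" and p: "p \<in> P" "e > 0"
  have "\<forall>\<^sub>F n in sequentially. \<forall>t\<ge>0. p (S t (u n)) \<le> e / 2 * exp (\<alpha> * t)"
    using u p \<alpha> by (intro S_equi_exp) auto
  then show "\<forall>\<^sub>F n in sequentially. \<forall>j\<in>{(s, m). s > \<alpha> \<and> m \<ge> m0}.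
      p ((case j of (s, m) \<Rightarrow> \<lambda>x. (s - \<alpha>) ^ m *\<^sub>R (resolvent smul D A (of_real s) ^^ m) x) (u n)) < e"
  proof (rule eventually_mono, intro ballI)
    fix n j assume S: "\<forall>t\<ge>0. p (S t (u n)) \<le> e / 2 * exp (\<alpha> * t)"
      and j: "j \<in> {(s, m). s > \<alpha> \<and> m \<ge> m0}"
    obtain s m where sm: "j = (s, m)" by (cases j)
    have s: "s > \<alpha>" using j by (simp add: sm)
    interpret bi_semigroup_resolvent smul P S M \<omega> s by unfold_locales (use s \<alpha> in simp)
    have "p ((s - \<alpha>) ^ m *\<^sub>R (R ^^ m) (u n)) \<le> e / 2"
      by (rule R_power_bound'[OF p(1) s]) (use S in simp)
    then show "p ((case j of (s, m) \<Rightarrow> \<lambda>x. (s - \<alpha>) ^ m *\<^sub>R (resolvent smul D A (of_real s) ^^ m) x) (u n)) < e"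
      using p(2) by (simp add: sm resolvent_eq_R[OF gen])
  qed
qed

lemma generator_unique_extension:
  assumes gen: "bi_generator \<tau>P S D' A'" and "D \<subseteq> D'" "\<And>x. x \<in> D \<Longrightarrow> A' x = A x"
    and l: "l > \<omega>" and surj: "\<And>y. \<exists>x\<in>D. l *\<^sub>R x - A x = y"
  shows "D' = D"
proof -
  interpret bi_semigroup_resolvent smul P S M \<omega> l by unfold_locales (rule l)
  have "x \<in> D" if x: "x \<in> D'" for x
  proof -
    obtain z where z: "z \<in> D" "l *\<^sub>R z - A z = l *\<^sub>R x - A' x" using surj by blast
    then have "R (l *\<^sub>R z - A' z) = R (l *\<^sub>R x - A' x)" using assms(3) by simp
    then have "z = x" using R_generator[OF gen] x z(1) assms(2) by auto
    then show ?thesis using z(1) by simp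
  qed
  then show ?thesis using assms(2) by blast
qed

end

section \<open>Generation by implicit Euler steps\<close>

text \<open>Two rates are kept. The rate \<open>\<omega> / (1 - h n * \<omega>)\<close> tends to
  \<omega> and yields the sharp norm bound of the limit. The fixed \<alpha> dominates it for all n
  and, being nonnegative, makes \<open>exp (\<alpha> t)\<close> monotone, which suits all other
  estimates. The shift n0 leaves room to start with steps so small that \<open>1 / h n\<close> is in
  the resolvent set.\<close>

locale euler_scheme = norming_seminorms smul P
  for smul :: "'k::real_normed_field \<Rightarrow> 'a::real_normed_vector \<Rightarrow> 'a" and P +
  fixes D :: "'a set" and A :: "'a \<Rightarrow> 'a" and J :: "nat \<Rightarrow> 'a \<Rightarrow> 'a" and n0 :: nat and h :: "nat \<Rightarrow> real"
    and M \<omega> \<alpha> :: real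
  assumes operator: "linear_operator smul D A"
    and dense: "bi_densely_defined (seminorm_topology P) D"
    and h_eq: "h n = 1 / 2 ^ (n + n0)"
    and J_linear: "Vector_Spaces.linear smul smul (J n)"
    and J_in_D: "J n x \<in> D"
    and J_right: "J n x - h n *\<^sub>R A (J n x) = x"
    and J_left: "x \<in> D \<Longrightarrow> J n (x - h n *\<^sub>R A x) = x"
    and M: "M \<ge> 1" and \<alpha>: "\<alpha> \<ge> 0" and \<omega>_le_\<alpha>: "\<omega> / (1 - h n * \<omega>) \<le> \<alpha>"
    and J_norm_sharp: "norm ((J n ^^ k) x) \<le> M * exp (real k * h n * (\<omega> / (1 - h n * \<omega>))) * norm x"
    and J_equi: "(\<And>i. norm (u i) \<le> C) \<Longrightarrow> limitin (seminorm_topology P) u 0 sequentially \<Longrightarrow>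
      p \<in> P \<Longrightarrow> e > 0 \<Longrightarrow> \<forall>\<^sub>F i in sequentially. \<forall>n k. p ((J n ^^ k) (u i)) \<le> e * exp (\<alpha> * (real k * h n))"
begin

lemma h_pos: "h n > 0" by (simp add: h_eq)

lemma h_Suc: "h n = 2 * h (Suc n)" by (simp add: h_eq)

lemma h_tendsto: "h \<longlonglongrightarrow> 0"
proof -
  have "(\<lambda>n. (1 / 2) ^ n * (1 / 2) ^ n0) \<longlonglongrightarrow> (0::real) * (1 / 2) ^ n0"
    by (intro tendsto_intros LIMSEQ_realpow_zero) auto
  then show ?thesis by (simp add: h_eq[abs_def] power_add power_one_over)
qed

lemma A_add: "x \<in> D \<Longrightarrow> y \<in> D \<Longrightarrow> A (x + y) = A x + A y"
  using operator unfolding linear_operator_def by blast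

lemma D_add: "x \<in> D \<Longrightarrow> y \<in> D \<Longrightarrow> x + y \<in> D"
  using operator unfolding linear_operator_def by (blast intro: subspace_add)

lemma D_scaleR: "x \<in> D \<Longrightarrow> r *\<^sub>R x \<in> D"
  using operator subspace_scale[of D x "of_real r"] unfolding linear_operator_def smul_of_real by blast

lemma A_scaleR: "x \<in> D \<Longrightarrow> A (r *\<^sub>R x) = r *\<^sub>R A x"
  using operator unfolding linear_operator_def smul_of_real[symmetric] by blast

lemma D_diff: "x \<in> D \<Longrightarrow> y \<in> D \<Longrightarrow> x - y \<in> D"
  using D_add[of x "(- 1) *\<^sub>R y"] D_scaleR[of y "- 1"] by simp

lemma A_diff: "x \<in> D \<Longrightarrow> y \<in> D \<Longrightarrow> A (x - y) = A x - A y"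
  using A_add[of x "(- 1) *\<^sub>R y"] D_scaleR[of y "- 1"] A_scaleR[of y "- 1"] by simp

lemma linear_J: "linear (J n)" by (rule real_linear[OF J_linear])

lemma linear_Jk: "linear (J n ^^ k)"
proof (induction k)
  case (Suc k)
  then show ?case using linear_compose[OF Suc linear_J[of n]] by (simp add: o_def)
qed (auto intro!: linearI)

lemma J_smul: "J n (smul c x) = smul c (J n x)"
  using module_hom.scale[of smul smul "J n"] J_linear[of n] unfolding module_hom_iff_linear by blast

lemma Jk_smul: "(J n ^^ k) (smul c x) = smul c ((J n ^^ k) x)"
  by (induction k) (simp_all add: J_smul)

lemma J_norm: "norm ((J n ^^ k) x) \<le> M * exp (\<alpha> * (real k * h n)) * norm x"
proof -
  have "real k * h n * (\<omega> / (1 - h n * \<omega>)) \<le> real k * h n * \<alpha>"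
    using h_pos[of n] by (intro mult_left_mono \<omega>_le_\<alpha>) auto
  then have "M * exp (real k * h n * (\<omega> / (1 - h n * \<omega>))) * norm x \<le> M * exp (\<alpha> * (real k * h n)) * norm x"
    using M by (intro mult_right_mono mult_left_mono) (auto simp: mult_ac)
  then show ?thesis using J_norm_sharp order_trans by blast
qed

lemma J_norm_le:
  assumes "real k * h n \<le> T"
  shows "norm ((J n ^^ k) x) \<le> M * exp (\<alpha> * T) * norm x"
proof -
  have "M * exp (\<alpha> * (real k * h n)) * norm x \<le> M * exp (\<alpha> * T) * norm x"
    using M assms \<alpha> by (intro mult_right_mono mult_left_mono) (auto simp: mult_left_mono)
  then show ?thesis using J_norm order_trans by blast
qed

lemma J_A: "x \<in> D \<Longrightarrow> A (J n x) = J n (A x)"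
proof -
  assume x: "x \<in> D"
  have "J n x - h n *\<^sub>R J n (A x) = x"
    using J_left[OF x, of n] by (simp add: linear_diff[OF linear_J] linear_scale[OF linear_J])
  then have "h n *\<^sub>R A (J n x) = h n *\<^sub>R J n (A x)"
    using J_right[of n x] by (metis diff_diff_eq2 add_diff_cancel_left')
  then show ?thesis using h_pos[of n] by simp
qed

lemma Jk_A: "x \<in> D \<Longrightarrow> (J n ^^ k) x \<in> D \<and> A ((J n ^^ k) x) = (J n ^^ k) (A x)"
  by (induction k) (auto simp: J_in_D J_A)

lemma J_minus_id: "x \<in> D \<Longrightarrow> J n x - x = h n *\<^sub>R J n (A x)"
  using J_right[of n x] J_A[of x n] by (metis diff_diff_eq2 add_diff_cancel_left')

lemma Jk_Lipschitz:
  assumes x: "x \<in> D" and T: "real (k + j) * h n \<le> T"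
  shows "norm ((J n ^^ (k + j)) x - (J n ^^ k) x) \<le> real j * h n * (M * exp (\<alpha> * T) * norm (A x))"
  using T
proof (induction j)
  case (Suc j)
  let ?K = "M * exp (\<alpha> * T) * norm (A x)"
  have "real (k + j) * h n \<le> real (k + Suc j) * h n" using h_pos[of n] by (intro mult_right_mono) auto
  with Suc have IH: "norm ((J n ^^ (k + j)) x - (J n ^^ k) x) \<le> real j * h n * ?K" by simp
  have "(J n ^^ (k + Suc j)) x - (J n ^^ (k + j)) x = (J n ^^ (k + j)) (J n x - x)"
    by (simp add: linear_diff[OF linear_Jk] funpow_swap1)
  also have "\<dots> = h n *\<^sub>R (J n ^^ (k + Suc j)) (A x)"
    by (simp add: J_minus_id[OF x] linear_scale[OF linear_Jk] funpow_swap1)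
  finally have "norm ((J n ^^ (k + Suc j)) x - (J n ^^ (k + j)) x) \<le> h n * ?K"
    using J_norm_le[OF Suc.prems, of "A x"] h_pos[of n] by (simp add: mult_left_mono)
  then have "norm (((J n ^^ (k + Suc j)) x - (J n ^^ (k + j)) x) + ((J n ^^ (k + j)) x - (J n ^^ k) x))
      \<le> h n * ?K + real j * h n * ?K"
    using IH by (rule norm_triangle_mono)
  then show ?case by (simp add: algebra_simps)
qed simp

text \<open>With \<open>g = h / 2\<close> this is \<open>(1 - g A)\<^sup>2 = (1 - h A) + g\<^sup>2 A\<^sup>2\<close>, inverted.\<close>

lemma J_refine:
  assumes x: "x \<in> D" "A x \<in> D"
  shows "J (Suc n) (J (Suc n) x) - J n x = - ((h (Suc n))\<^sup>2 *\<^sub>R J (Suc n) (J (Suc n) (A (A (J n x)))))"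
proof -
  define g where "g = h (Suc n)"
  define v where "v = J n x"
  have v: "v \<in> D" "A v \<in> D" using J_A[OF x(1), of n] J_in_D by (auto simp: v_def)
  have "(v - g *\<^sub>R A v) - g *\<^sub>R A (v - g *\<^sub>R A v) = v - (2 * g) *\<^sub>R A v + g\<^sup>2 *\<^sub>R A (A v)"
    using v by (simp add: A_diff A_scaleR D_scaleR algebra_simps power2_eq_square)
      (simp flip: scaleR_add_left)
  also have "v - (2 * g) *\<^sub>R A v = x"
    using J_right[of n x] h_Suc[of n] by (simp add: v_def g_def)
  finally have *: "(v - g *\<^sub>R A v) - g *\<^sub>R A (v - g *\<^sub>R A v) = x + g\<^sup>2 *\<^sub>R A (A v)" .
  have "J (Suc n) (J (Suc n) (x + g\<^sup>2 *\<^sub>R A (A v))) = v"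
    unfolding *[symmetric] unfolding g_def
    using v by (simp only: J_left D_diff D_scaleR)
  then have "J (Suc n) (J (Suc n) x) + g\<^sup>2 *\<^sub>R J (Suc n) (J (Suc n) (A (A v))) = v"
    by (simp add: linear_add[OF linear_J] linear_scale[OF linear_J])
  then show ?thesis by (simp add: v_def g_def algebra_simps)
qed

text \<open>One coarse step at a time is replaced by two fine ones, each time with the local error
  from \<open>J_refine\<close>; stability of the fine scheme carries these errors to the end. The
  induction moves x along the coarse orbit, which is why c bounds \<open>A (A x)\<close> on that
  orbit.\<close>

lemma Jk_refine:
  assumes "x \<in> D" "A x \<in> D" and "\<And>j. j \<le> N \<Longrightarrow> norm (A (A ((J n ^^ j) x))) \<le> c"
    and T: "real N * h n \<le> T"
  shows "norm ((J (Suc n) ^^ (2 * N)) x - (J n ^^ N) x) \<le> real N * (h (Suc n))\<^sup>2 * (M * exp (\<alpha> * T) * c)"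
  using assms
proof (induction N arbitrary: x)
  case (Suc N)
  let ?g = "h (Suc n)" and ?K = "M * exp (\<alpha> * T) * c"
  let ?x = "J n x"
  have TN: "real N * h n \<le> T"
    using Suc.prems(4) h_pos[of n] by (simp add: algebra_simps)
  have IH: "norm ((J (Suc n) ^^ (2 * N)) ?x - (J n ^^ N) ?x) \<le> real N * ?g\<^sup>2 * ?K"
  proof (rule Suc.IH)
    show "norm (A (A ((J n ^^ j) ?x))) \<le> c" if "j \<le> N" for j
      using Suc.prems(3)[of "Suc j"] that by (simp add: funpow_swap1)
  qed (use Suc.prems(1,2) J_A J_in_D TN in auto)
  have "(J (Suc n) ^^ (2 * Suc N)) x - (J (Suc n) ^^ (2 * N)) ?x
      = (J (Suc n) ^^ (2 * N)) (J (Suc n) (J (Suc n) x) - ?x)"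
    by (simp add: linear_diff[OF linear_Jk] funpow_swap1)
  also have "\<dots> = - (?g\<^sup>2 *\<^sub>R (J (Suc n) ^^ (2 * Suc N)) (A (A ?x)))"
    unfolding J_refine[OF Suc.prems(1,2)]
    by (simp add: linear_neg[OF linear_Jk] linear_scale[OF linear_Jk] funpow_swap1)
  finally have "norm ((J (Suc n) ^^ (2 * Suc N)) x - (J (Suc n) ^^ (2 * N)) ?x)
      = ?g\<^sup>2 * norm ((J (Suc n) ^^ (2 * Suc N)) (A (A ?x)))" by simp
  also have "\<dots> \<le> ?g\<^sup>2 * (M * exp (\<alpha> * T) * norm (A (A ?x)))"
    using Suc.prems(4) h_Suc[of n] by (intro mult_left_mono J_norm_le) (auto simp: algebra_simps)
  also have "\<dots> \<le> ?g\<^sup>2 * ?K"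
    using Suc.prems(3)[of 1] M by (intro mult_left_mono) auto
  finally have "norm ((J (Suc n) ^^ (2 * Suc N)) x - (J (Suc n) ^^ (2 * N)) ?x) \<le> ?g\<^sup>2 * ?K" .
  from norm_triangle_mono[OF this IH]
  have "norm ((J (Suc n) ^^ (2 * Suc N)) x - (J n ^^ N) ?x) \<le> ?g\<^sup>2 * ?K + real N * ?g\<^sup>2 * ?K"
    by simp
  then show ?case by (simp add: funpow_swap1 algebra_simps)
qed simp

section \<open>Euler approximations at real times\<close>

definition steps :: "nat \<Rightarrow> real \<Rightarrow> nat"
  where "steps n t = nat \<lfloor>t * 2 ^ (n + n0)\<rfloor>"

definition E :: "nat \<Rightarrow> real \<Rightarrow> 'a \<Rightarrow> 'a"
  where "E n t = J n ^^ steps n t"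

lemma steps_tendsto: "t \<ge> 0 \<Longrightarrow> (\<lambda>n. real (steps n t) * h n) \<longlonglongrightarrow> t"
  using LIMSEQ_ignore_initial_segment[OF dyadic_floor_tendsto[of t], of n0]
  by (simp add: steps_def h_eq)

lemma steps_le: "t \<ge> 0 \<Longrightarrow> real (steps n t) * h n \<le> t"
proof -
  assume "t \<ge> 0"
  then have "real (steps n t) \<le> t * 2 ^ (n + n0)" unfolding steps_def by simp
  then show ?thesis by (simp add: h_eq pos_divide_le_eq)
qed

lemma steps_mono: "s \<le> t \<Longrightarrow> steps n s \<le> steps n t"
  unfolding steps_def by (intro nat_mono floor_mono mult_right_mono) auto

lemma steps_Suc: "t \<ge> 0 \<Longrightarrow> steps (Suc n) t = 2 * steps n t \<or> steps (Suc n) t = 2 * steps n t + 1"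
proof -
  assume t: "t \<ge> 0"
  define y where "y = t * 2 ^ (n + n0)"
  have y: "y \<ge> 0" using t by (simp add: y_def)
  have "\<lfloor>2 * y\<rfloor> = 2 * \<lfloor>y\<rfloor> \<or> \<lfloor>2 * y\<rfloor> = 2 * \<lfloor>y\<rfloor> + 1" by linarith
  then have "nat \<lfloor>2 * y\<rfloor> = 2 * nat \<lfloor>y\<rfloor> \<or> nat \<lfloor>2 * y\<rfloor> = 2 * nat \<lfloor>y\<rfloor> + 1" using y by linarith
  moreover have "t * 2 ^ (Suc n + n0) = 2 * y" by (simp add: y_def)
  ultimately show ?thesis by (simp only: steps_def y_def[symmetric])
qed

lemma steps_add:
  "s \<ge> 0 \<Longrightarrow> t \<ge> 0 \<Longrightarrow> steps n (t + s) = steps n t + steps n s \<or> steps n (t + s) = steps n t + steps n s + 1"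
proof -
  assume st: "s \<ge> 0" "t \<ge> 0"
  define y where "y = t * 2 ^ (n + n0)"
  define z where "z = s * 2 ^ (n + n0)"
  have y: "y \<ge> 0" "z \<ge> 0" using st by (simp_all add: y_def z_def)
  have "\<lfloor>y + z\<rfloor> = \<lfloor>y\<rfloor> + \<lfloor>z\<rfloor> \<or> \<lfloor>y + z\<rfloor> = \<lfloor>y\<rfloor> + \<lfloor>z\<rfloor> + 1" by linarith
  moreover have "\<lfloor>y\<rfloor> \<ge> 0" "\<lfloor>z\<rfloor> \<ge> 0" using y by auto
  ultimately have "nat \<lfloor>y + z\<rfloor> = nat \<lfloor>y\<rfloor> + nat \<lfloor>z\<rfloor> \<or> nat \<lfloor>y + z\<rfloor> = nat \<lfloor>y\<rfloor> + nat \<lfloor>z\<rfloor> + 1" by linarith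
  moreover have "(t + s) * 2 ^ (n + n0) = y + z" by (simp add: y_def z_def algebra_simps)
  ultimately show ?thesis by (simp add: steps_def y_def z_def)
qed

text \<open>The first summand collects about t / h local errors of order \<open>h\<^sup>2\<close>;
  the second pays for a possible extra step caused by rounding t on the finer grid.\<close>

lemma E_step:
  assumes x: "x \<in> D" "A x \<in> D" and t: "0 \<le> t"
  shows "norm (E (Suc n) t x - E n t x) \<le>
    (t * (M * exp (\<alpha> * t) * (M * exp (\<alpha> * t) * norm (A (A x)))) + M * exp (\<alpha> * t) * norm (A x)) * h (Suc n)"
proof -
  define N where "N = steps n t"
  define g where "g = h (Suc n)"
  define K where "K = M * exp (\<alpha> * t) * (M * exp (\<alpha> * t) * norm (A (A x)))"
  have g: "g > 0" using h_pos by (simp add: g_def)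
  have K: "K \<ge> 0" using M by (simp add: K_def)
  have N: "real N * h n \<le> t" unfolding N_def by (rule steps_le[OF t])
  have "norm ((J (Suc n) ^^ (2 * N)) x - (J n ^^ N) x) \<le> real N * g\<^sup>2 * K"
    unfolding g_def K_def
  proof (rule Jk_refine[OF x _ N])
    fix j assume "j \<le> N"
    then have "real j * h n \<le> t" using h_pos[of n] by (intro order_trans[OF _ N] mult_right_mono) auto
    moreover have "A (A ((J n ^^ j) x)) = (J n ^^ j) (A (A x))" using x by (simp add: Jk_A)
    ultimately show "norm (A (A ((J n ^^ j) x))) \<le> M * exp (\<alpha> * t) * norm (A (A x))"
      using J_norm_le by simp
  qed
  also have "real N * g\<^sup>2 * K \<le> t * K * g"
  proof -
    have "real N * g \<le> t" using N g h_Suc[of n] unfolding g_def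
      by (intro order_trans[OF _ N] mult_left_mono) auto
    then have "real N * g * (K * g) \<le> t * (K * g)" using K g by (intro mult_right_mono) auto
    then show ?thesis by (simp add: power2_eq_square mult_ac)
  qed
  finally have 1: "norm ((J (Suc n) ^^ (2 * N)) x - (J n ^^ N) x) \<le> t * K * g" .
  \<comment> \<open>The value is 0 or 1, because the floor of 2 y is twice the floor of y, or one
    more.\<close>
  define j where "j = steps (Suc n) t - 2 * N"
  have j: "steps (Suc n) t = 2 * N + j" "j \<le> 1" using steps_Suc[OF t, of n] by (auto simp: j_def N_def)
  have "norm ((J (Suc n) ^^ (2 * N + j)) x - (J (Suc n) ^^ (2 * N)) x) \<le> real j * g * (M * exp (\<alpha> * t) * norm (A x))"
    unfolding g_def using steps_le[OF t, of "Suc n"] by (intro Jk_Lipschitz x(1)) (simp add: j)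
  also have "\<dots> \<le> 1 * g * (M * exp (\<alpha> * t) * norm (A x))"
    using j(2) g M by (intro mult_right_mono) auto
  finally have "norm ((J (Suc n) ^^ (2 * N + j)) x - (J (Suc n) ^^ (2 * N)) x) \<le> g * (M * exp (\<alpha> * t) * norm (A x))"
    by simp
  from norm_triangle_mono[OF this 1]
  have "norm (E (Suc n) t x - E n t x) \<le> g * (M * exp (\<alpha> * t) * norm (A x)) + t * K * g"
    by (simp add: E_def j(1) N_def)
  then show ?thesis by (simp add: K_def g_def algebra_simps)
qed

text \<open>Since \<open>h (Suc n) = h n - h (Suc n)\<close>, the errors of successive halvings
  telescope to \<open>h n - h (n + j)\<close>.\<close>

lemma E_Cauchy_core:
  assumes x: "x \<in> D" "A x \<in> D" and t: "0 \<le> t"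
  obtains G where "G \<ge> 0" "\<And>n j. norm (E (n + j) t x - E n t x) \<le> G * h n"
proof -
  define G where "G = t * (M * exp (\<alpha> * t) * (M * exp (\<alpha> * t) * norm (A (A x)))) + M * exp (\<alpha> * t) * norm (A x)"
  have G: "G \<ge> 0" using t M by (auto simp: G_def)
  have "norm (E (n + j) t x - E n t x) \<le> G * (h n - h (n + j))" for n j
  proof (induction j)
    case (Suc j)
    have "norm (E (Suc (n + j)) t x - E (n + j) t x) \<le> G * h (Suc (n + j))"
      unfolding G_def by (rule E_step[OF x t])
    from norm_triangle_mono[OF this Suc.IH] show ?case
      using h_Suc[of "n + j"] by (simp add: algebra_simps)
  qed simp
  then have "norm (E (n + j) t x - E n t x) \<le> G * h n" for n j
    using mult_left_mono[OF _ G, of "h n - h (n + j)" "h n"] h_pos[of "n + j"] order_trans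
    by (smt (verit))
  then show thesis using that G by blast
qed

text \<open>Replaces the seminorm \<open>sup p ((J n)\<^sup>k x) exp (- \<alpha> k h)\<close>, which is small along bounded
  \<open>\<tau>\<close>-null sequences by bi-equicontinuity.\<close>

definition dominated :: "('a \<Rightarrow> real) \<Rightarrow> 'a \<Rightarrow> real \<Rightarrow> bool"
  where "dominated p x c \<longleftrightarrow> (\<forall>n k. p ((J n ^^ k) x) \<le> c * exp (\<alpha> * (real k * h n)))"

lemma dominated_le:
  assumes "dominated p x c" "p \<in> P" "real k * h n \<le> t"
  shows "p ((J n ^^ k) x) \<le> c * exp (\<alpha> * t)"
proof -
  \<comment> \<open>The instance n = k = 0 shows that c is nonnegative.\<close>
  have "p ((J 0 ^^ 0) x) \<le> c * exp (\<alpha> * (real 0 * h 0))" using assms(1) unfolding dominated_def by blast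
  then have "c \<ge> 0" using sn_nonneg[OF assms(2), of x] by simp
  then have "c * exp (\<alpha> * (real k * h n)) \<le> c * exp (\<alpha> * t)"
    using assms(3) \<alpha> by (intro mult_left_mono) (auto intro: mult_left_mono)
  then show ?thesis using assms(1) order_trans unfolding dominated_def by blast
qed

lemma dominated_norm: "p \<in> P \<Longrightarrow> dominated p x (M * norm x)"
  unfolding dominated_def using order_trans[OF sn_le_norm J_norm] by (simp add: mult_ac)

lemma dominated_add:
  assumes "p \<in> P" "dominated p x c" "dominated p y d" shows "dominated p (x + y) (c + d)"
  unfolding dominated_def
proof (intro allI)
  fix n k
  have "p ((J n ^^ k) (x + y)) \<le> p ((J n ^^ k) x) + p ((J n ^^ k) y)"
    unfolding linear_add[OF linear_Jk] by (rule sn_triangle[OF assms(1)])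
  also have "\<dots> \<le> c * exp (\<alpha> * (real k * h n)) + d * exp (\<alpha> * (real k * h n))"
    using assms(2,3) unfolding dominated_def by (intro add_mono) auto
  finally show "p ((J n ^^ k) (x + y)) \<le> (c + d) * exp (\<alpha> * (real k * h n))" by (simp add: algebra_simps)
qed

text \<open>Bi-density gives v in D, and \<open>J_equi\<close> makes the error small along all Euler
  orbits at once. Then \<open>J n v\<close> replaces v: its image under A is
  \<open>J n (A v)\<close>, which is in D again, and the norm error \<open>h n J n (A v)\<close>
  tends to 0.\<close>

lemma D2_dense:
  assumes p: "p \<in> P" "e > 0"
  obtains y where "y \<in> D" "A y \<in> D" "dominated p (x - y) e"
proof -
  obtain u where u: "range u \<subseteq> D" "bounded (range u)" "tl u x"
    using dense unfolding bi_densely_defined_def by blast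
  obtain C where C: "\<And>n. norm (u n) \<le> C" using u(2) by (auto simp: bounded_iff)
  have "norm (x - u n) \<le> norm x + C" for n
    using norm_triangle_ineq4[of x "u n"] C[of n] by linarith
  moreover have "tl (\<lambda>n. x - u n) 0" using tl_diff[OF tl_const u(3), of x] by simp
  ultimately have "\<forall>\<^sub>F i in sequentially. \<forall>n k. p ((J n ^^ k) (x - u i)) \<le> e / 2 * exp (\<alpha> * (real k * h n))"
    using p(1) by (rule J_equi) (use p in simp)
  then obtain i where "dominated p (x - u i) (e / 2)"
    unfolding dominated_def by (auto simp: eventually_sequentially)
  define v where "v = u i"
  have v: "v \<in> D" "dominated p (x - v) (e / 2)"
    using u(1) \<open>dominated p (x - u i) (e / 2)\<close> by (auto simp: v_def)
  \<comment> \<open>The outer M is the price of \<open>dominated_norm\<close>; the inner factor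
    bounds \<open>J n (A v)\<close>.\<close>
  have "(\<lambda>n. M * (h n * (M * exp (\<alpha> * h n) * norm (A v)))) \<longlonglongrightarrow> M * (0 * (M * exp (\<alpha> * 0) * norm (A v)))"
    by (intro tendsto_intros h_tendsto)
  then have "\<forall>\<^sub>F n in sequentially. M * (h n * (M * exp (\<alpha> * h n) * norm (A v))) < e / 2"
    by (rule order_tendstoD) (use p in simp)
  then obtain n where n: "M * (h n * (M * exp (\<alpha> * h n) * norm (A v))) < e / 2"
    by (auto simp: eventually_sequentially)
  have "norm (v - J n v) = norm (h n *\<^sub>R J n (A v))"
    unfolding J_minus_id[OF v(1), symmetric] by (rule norm_minus_commute)
  also have "\<dots> = h n * norm (J n (A v))" using h_pos[of n] by simp
  also have "\<dots> \<le> h n * (M * exp (\<alpha> * h n) * norm (A v))"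
    using J_norm_le[of 1 n "h n" "A v"] h_pos[of n] by (intro mult_left_mono) auto
  finally have "M * norm (v - J n v) \<le> e / 2"
    using n M mult_left_mono[of "norm (v - J n v)" "h n * (M * exp (\<alpha> * h n) * norm (A v))" M]
    by linarith
  moreover have "dominated p (v - J n v) (M * norm (v - J n v))" by (rule dominated_norm[OF p(1)])
  ultimately have "dominated p (v - J n v) (e / 2)"
    unfolding dominated_def by (meson exp_ge_zero mult_right_mono order_trans)
  from dominated_add[OF p(1) v(2) this] have "dominated p (x - J n v) e" by simp
  moreover have "A (J n v) \<in> D" using J_A[OF v(1)] J_in_D by simp
  ultimately show thesis using that J_in_D by blast
qed

lemma E_norm: "t \<ge> 0 \<Longrightarrow> norm (E n t x) \<le> M * exp (\<alpha> * t) * norm x"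
  unfolding E_def by (intro J_norm_le steps_le)

lemma E_dominated: "dominated p x c \<Longrightarrow> p \<in> P \<Longrightarrow> t \<ge> 0 \<Longrightarrow> p (E n t x) \<le> c * exp (\<alpha> * t)"
  unfolding E_def by (intro dominated_le steps_le)

lemma linear_E: "linear (E n t)"
  unfolding E_def by (rule linear_Jk)

lemma E_converges:
  assumes t: "t \<ge> 0" shows "\<exists>y. tl (\<lambda>n. E n t x) y"
proof (rule bounded_Cauchy_converges)
  show "bounded (range (\<lambda>n. E n t x))" unfolding bounded_iff using E_norm[OF t] by blast
next
  fix p and e :: real assume p: "p \<in> P" "e > 0"
  \<comment> \<open>The exponential compensates the growth that a \<open>dominated\<close> bound
    allows up to time t.\<close>
  define e' where "e' = e / 4 * exp (- (\<alpha> * t))"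
  have e': "e' > 0" "e' * exp (\<alpha> * t) = e / 4" using p by (auto simp: e'_def mult_exp_exp)
  obtain y where y: "y \<in> D" "A y \<in> D" "dominated p (x - y) e'"
    using D2_dense[OF p(1) e'(1)] by blast
  obtain G where G: "G \<ge> 0" "\<And>n j. norm (E (n + j) t y - E n t y) \<le> G * h n"
    using E_Cauchy_core[OF y(1,2) t] by blast
  have "(\<lambda>n. G * h n) \<longlonglongrightarrow> G * 0" by (intro tendsto_intros h_tendsto)
  then have "\<forall>\<^sub>F n in sequentially. G * h n < e / 8" by (rule order_tendstoD) (use p in simp)
  then obtain N where N: "G * h N < e / 8" by (auto simp: eventually_sequentially)
  have small: "p (E m t x - E m t y) \<le> e / 4" for m
    using E_dominated[OF y(3) p(1) t, of m] e' by (simp add: linear_diff[OF linear_E])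
  have y_close: "p (E m t y - E N t y) < e / 8" if "m \<ge> N" for m
    using sn_le_norm[OF p(1), of "E m t y - E N t y"] G(2)[of N "m - N"] N that by simp
  have "p (E m t x - E n t x) < e" if "m \<ge> N" "n \<ge> N" for m n
  proof -
    have "p (E m t x - E n t x) \<le> p (E m t x - E m t y) + (p (E m t y - E N t y) + (p (E N t y - E n t y) + p (E n t y - E n t x)))"
      using sn_triangle_diff[OF p(1), of "E m t x" "E n t x" "E m t y"]
        sn_triangle_diff[OF p(1), of "E m t y" "E n t x" "E N t y"]
        sn_triangle_diff[OF p(1), of "E N t y" "E n t x" "E n t y"] by linarith
    then show ?thesis
      using small[of m] small[of n] y_close[OF that(1)] y_close[OF that(2)] p(2)
        sn_commute[OF p(1), of "E N t y" "E n t y"] sn_commute[OF p(1), of "E n t y" "E n t x"]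
      by linarith
  qed
  then show "\<exists>N. \<forall>m\<ge>N. \<forall>n\<ge>N. p (E m t x - E n t x) < e" by blast
qed

section \<open>The limit semigroup\<close>

definition S :: "real \<Rightarrow> 'a \<Rightarrow> 'a"
  where "S t x = (THE y. tl (\<lambda>n. E n t x) y)"

lemma E_tl: "t \<ge> 0 \<Longrightarrow> tl (\<lambda>n. E n t x) (S t x)"
proof -
  assume "t \<ge> 0"
  then have "\<exists>!y. tl (\<lambda>n. E n t x) y" using E_converges tl_unique by blast
  then show ?thesis unfolding S_def by (rule theI')
qed

lemma S_eqI: "t \<ge> 0 \<Longrightarrow> tl (\<lambda>n. E n t x) y \<Longrightarrow> S t x = y"
  using E_tl tl_unique by blast

lemma S_linear: "t \<ge> 0 \<Longrightarrow> Vector_Spaces.linear smul smul (S t)"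
proof (rule smul_linearI)
  assume t: "t \<ge> 0"
  show "S t (x + y) = S t x + S t y" for x y
    using tl_add[OF E_tl[OF t, of x] E_tl[OF t, of y]] by (intro S_eqI t) (simp add: linear_add[OF linear_E])
  show "S t (smul c x) = smul c (S t x)" for c x
    using tl_smul[OF E_tl[OF t, of x], of c] by (intro S_eqI t) (simp add: E_def Jk_smul)
qed

lemma linear_S: "t \<ge> 0 \<Longrightarrow> linear (S t)"
  by (rule real_linear[OF S_linear])

lemma S_0: "S 0 x = x"
  by (rule S_eqI) (simp_all add: E_def steps_def topspace_\<tau>P)

lemma S_dominated:
  assumes "dominated p x c" "p \<in> P" "t \<ge> 0" shows "p (S t x) \<le> c * exp (\<alpha> * t)"
  using E_dominated[OF assms] by (intro tl_le[OF E_tl assms(2) _ tendsto_const] assms(3)) auto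

text \<open>The rate depending on n is used here instead of \<alpha>, because its limit is exactly
  \<omega>.\<close>

lemma S_norm:
  assumes t: "t \<ge> 0" shows "norm (S t x) \<le> M * exp (\<omega> * t) * norm x"
proof (rule tl_norm_le[OF E_tl[OF t]])
  show "\<forall>\<^sub>F n in sequentially. norm (E n t x) \<le> M * exp (real (steps n t) * h n * (\<omega> / (1 - h n * \<omega>))) * norm x"
    unfolding E_def using J_norm_sharp by simp
  have "(\<lambda>n. M * exp (real (steps n t) * h n * (\<omega> / (1 - h n * \<omega>))) * norm x)
      \<longlonglongrightarrow> M * exp (t * (\<omega> / (1 - 0 * \<omega>))) * norm x"
    by (intro tendsto_intros steps_tendsto h_tendsto t) simp
  then show "(\<lambda>n. M * exp (real (steps n t) * h n * (\<omega> / (1 - h n * \<omega>))) * norm x)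
      \<longlonglongrightarrow> M * exp (\<omega> * t) * norm x"
    by (simp add: mult.commute)
qed

lemma E_Lipschitz:
  assumes x: "x \<in> D" and st: "0 \<le> s" "s \<le> t"
  shows "norm (E n t x - E n s x) \<le> (real (steps n t) * h n - real (steps n s) * h n) * (M * exp (\<alpha> * t) * norm (A x))"
proof -
  define j where "j = steps n t - steps n s"
  have j: "steps n t = steps n s + j" using steps_mono[OF st(2), of n] by (simp add: j_def)
  show ?thesis
    using Jk_Lipschitz[OF x, of "steps n s" j n t] steps_le[of t n] st
    by (simp add: E_def j algebra_simps)
qed

lemma S_Lipschitz:
  assumes x: "x \<in> D" and st: "0 \<le> s" "s \<le> t"
  shows "norm (S t x - S s x) \<le> (t - s) * (M * exp (\<alpha> * t) * norm (A x))"
proof (rule tl_norm_le)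
  show "tl (\<lambda>n. E n t x - E n s x) (S t x - S s x)"
    using st by (intro tl_diff E_tl) auto
  show "(\<lambda>n. (real (steps n t) * h n - real (steps n s) * h n) * (M * exp (\<alpha> * t) * norm (A x)))
      \<longlonglongrightarrow> (t - s) * (M * exp (\<alpha> * t) * norm (A x))"
    using st by (intro tendsto_intros steps_tendsto) auto
qed (use E_Lipschitz[OF x st] in simp)

text \<open>Orbits that start in D are Lipschitz in norm; \<open>dominated\<close> transfers
  continuity to every x, with an error in p that is uniform on bounded time intervals.\<close>

lemma S_cont:
  assumes t: "t \<ge> 0" and p: "p \<in> P" "e > 0"
  shows "\<exists>d>0. \<forall>s\<ge>0. \<bar>s - t\<bar> < d \<longrightarrow> p (S s x - S t x) < e"
proof -
  \<comment> \<open>The horizon t + 1 contains all s considered, since d will be at most 1.\<close>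
  define e' where "e' = e / 4 * exp (- (\<alpha> * (t + 1)))"
  have e': "e' > 0" "e' * exp (\<alpha> * (t + 1)) = e / 4" using p by (auto simp: e'_def mult_exp_exp)
  obtain y where y: "y \<in> D" "A y \<in> D" "dominated p (x - y) e'"
    using D2_dense[OF p(1) e'(1)] by blast
  define K where "K = M * exp (\<alpha> * (t + 1)) * norm (A y)"
  have K: "K \<ge> 0" using M by (simp add: K_def)
  have small: "p (S s (x - y)) \<le> e / 4" if "0 \<le> s" "s \<le> t + 1" for s
  proof -
    have "p (S s (x - y)) \<le> e' * exp (\<alpha> * s)" by (rule S_dominated[OF y(3) p(1) that(1)])
    also have "\<dots> \<le> e' * exp (\<alpha> * (t + 1))"
      using e'(1) \<alpha> that by (intro mult_left_mono) (auto intro: mult_left_mono)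
    finally show ?thesis using e' by simp
  qed
  have Lip: "norm (S b y - S a y) \<le> (b - a) * K" if "0 \<le> a" "a \<le> b" "b \<le> t + 1" for a b
  proof -
    have "norm (S b y - S a y) \<le> (b - a) * (M * exp (\<alpha> * b) * norm (A y))"
      by (rule S_Lipschitz[OF y(1) that(1,2)])
    also have "\<dots> \<le> (b - a) * K"
      unfolding K_def using that M \<alpha> by (intro mult_left_mono mult_right_mono) (auto intro: mult_left_mono)
    finally show ?thesis .
  qed
  define d where "d = min 1 (e / 4 / (K + 1))"
  have d: "d > 0" "d \<le> 1" "d * K < e / 2"
  proof -
    show "d > 0" "d \<le> 1" using p K by (auto simp: d_def)
    have "d * K \<le> e / 4 / (K + 1) * K" using K by (intro mult_right_mono) (auto simp: d_def)
    also have "\<dots> \<le> e / 4" using K p by (simp add: field_simps)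
    finally show "d * K < e / 2" using p by simp
  qed
  have "p (S s x - S t x) < e" if s: "s \<ge> 0" "\<bar>s - t\<bar> < d" for s
  proof -
    have st: "s \<le> t + 1" using s d(2) by linarith
    have "norm (S s y - S t y) \<le> \<bar>s - t\<bar> * K"
      using Lip[of s t] Lip[of t s] s(1) t st by (cases "s \<le> t") (auto simp: norm_minus_commute)
    also have "\<dots> \<le> d * K" using s(2) K by (intro mult_right_mono) auto
    finally have 1: "p (S s y - S t y) < e / 2"
      using sn_le_norm[OF p(1), of "S s y - S t y"] d(3) by linarith
    have "S s x - S t x = (S s (x - y) - S t (x - y)) + (S s y - S t y)"
      using s(1) t by (simp add: linear_diff[OF linear_S])
    then have "p (S s x - S t x) \<le> (p (S s (x - y)) + p (S t (x - y))) + p (S s y - S t y)"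
      using sn_triangle[OF p(1)] sn_diff[OF p(1)] add_right_mono order_trans by metis
    then show ?thesis using small[OF s(1) st] small[of t] t 1 by linarith
  qed
  then show ?thesis using d(1) by blast
qed

text \<open>\<open>J_equi\<close> is uniform in the step size as well as in the power, so its bound
  survives the limit that defines S t.\<close>

lemma S_equi:
  assumes C: "\<And>n. norm (u n) \<le> C" and "tl u 0" "p \<in> P" "e > 0"
  shows "\<forall>\<^sub>F n in sequentially. \<forall>t\<in>{0..T}. p (S t (u n)) < e"
proof -
  define e' where "e' = e / 2 * exp (- (\<alpha> * T))"
  have e': "e' > 0" "e' * exp (\<alpha> * T) = e / 2" using assms(4) by (auto simp: e'_def mult_exp_exp)
  from J_equi[OF assms(1-3) e'(1)] show ?thesis
  proof (rule eventually_mono, intro ballI)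
    fix i t assume "\<forall>n k. p ((J n ^^ k) (u i)) \<le> e' * exp (\<alpha> * (real k * h n))" and t: "t \<in> {0..T}"
    then have "p (S t (u i)) \<le> e' * exp (\<alpha> * t)"
      using assms(3) by (intro S_dominated) (auto simp: dominated_def)
    also have "\<dots> \<le> e' * exp (\<alpha> * T)"
      using e'(1) \<alpha> t by (intro mult_left_mono) (auto intro: mult_left_mono)
    finally show "p (S t (u i)) < e" using e'(2) assms(4) by simp
  qed
qed

text \<open>Operator and argument vary with the same n. The argument error
  \<open>E n s x - S s x\<close> is a bounded null sequence, and the uniformity of
  \<open>J_equi\<close> over all step sizes keeps it null under \<open>E n t\<close>.\<close>

lemma E_E_tl:
  assumes t: "t \<ge> 0" "s \<ge> 0"
  shows "tl (\<lambda>n. E n t (E n s x)) (S t (S s x))"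
proof -
  have "tl (\<lambda>n. E n t (E n s x - S s x)) 0"
  proof (rule tl_eventuallyI)
    fix p and e :: real assume p: "p \<in> P" "e > 0"
    define e' where "e' = e / 2 * exp (- (\<alpha> * t))"
    have e': "e' > 0" "e' * exp (\<alpha> * t) = e / 2" using p by (auto simp: e'_def mult_exp_exp)
    have b: "norm (E n s x - S s x) \<le> M * exp (\<alpha> * s) * norm x + norm (S s x)" for n
      using norm_triangle_ineq4[of "E n s x" "S s x"] E_norm[OF t(2), of n x] by linarith
    have "tl (\<lambda>n. E n s x - S s x) 0" using E_tl[OF t(2)] by (simp add: tl_zero_iff)
    from J_equi[OF b this p(1) e'(1)]
    show "\<forall>\<^sub>F n in sequentially. p (E n t (E n s x - S s x) - 0) < e"
    proof (rule eventually_mono)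
      fix n assume "\<forall>m k. p ((J m ^^ k) (E n s x - S s x)) \<le> e' * exp (\<alpha> * (real k * h m))"
      then have "p (E n t (E n s x - S s x)) \<le> e' * exp (\<alpha> * t)"
        using p t by (intro E_dominated) (auto simp: dominated_def)
      then show "p (E n t (E n s x - S s x) - 0) < e" using e' p by simp
    qed
  qed
  from tl_add[OF this E_tl[OF t(1), of "S s x"]]
  show ?thesis by (simp add: linear_diff[OF linear_E])
qed

text \<open>\<open>E n t\<close> after \<open>E n s\<close> is a power of J n whose exponent falls
  short of \<open>steps n (t + s)\<close> by at most one. On D this costs O(h) in norm, and the
  dense domain of \<open>A\<^sup>2\<close> carries it over to all x.\<close>

lemma S_add:
  assumes t: "t \<ge> 0" "s \<ge> 0"
  shows "S (t + s) x = S t (S s x)"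
proof -
  have "tl (\<lambda>n. E n (t + s) x - E n t (E n s x)) 0"
  proof (rule tl_eventuallyI)
    fix p and e :: real assume p: "p \<in> P" "e > 0"
    define e' where "e' = e / 4 * exp (- (\<alpha> * (t + s)))"
    have e': "e' > 0" "e' * exp (\<alpha> * (t + s)) = e / 4" using p by (auto simp: e'_def mult_exp_exp)
    obtain y where y: "y \<in> D" "A y \<in> D" "dominated p (x - y) e'"
      using D2_dense[OF p(1) e'(1)] by blast
    define K where "K = M * exp (\<alpha> * (t + s)) * norm (A y)"
    have EE: "E n t (E n s z) = (J n ^^ (steps n t + steps n s)) z" for n z
      by (simp add: E_def funpow_add)
    have le: "real (steps n t + steps n s) * h n \<le> t + s" for n
      using steps_le[OF t(1), of n] steps_le[OF t(2), of n] by (simp add: distrib_right)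
    have y_le: "norm (E n (t + s) y - E n t (E n s y)) \<le> h n * K" for n
    proof -
      obtain j where j: "steps n (t + s) = steps n t + steps n s + j" "j \<le> 1"
        using steps_add[OF t(2,1), of n] by auto
      have "norm (E n (t + s) y - E n t (E n s y)) \<le> real j * h n * K"
        using Jk_Lipschitz[OF y(1), of "steps n t + steps n s" j n "t + s"] steps_le[of "t + s" n] t
        unfolding EE K_def by (simp add: E_def j(1))
      also have "\<dots> \<le> 1 * h n * K"
        using j(2) h_pos[of n] M by (intro mult_right_mono) (auto simp: K_def)
      finally show ?thesis by simp
    qed
    have "(\<lambda>n. h n * K) \<longlonglongrightarrow> 0 * K" by (intro tendsto_intros h_tendsto)
    then have "\<forall>\<^sub>F n in sequentially. h n * K < e / 2" by (rule order_tendstoD) (use p in simp)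
    then show "\<forall>\<^sub>F n in sequentially. p (E n (t + s) x - E n t (E n s x) - 0) < e"
    proof (rule eventually_mono)
      fix n assume n: "h n * K < e / 2"
      have "E n (t + s) x - E n t (E n s x) =
          (E n (t + s) (x - y) - E n t (E n s (x - y))) + (E n (t + s) y - E n t (E n s y))"
        by (simp add: linear_diff[OF linear_E])
      then have "p (E n (t + s) x - E n t (E n s x)) \<le>
          (p (E n (t + s) (x - y)) + p (E n t (E n s (x - y)))) + p (E n (t + s) y - E n t (E n s y))"
        using sn_triangle[OF p(1)] sn_diff[OF p(1)] add_right_mono order_trans by metis
      moreover have "p (E n (t + s) (x - y)) \<le> e / 4"
        using E_dominated[OF y(3) p(1), of "t + s" n] t e'(2) by simp
      moreover have "p (E n t (E n s (x - y))) \<le> e / 4"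
        using dominated_le[OF y(3) p(1) le[of n]] e'(2) by (simp add: EE)
      moreover have "p (E n (t + s) y - E n t (E n s y)) < e / 2"
        using sn_le_norm[OF p(1), of "E n (t + s) y - E n t (E n s y)"] y_le[of n] n by linarith
      ultimately show "p (E n (t + s) x - E n t (E n s x) - 0) < e" by simp
    qed
  qed
  from tl_add[OF this E_E_tl[OF t, of x]]
  show ?thesis using t by (intro S_eqI) simp_all
qed

section \<open>Identification of the generator\<close>

lemma S_generator_bdd:
  assumes "x \<in> D"
  shows "bdd_above ((\<lambda>t. (1 / t) * norm (S t x - x)) ` {0<..1})"
proof (rule bdd_aboveI2)
  fix t :: real assume "t \<in> {0<..1}"
  then have t: "0 < t" "t \<le> 1" by auto
  have "norm (S t x - x) \<le> t * (M * exp (\<alpha> * t) * norm (A x))"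
    using S_Lipschitz[OF assms, of 0 t] t by (simp add: S_0)
  also have "\<dots> \<le> t * (M * exp \<alpha> * norm (A x))"
    using t M \<alpha> by (intro mult_left_mono mult_right_mono) (auto simp: mult_left_le)
  finally show "(1 / t) * norm (S t x - x) \<le> M * exp \<alpha> * norm (A x)"
    using t by (simp add: pos_divide_le_eq mult.commute)
qed

text \<open>The discrete form of writing \<open>S t x - x - t A x\<close> as the integral of
  \<open>S r (A x) - A x\<close> over [0, t]: the k-th Euler step adds
  \<open>h (J n)\<^sup>k (A x)\<close>.\<close>

lemma S_increment:
  assumes x: "x \<in> D" and p: "p \<in> P" and t: "t \<ge> 0"
    and c: "\<And>n k. real k * h n \<le> t \<Longrightarrow> p ((J n ^^ k) (A x) - A x) \<le> c"
  shows "p (S t x - x - t *\<^sub>R A x) \<le> t * c"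
proof (rule tl_le[OF _ p])
  show "tl (\<lambda>n. E n t x - x - (real (steps n t) * h n) *\<^sub>R A x) (S t x - x - t *\<^sub>R A x)"
    by (intro tl_diff tl_scaleR tl_const E_tl t steps_tendsto)
  show "(\<lambda>n. (real (steps n t) * h n) * c) \<longlonglongrightarrow> t * c"
    by (intro tendsto_intros steps_tendsto t)
  have "p ((J n ^^ k) x - x - (real k * h n) *\<^sub>R A x) \<le> real k * h n * c"
    if "real k * h n \<le> t" for n k
    using that
  proof (induction k)
    case (Suc k)
    have "real k * h n \<le> t"
      using Suc.prems h_pos[of n] by (simp add: algebra_simps)
    note IH = Suc.IH[OF this]
    have "(J n ^^ Suc k) x - (J n ^^ k) x = (J n ^^ k) (J n x - x)"
      by (simp add: linear_diff[OF linear_Jk] funpow_swap1)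
    also have "\<dots> = h n *\<^sub>R (J n ^^ Suc k) (A x)"
      by (simp add: J_minus_id[OF x] linear_scale[OF linear_Jk] funpow_swap1)
    finally have "(J n ^^ Suc k) x - x - (real (Suc k) * h n) *\<^sub>R A x =
        h n *\<^sub>R ((J n ^^ Suc k) (A x) - A x) + ((J n ^^ k) x - x - (real k * h n) *\<^sub>R A x)"
      by (simp add: algebra_simps del: funpow.simps)
    then have "p ((J n ^^ Suc k) x - x - (real (Suc k) * h n) *\<^sub>R A x) \<le>
        h n * p ((J n ^^ Suc k) (A x) - A x) + real k * h n * c"
      using sn_triangle[OF p, of "h n *\<^sub>R ((J n ^^ Suc k) (A x) - A x)"
          "(J n ^^ k) x - x - (real k * h n) *\<^sub>R A x"] IH h_pos[of n]
      by (simp only: sn_scaleR[OF p] abs_of_pos)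
    also have "h n * p ((J n ^^ Suc k) (A x) - A x) \<le> h n * c"
      using h_pos[of n] Suc.prems by (intro mult_left_mono c) auto
    finally show ?case by (simp add: algebra_simps del: funpow.simps)
  qed (simp add: sn_zero[OF p])
  then show "\<forall>\<^sub>F n in sequentially. p (E n t x - x - (real (steps n t) * h n) *\<^sub>R A x) \<le> real (steps n t) * h n * c"
    unfolding E_def using steps_le[OF t] by simp
qed

text \<open>By \<open>S_increment\<close> it suffices that \<open>(J n)\<^sup>k (A x)\<close> stays
  near A x for k h at most t. As A x need not lie in D, it is replaced by some y in D, for which the
  displacement is Lipschitz in time.\<close>

lemma S_generator_limit:
  assumes x: "x \<in> D"
  shows "limitin \<tau>P (\<lambda>t. (1 / t) *\<^sub>R (S t x - x)) (A x) (at_right 0)"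
  unfolding limitin_\<tau>P
proof (intro ballI tendstoI)
  fix p and e :: real assume p: "p \<in> P" "e > 0"
  \<comment> \<open>The time horizon is 1, and the error \<open>A x - y\<close> enters twice, once
    along the Euler orbit and once at its start.\<close>
  define e' where "e' = e / 8 * exp (- \<alpha>)"
  have e': "e' > 0" "e' * exp \<alpha> = e / 8" using p by (auto simp: e'_def mult_exp_exp)
  obtain y where y: "y \<in> D" "A y \<in> D" "dominated p (A x - y) e'"
    using D2_dense[OF p(1) e'(1)] by blast
  define K where "K = M * exp \<alpha> * norm (A y)"
  have K: "K \<ge> 0" using M by (simp add: K_def)
  have bound: "p ((1 / t) *\<^sub>R (S t x - x) - A x) \<le> e / 2 + t * K" if t: "0 < t" "t \<le> 1" for t
  proof -
    have "p ((J n ^^ k) (A x) - A x) \<le> e / 2 + t * K" if k: "real k * h n \<le> t" for n k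
    proof -
      have 1: "p ((J n ^^ k) (A x - y)) \<le> e / 8"
        using dominated_le[OF y(3) p(1), of k n 1] k t e' by simp
      have 2: "p (A x - y) \<le> e / 8"
        using dominated_le[OF y(3) p(1), of 0 n 1] e' by simp
      have "norm ((J n ^^ k) y - y) \<le> real k * h n * K"
        using Jk_Lipschitz[OF y(1), of 0 k n 1] k t by (simp add: K_def)
      also have "\<dots> \<le> t * K" using k K by (intro mult_right_mono) auto
      finally have 3: "p ((J n ^^ k) y - y) \<le> t * K"
        using sn_le_norm[OF p(1)] order_trans by blast
      have "(J n ^^ k) (A x) - A x = ((J n ^^ k) (A x - y) - (A x - y)) + ((J n ^^ k) y - y)"
        by (simp add: linear_diff[OF linear_Jk])
      then have "p ((J n ^^ k) (A x) - A x) \<le> (p ((J n ^^ k) (A x - y)) + p (A x - y)) + p ((J n ^^ k) y - y)"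
        using sn_triangle[OF p(1)] sn_diff[OF p(1)] add_right_mono order_trans by metis
      then show ?thesis using 1 2 3 p(2) by linarith
    qed
    then have *: "p (S t x - x - t *\<^sub>R A x) \<le> t * (e / 2 + t * K)"
      using t by (intro S_increment x p) auto
    have "(1 / t) *\<^sub>R (S t x - x) - A x = (1 / t) *\<^sub>R (S t x - x - t *\<^sub>R A x)"
      using t by (simp add: algebra_simps)
    then have "p ((1 / t) *\<^sub>R (S t x - x) - A x) = p (S t x - x - t *\<^sub>R A x) / t"
      using t by (simp add: sn_scaleR[OF p(1)])
    also have "\<dots> \<le> e / 2 + t * K" using * t by (simp add: pos_divide_le_eq mult.commute)
    finally show ?thesis .
  qed
  define d where "d = min 1 (e / 4 / (K + 1))"
  have d: "d > 0" "d \<le> 1" "d * K < e / 2"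
  proof -
    show "d > 0" "d \<le> 1" using p K by (auto simp: d_def)
    have "d * K \<le> e / 4 / (K + 1) * K" using K by (intro mult_right_mono) (auto simp: d_def)
    also have "\<dots> \<le> e / 4" using K p by (simp add: field_simps)
    finally show "d * K < e / 2" using p by simp
  qed
  have "p ((1 / t) *\<^sub>R (S t x - x) - A x) < e" if "0 < t" "t < d" for t
    using bound[of t] that d K mult_right_mono[of t d K] by linarith
  then show "\<forall>\<^sub>F t in at_right 0. dist (p ((1 / t) *\<^sub>R (S t x - x) - A x)) 0 < e"
    unfolding eventually_at_right_field using d(1) by (intro exI[of _ d]) (simp add: sn_nonneg[OF p(1)])
qed

sublocale bi_semigroup smul P S M \<omega>
  by (intro bi_semigroup.intro bi_semigroup_axioms.intro)
    (fact norming_seminorms_axioms S_linear S_0 S_add M S_norm S_cont S_equi)+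

text \<open>The generator first appears with its own domain D' and values picked by
  \<open>SOME\<close>. Once D' = D is known, A can take the place of A', since the predicate tests
  values on the domain only.\<close>

lemma A_generator:
  assumes l: "l > \<omega>" and surj: "\<And>y. \<exists>x\<in>D. l *\<^sub>R x - A x = y"
  shows "bi_generator \<tau>P S D A"
proof -
  define D' where "D' = {x. (\<exists>y. limitin \<tau>P (\<lambda>t. (1 / t) *\<^sub>R (S t x - x)) y (at_right 0)) \<and>
    bdd_above ((\<lambda>t. (1 / t) * norm (S t x - x)) ` {0<..1})}"
  define A' where "A' x = (SOME y. limitin \<tau>P (\<lambda>t. (1 / t) *\<^sub>R (S t x - x)) y (at_right 0))" for x
  have A': "limitin \<tau>P (\<lambda>t. (1 / t) *\<^sub>R (S t x - x)) (A' x) (at_right 0)" if "x \<in> D'" for x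
    using that unfolding A'_def D'_def by (auto intro: someI_ex)
  then have gen: "bi_generator \<tau>P S D' A'" unfolding bi_generator_def D'_def by simp
  have "x \<in> D'" if "x \<in> D" for x
    unfolding D'_def using S_generator_bdd[OF that] S_generator_limit[OF that] by auto
  then have sub: "D \<subseteq> D'" by blast
  have eq: "A' x = A x" if "x \<in> D" for x
    using tl_unique[OF tl_at_right[OF A'] tl_at_right[OF S_generator_limit]] sub that by blast
  have "D' = D" using generator_unique_extension[OF gen sub eq l surj] by blast
  then show ?thesis using gen eq unfolding bi_generator_def by metis
qed

end

section \<open>Passage between orbit estimates and the stated notions\<close>

context bi_semigroup
begin

lemma onorm_S: "t \<ge> 0 \<Longrightarrow> onorm (S t) \<le> M * exp (\<omega> * t)"
  using M S_bound by (intro onorm_bound) auto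

lemma bounded_operator_S: "t \<ge> 0 \<Longrightarrow> bounded_operator smul (S t)"
  unfolding bounded_operator_def
  using linear_S[of t] S_bound[of t] S_linear[of t]
  by (auto intro!: bounded_linear_intro[of "S t" "M * exp (\<omega> * t)"] simp: linear_add linear_scale mult.commute)

lemma operator_semigroup_S: "operator_semigroup smul S"
  unfolding operator_semigroup_def by (auto simp: S_linear S_0 S_add fun_eq_iff)

lemma exponentially_bounded_S: "exponentially_bounded S"
  unfolding exponentially_bounded_def
proof (intro exI bdd_aboveI2)
  fix t :: real assume "t \<in> {0..}"
  then have t: "t \<ge> 0" by simp
  show "onorm (\<lambda>x. exp (- \<omega> * t) *\<^sub>R S t x) \<le> M"
  proof (rule onorm_bound)
    show "norm (exp (- \<omega> * t) *\<^sub>R S t x) \<le> M * norm x" for x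
      using mult_left_mono[OF S_bound[OF t, of x], of "exp (- \<omega> * t)"]
      by (simp add: exp_minus field_simps)
  qed (use M in simp)
qed

lemma locally_bi_continuous_S: "locally_bi_continuous smul \<tau>P S"
  unfolding locally_bi_continuous_def
proof (intro conjI allI impI)
  fix x
  show "continuous_map (top_of_set {0..}) \<tau>P (\<lambda>t. S t x)"
    unfolding continuous_map_into_\<tau>P
  proof (intro ballI allI impI)
    fix p t and e :: real
    assume p: "p \<in> P" and t: "t \<in> topspace (top_of_set {0::real..})" and e: "e > 0"
    obtain d where d: "d > 0" "\<And>s. s \<ge> 0 \<Longrightarrow> \<bar>s - t\<bar> < d \<Longrightarrow> p (S s x - S t x) < e"
      using S_cont[OF _ p e, of t x] t by auto
    have "openin (top_of_set {0..}) ({0..} \<inter> ball t d)" by (simp add: openin_open_Int)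
    then show "\<exists>U. openin (top_of_set {0..}) U \<and> t \<in> U \<and> (\<forall>s\<in>U. p (S s x - S t x) < e)"
      using d t by (intro exI[of _ "{0..} \<inter> ball t d"]) (auto simp: dist_real_def abs_minus_commute)
  qed
next
  fix N :: "real set" assume N: "compact N \<and> N \<subseteq> {0..}"
  obtain T where T: "\<And>t. t \<in> N \<Longrightarrow> \<bar>t\<bar> \<le> T"
    using compact_imp_bounded[of N] N by (auto simp: bounded_iff)
  have NT: "N \<subseteq> {0..T}" using T N by fastforce
  show "bdd_above ((\<lambda>t. onorm (S t)) ` N)"
  proof (rule bdd_aboveI2)
    fix t assume "t \<in> N"
    then have t: "0 \<le> t" "t \<le> T" using NT by auto
    have "\<omega> * t \<le> \<bar>\<omega>\<bar> * T" using t by (intro mult_mono) auto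
    then have "M * exp (\<omega> * t) \<le> M * exp (\<bar>\<omega>\<bar> * T)" using M by simp
    then show "onorm (S t) \<le> M * exp (\<bar>\<omega>\<bar> * T)" using onorm_S[OF t(1)] by linarith
  qed
  show "bi_equicontinuous \<tau>P N S"
    unfolding bi_equicontinuous_\<tau>P
  proof (intro allI impI ballI, elim conjE)
    fix u C p and e :: real
    assume u: "\<forall>n. norm (u n) \<le> C" "tl u 0" and p: "p \<in> P" "e > 0"
    show "\<forall>\<^sub>F n in sequentially. \<forall>t\<in>N. p (S t (u n)) < e"
      using S_equi[OF u(1)[rule_format] u(2) p, of T]
      by (rule eventually_mono) (use NT in blast)
  qed
qed (rule bounded_operator_S)

end

context norming_seminorms
begin

lemma bi_semigroupI:
  assumes "operator_semigroup smul S" "locally_bi_continuous smul \<tau>P S" "M \<ge> 1"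
    and "\<And>t. t \<ge> 0 \<Longrightarrow> onorm (S t) \<le> M * exp (\<omega> * t)"
  shows "bi_semigroup smul P S M \<omega>"
proof (intro bi_semigroup.intro bi_semigroup_axioms.intro)
  show "norming_seminorms smul P" by (fact norming_seminorms_axioms)
  show "M \<ge> 1" by fact
  show "Vector_Spaces.linear smul smul (S t)" if "t \<ge> 0" for t
    using assms(1) that unfolding operator_semigroup_def by blast
  show "S 0 x = x" for x
    using assms(1) unfolding operator_semigroup_def by simp
  show "S (t + s) x = S t (S s x)" if "t \<ge> 0" "s \<ge> 0" for t s x
    using assms(1) that unfolding operator_semigroup_def by simp
  show "norm (S t x) \<le> M * exp (\<omega> * t) * norm x" if "t \<ge> 0" for t x
  proof -
    have "bounded_linear (S t)"
      using assms(2) that unfolding locally_bi_continuous_def bounded_operator_def by blast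
    then have "norm (S t x) \<le> onorm (S t) * norm x" by (rule onorm)
    also have "\<dots> \<le> M * exp (\<omega> * t) * norm x" using assms(4)[OF that] by (rule mult_right_mono) simp
    finally show ?thesis .
  qed
  show "\<exists>d>0. \<forall>s\<ge>0. \<bar>s - t\<bar> < d \<longrightarrow> p (S s x - S t x) < e" if "t \<ge> 0" "p \<in> P" "e > 0" for t p e x
  proof -
    have "continuous_map (top_of_set {0..}) \<tau>P (\<lambda>t. S t x)"
      using assms(2) unfolding locally_bi_continuous_def by blast
    from this[unfolded continuous_map_into_\<tau>P, rule_format, OF that(2) _ that(3), of t] that(1)
    obtain U where U: "openin (top_of_set {0..}) U" "t \<in> U" "\<And>s. s \<in> U \<Longrightarrow> p (S s x - S t x) < e"
      by auto
    obtain d where "d > 0" "ball t d \<inter> {0..} \<subseteq> U"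
      using U(1,2) unfolding openin_contains_ball by blast
    then show ?thesis
      using U(3) by (intro exI[of _ d]) (auto simp: dist_real_def abs_minus_commute subset_iff)
  qed
  show "\<forall>\<^sub>F n in sequentially. \<forall>t\<in>{0..T}. p (S t (u n)) < e"
    if "\<And>n. norm (u n) \<le> C" "tl u 0" "p \<in> P" "e > 0" for u C p e T
  proof -
    have "bi_equicontinuous \<tau>P {0..T} S"
      using assms(2) unfolding locally_bi_continuous_def by simp
    from this[unfolded bi_equicontinuous_\<tau>P, rule_format, OF conjI[OF allI[OF that(1)] that(2)] that(3,4)]
    show ?thesis by simp
  qed
qed

lemma hille_yosida:
  assumes operator: "linear_operator smul D A" and M: "M \<ge> 1"
    and dense: "bi_densely_defined \<tau>P D"
    and res: "\<And>l. l > \<omega> \<Longrightarrow> of_real l \<in> resolvent_set smul D A"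
    and bound: "\<And>l m. l > \<omega> \<Longrightarrow> m \<ge> 1 \<Longrightarrow>
      onorm (\<lambda>x. (l - \<omega>) ^ m *\<^sub>R (resolvent smul D A (of_real l) ^^ m) x) \<le> M"
    and equi: "\<beta> > \<omega>" "bi_equicontinuous \<tau>P {(s, m). s > \<beta> \<and> (m::nat) \<ge> 1}
      (\<lambda>(s, m) x. (s - \<beta>) ^ m *\<^sub>R (resolvent smul D A (of_real s) ^^ m) x)"
  obtains S where "bi_semigroup smul P S M \<omega>" "bi_generator \<tau>P S D A"
proof -
  define R where "R l = resolvent smul D A (of_real l)" for l :: real
  have bij: "bij_betw (\<lambda>x. l *\<^sub>R x - A x) D UNIV"
    and R_linear: "Vector_Spaces.linear smul smul (R l)" and R_bounded: "bounded_linear (R l)"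
    and R_eq: "R l = the_inv_into D (\<lambda>x. l *\<^sub>R x - A x)"
    if "l > \<omega>" for l
    using res[OF that] unfolding resolvent_set_def bounded_operator_def R_def resolvent_def
    by (simp_all add: smul_of_real)
  have R_D: "R l x \<in> D" if "l > \<omega>" for l x
    unfolding R_eq[OF that] using bij[OF that]
    by (intro the_inv_into_into) (auto simp: bij_betw_def)
  have R_right: "l *\<^sub>R R l x - A (R l x) = x" if "l > \<omega>" for l x
    unfolding R_eq[OF that] using f_the_inv_into_f_bij_betw[OF bij[OF that]] by simp
  have R_left: "R l (l *\<^sub>R x - A x) = x" if "l > \<omega>" "x \<in> D" for l x
    unfolding R_eq[OF that(1)] using the_inv_into_f_f[OF bij_betw_imp_inj_on[OF bij[OF that(1)]] that(2)] .
  have Rk_bounded: "bounded_linear (R l ^^ m)" if "l > \<omega>" for l m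
  proof (induction m)
    case (Suc m)
    then show ?case using bounded_linear_compose[OF R_bounded[OF that] Suc] by (simp add: o_def)
  qed (simp add: bounded_linear_ident id_def)
  have R_norm: "norm ((l - \<omega>) ^ m *\<^sub>R (R l ^^ m) x) \<le> M * norm x" if l: "l > \<omega>" for l m x
  \<comment> \<open>The resolvent estimates start at m = 1, while Euler powers start at 0; M at
    least 1 covers the identity.\<close>
  proof (cases "m = 0")
    case True
    then show ?thesis using M mult_right_mono[of 1 M "norm x"] by simp
  next
    case False
    have "bounded_linear (\<lambda>x. (l - \<omega>) ^ m *\<^sub>R (R l ^^ m) x)"
      using Rk_bounded[OF l] by (rule bounded_linear_const_scaleR)
    then have "norm ((l - \<omega>) ^ m *\<^sub>R (R l ^^ m) x) \<le> onorm (\<lambda>x. (l - \<omega>) ^ m *\<^sub>R (R l ^^ m) x) * norm x"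
      by (rule onorm)
    also have "\<dots> \<le> M * norm x"
      using bound[OF l, of m] False unfolding R_def by (intro mult_right_mono) auto
    finally show ?thesis .
  qed
  \<comment> \<open>b dominates \<omega>, \<beta> and 1, and n0 ensures
    \<open>h n * b \<le> 1 / 2\<close>. For c at most b then \<open>1 - h n * c \<ge> 1 / 2\<close>,
    whence \<open>1 / h n > c\<close> and \<open>c / (1 - h n * c) \<le> 2 * b\<close>. With c =
    \<omega> and c = \<beta> this gives the common rate 2 b of the scheme.\<close>
  define b where "b = \<bar>\<omega>\<bar> + \<bar>\<beta>\<bar> + 1"
  obtain n0 where n0: "2 * b < 2 ^ n0" using real_arch_pow[of 2 "2 * b"] by auto
  define h :: "nat \<Rightarrow> real" where "h n = 1 / 2 ^ (n + n0)" for n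
  have h: "h n > 0" "h n * b \<le> 1 / 2" for n
  proof -
    show "h n > 0" by (simp add: h_def)
    have "(2::real) ^ n0 \<le> 2 ^ (n + n0)" by (intro power_increasing) auto
    then have "2 * b \<le> 2 ^ (n + n0)" using n0 by linarith
    then show "h n * b \<le> 1 / 2" by (simp add: h_def field_simps)
  qed
  have b: "b \<ge> 1" "\<omega> \<le> b" "\<beta> \<le> b" by (auto simp: b_def)
  have h_le: "h n * c \<le> 1 / 2" if "c \<le> b" for c n
    using mult_left_mono[OF that, of "h n"] h[of n] by linarith
  have quot: "c / (1 - h n * c) \<le> 2 * b" if "c \<le> b" for c n
  proof (cases "c \<ge> 0")
    case True
    have "c / (1 - h n * c) \<le> c / (1 / 2)"
      using h_le[OF that, of n] True by (intro divide_left_mono) auto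
    then show ?thesis using that by simp
  next
    case False
    then have "c / (1 - h n * c) \<le> 0" using h_le[OF that, of n] by (intro divide_nonpos_pos) auto
    then show ?thesis using b by linarith
  qed
  have inv_h: "1 / h n > c" if "c \<le> b" for c n
  proof -
    have "h n * c < 1" using h_le[OF that, of n] by linarith
    then show ?thesis using h(1)[of n] by (simp add: pos_less_divide_eq mult.commute)
  qed
  \<comment> \<open>For s = 1 / h the quotient \<open>s / (s - c)\<close> is
    \<open>1 / (1 - h c)\<close>. This trades the weight \<open>s ^ k\<close> in the powers of J n
    for the weight \<open>(s - c) ^ k\<close> of the resolvent estimates.\<close>
  have pow: "(1 / h n) ^ k \<le> exp (real k * h n * (c / (1 - h n * c))) * (1 / h n - c) ^ k"
    if "c \<le> b" for c n k
  proof -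
    have c: "h n * c < 1" using h_le[OF that, of n] by linarith
    have "(1 / h n) = 1 / (1 - h n * c) * (1 / h n - c)"
      using c h(1)[of n] by (simp add: field_simps)
    also have "\<dots> \<le> exp (h n * c / (1 - h n * c)) * (1 / h n - c)"
      using one_over_one_minus_le_exp[OF c] inv_h[OF that, of n] by (intro mult_right_mono) auto
    finally have "(1 / h n) ^ k \<le> (exp (h n * c / (1 - h n * c)) * (1 / h n - c)) ^ k"
      using h(1)[of n] by (intro power_mono) auto
    also have "\<dots> = exp (real k * h n * (c / (1 - h n * c))) * (1 / h n - c) ^ k"
      by (simp add: power_mult_distrib exp_of_nat_mult[symmetric] mult.assoc)
    finally show ?thesis .
  qed
  define J where "J n x = (1 / h n) *\<^sub>R R (1 / h n) x" for n x
  note h_\<omega> = inv_h[OF b(2)]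
  have lin_R: "linear (R (1 / h n))" for n by (rule real_linear[OF R_linear[OF h_\<omega>]])
  have Jk: "(J n ^^ k) x = (1 / h n) ^ k *\<^sub>R (R (1 / h n) ^^ k) x" for n k x
    by (induction k) (simp_all add: J_def linear_scale[OF lin_R] mult.commute)
  interpret euler_scheme smul P D A J n0 h M \<omega> "2 * b"
  proof unfold_locales
    show "linear_operator smul D A" "bi_densely_defined \<tau>P D" "M \<ge> 1" by fact+
    show "h n = 1 / 2 ^ (n + n0)" for n by (simp add: h_def)
    show "2 * b \<ge> 0" using b by simp
    show "\<omega> / (1 - h n * \<omega>) \<le> 2 * b" for n by (rule quot[OF b(2)])
    show "J n (x + y) = J n x + J n y" for n x y
      by (simp add: J_def linear_add[OF lin_R] scaleR_right_distrib)
    show "J n (smul c x) = smul c (J n x)" for n c x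
    proof -
      have "R (1 / h n) (smul c x) = smul c (R (1 / h n) x)"
        using module_hom.scale[of smul smul "R (1 / h n)"] R_linear[OF h_\<omega>[of n]]
        unfolding module_hom_iff_linear by blast
      then show ?thesis by (simp add: J_def scale_left_commute flip: smul_of_real)
    qed
    show "J n x \<in> D" for n x
      using operator R_D[OF h_\<omega>] subspace_scale[of D _ "of_real (1 / h n)"]
      unfolding linear_operator_def J_def smul_of_real by blast
    have A_J: "A (J n x) = (1 / h n) *\<^sub>R A (R (1 / h n) x)" for n x
      using operator R_D[OF h_\<omega>] unfolding linear_operator_def J_def smul_of_real[symmetric] by blast
    show "J n x - h n *\<^sub>R A (J n x) = x" for n x
      using R_right[OF h_\<omega>, of n x] h(1)[of n] unfolding A_J by (simp add: J_def)
    show "J n (x - h n *\<^sub>R A x) = x" if "x \<in> D" for n x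
    proof -
      have "J n (x - h n *\<^sub>R A x) = R (1 / h n) ((1 / h n) *\<^sub>R (x - h n *\<^sub>R A x))"
        by (simp add: J_def linear_scale[OF lin_R])
      also have "(1 / h n) *\<^sub>R (x - h n *\<^sub>R A x) = (1 / h n) *\<^sub>R x - A x"
        using h(1)[of n] by (simp add: scaleR_diff_right)
      finally show ?thesis using R_left[OF h_\<omega> that] by simp
    qed
    show "norm ((J n ^^ k) x) \<le> M * exp (real k * h n * (\<omega> / (1 - h n * \<omega>))) * norm x" for n k x
    proof -
      let ?E = "exp (real k * h n * (\<omega> / (1 - h n * \<omega>)))"
      have "norm ((J n ^^ k) x) = (1 / h n) ^ k * norm ((R (1 / h n) ^^ k) x)"
        unfolding Jk norm_scaleR using h(1)[of n] by simp
      also have "\<dots> \<le> ?E * (1 / h n - \<omega>) ^ k * norm ((R (1 / h n) ^^ k) x)"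
        by (intro mult_right_mono pow b) simp
      also have "\<dots> = ?E * norm ((1 / h n - \<omega>) ^ k *\<^sub>R (R (1 / h n) ^^ k) x)"
        using h_\<omega>[of n] by simp
      also have "\<dots> \<le> ?E * (M * norm x)" by (intro mult_left_mono R_norm h_\<omega>) simp
      finally show ?thesis by (simp add: mult_ac)
    qed
    show "\<forall>\<^sub>F i in sequentially. \<forall>n k. p ((J n ^^ k) (u i)) \<le> e * exp (2 * b * (real k * h n))"
      if u: "\<And>i. norm (u i) \<le> C" "tl u 0" and p: "p \<in> P" "e > 0" for u C p e
    proof -
      \<comment> \<open>Supplies the power k = 0, which the bi-equicontinuous family with m at least
        1 leaves out.\<close>
      have "\<forall>\<^sub>F i in sequentially. p (u i) < e" using tl_eventually[OF u(2) p] by simp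
      moreover have "\<forall>\<^sub>F i in sequentially. \<forall>j\<in>{(s, m). s > \<beta> \<and> (m::nat) \<ge> 1}.
          p ((case j of (s, m) \<Rightarrow> \<lambda>x. (s - \<beta>) ^ m *\<^sub>R (R s ^^ m) x) (u i)) < e"
        using equi(2)[unfolded bi_equicontinuous_\<tau>P, rule_format, OF conjI[OF allI[OF u(1)] u(2)] p]
        unfolding R_def by simp
      ultimately show ?thesis
      proof eventually_elim
        case (elim i)
        have "p ((J n ^^ k) (u i)) \<le> e * exp (2 * b * (real k * h n))" for n k
        proof -
          let ?E = "exp (real k * h n * (\<beta> / (1 - h n * \<beta>)))"
          have \<beta>: "1 / h n > \<beta>" by (rule inv_h[OF b(3)])
          have le: "p ((1 / h n - \<beta>) ^ k *\<^sub>R (R (1 / h n) ^^ k) (u i)) \<le> e"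
          proof (cases "k = 0")
            case True
            then show ?thesis using elim(1) by simp
          next
            case False
            then show ?thesis using elim(2)[rule_format, of "(1 / h n, k)"] \<beta> by simp
          qed
          have "p ((J n ^^ k) (u i)) = (1 / h n) ^ k * p ((R (1 / h n) ^^ k) (u i))"
            unfolding Jk sn_scaleR[OF p(1)] using h(1)[of n] by simp
          also have "\<dots> \<le> ?E * (1 / h n - \<beta>) ^ k * p ((R (1 / h n) ^^ k) (u i))"
            by (intro mult_right_mono pow b sn_nonneg p)
          also have "\<dots> = ?E * p ((1 / h n - \<beta>) ^ k *\<^sub>R (R (1 / h n) ^^ k) (u i))"
            unfolding sn_scaleR[OF p(1)] using \<beta> by simp
          also have "\<dots> \<le> ?E * e" by (intro mult_left_mono le) simp
          also have "\<dots> \<le> exp (2 * b * (real k * h n)) * e"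
          proof -
            have "real k * h n * (\<beta> / (1 - h n * \<beta>)) \<le> real k * h n * (2 * b)"
              using h(1)[of n] by (intro mult_left_mono quot b) simp
            then show ?thesis using p(2) by (simp add: mult_ac)
          qed
          finally show ?thesis by (simp add: mult.commute)
        qed
        then show ?case by blast
      qed
    qed
  qed
  have "\<exists>x\<in>D. (\<omega> + 1) *\<^sub>R x - A x = y" for y
    using R_right[of "\<omega> + 1" y] R_D[of "\<omega> + 1" y] by (intro bexI[of _ "R (\<omega> + 1) y"]) auto
  then have "bi_generator \<tau>P S D A" by (intro A_generator[of "\<omega> + 1"]) auto
  then show thesis using that bi_semigroup_axioms by blast
qed

end

theorem corollary6p8:
  fixes smul :: "'k::real_normed_field \<Rightarrow> 'a::real_normed_vector \<Rightarrow> 'a"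
    and \<tau> :: "'a topology"
    and D :: "'a set" and A :: "'a \<Rightarrow> 'a"
    and \<omega> M :: real
  assumes "saks_space smul \<tau>"
    and "seq_complete (mixed_topology smul \<tau>)"
    and "C_sequential (mixed_topology smul \<tau>)"
    and "linear_operator smul D A"
    and "M \<ge> 1"
  shows "(\<exists>S. operator_semigroup smul S \<and> locally_bi_continuous smul \<tau> S \<and> exponentially_bounded S \<and>
              bi_generator \<tau> S D A \<and> (\<forall>t\<ge>0. onorm (S t) \<le> M * exp (\<omega> * t)))
     \<longleftrightarrow>
         (bi_closed \<tau> D A \<and> bi_densely_defined \<tau> D \<and>
          of_real ` {\<omega><..} \<subseteq> resolvent_set smul D A \<and>
          (\<forall>l>\<omega>. \<forall>m\<ge>1::nat.
             onorm (\<lambda>x. (l - \<omega>) ^ m *\<^sub>R (resolvent smul D A (of_real l) ^^ m) x) \<le> M) \<and>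
          (\<forall>\<alpha>>\<omega>. bi_equicontinuous \<tau> {(s, m). s > \<alpha> \<and> (m::nat) \<ge> 1}
             (\<lambda>(s, m) x. (s - \<alpha>) ^ m *\<^sub>R (resolvent smul D A (of_real s) ^^ m) x)))"
    (is "?a \<longleftrightarrow> ?b")
proof -
  obtain P where P: "norming_seminorms smul P" "\<tau> = seminorm_topology P"
    using saks_space_norming_seminorms assms(1,2) by blast
  interpret norming_seminorms smul P by fact
  show ?thesis
  proof
    assume ?a
    then obtain S where S: "operator_semigroup smul S" "locally_bi_continuous smul \<tau>P S"
        "\<And>t. t \<ge> 0 \<Longrightarrow> onorm (S t) \<le> M * exp (\<omega> * t)"
      and gen: "bi_generator \<tau>P S D A"
      unfolding P(2) by blast
    interpret bi_semigroup smul P S M \<omega>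
      using S assms(5) by (intro bi_semigroupI)
    \<comment> \<open>Closedness and density are proved with one fixed point of the resolvent set;
      any number above \<omega> would serve.\<close>
    interpret bi_semigroup_resolvent smul P S M \<omega> "\<omega> + 1"
      by unfold_locales simp
    show ?b
      unfolding P(2)
      using generator_bi_closed[OF gen] generator_bi_densely_defined[OF gen]
        generator_in_resolvent_set[OF gen] generator_resolvent_onorm[OF gen]
        generator_resolvent_bi_equicontinuous[OF gen]
      by auto
  next
    assume b: ?b
    obtain S where S: "bi_semigroup smul P S M \<omega>" "bi_generator \<tau>P S D A"
    \<comment> \<open>The seminorm estimates are taken at rate \<omega> + 1; the exact rate \<omega>
      of the semigroup comes from the norm estimates.\<close>
    proof (rule hille_yosida[OF assms(4,5), of \<omega> "\<omega> + 1"])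
      show "of_real l \<in> resolvent_set smul D A" if "l > \<omega>" for l
        using b that by auto
    qed (use b in \<open>auto simp: P(2)\<close>)
    interpret bi_semigroup smul P S M \<omega> by (fact S(1))
    show ?a
      unfolding P(2)
      using operator_semigroup_S locally_bi_continuous_S exponentially_bounded_S S(2) onorm_S
      by blast
  qed
qed

end
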